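(* Let $M\subset\mathbb{R}^8$ be the Simons cone centered at the origin, let $B\subset\mathbb{R}^8$ be the unit ball centered at the origin, and let $\Omega$ be the deformed ball whose boundary is given in polar coordinates $r>0$, $\omega\in S^7$ by $$r(\omega):=1+K\,\phi\big(d(\omega,M\cap\partial B)\big),$$ where $d(\cdot,\cdot)$ is Euclidean distance, $\phi:[0,\infty)\to[0,\infty)$ is given by $\phi(a):=a^2\chi(a)$, $\chi$ is a smooth non-negative cut-off function vanishing for $|a|\ge 2\upsilon$, and $0<\upsilon\ll 1$ and $K\gg 1$ are suitable positive constants. The domain $\Omega$ is nonconvex, and $\partial\Omega$ can be taken arbitrarily close to $\partial B$ in $C^0$ norm. Then $M$ is area-minimizing in $\Omega$ with respect to arbitrary variations that have boundary on $\partial\Omega$ close to $M\cap\partial\Omega$ in the $C^0$ norm. More precisely, let $N$ be the set bounded by $M$, with $M=\partial N$. If $N'\subset\Omega$ is a competitor for which $M':=\partial N'$ is such that $M'\cap\partial\Omega$ is $C^0$-close to $M\cap\partial\Omega$ $(=M\cap\partial B)$, without necessarily requiring $\mathrm{vol}(N')=\mathrm{vol}(N)$, then $$|M\cap\Omega|<|M'\cap\Omega|\quad\text{unless } M'=M .$$ Thus $N$ is a $C^0$-local minimizer of perimeter in $\Omega$, and in particular it is a local minimizer with respect to its own volume. Consequently $M$ is a singular local minimizer, in $C^0$ norm, of the volume-constrained least area problem in $\Omega$.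
   Context: The Simons cone is $M=\{x\in\mathbb{R}^8: x_1^2+x_2^2+x_3^2+x_4^2=x_5^2+x_6^2+x_7^2+x_8^2\}$, which is singular at the origin. $S^7=\partial B$ is the unit sphere. The set $N$ is the side of the cone for which the field $X$ is the outward normal on $M=\partial N$, where $X$ is the divergence-free unit vector field on the ball of radius $2$, normal to the Simons cone, constructed by Bombieri, De Giorgi and Giusti as a calibration. $|M\cap\Omega|$ and $|M'\cap\Omega|$ denote the $7$-dimensional areas of the parts of $M$ and $M'$ lying inside $\Omega$, that is, the perimeters of $N$ and $N'$ within $\Omega$; $M'=M$ is understood within $\Omega$. $\mathrm{vol}$ denotes volume within $\Omega$. In the volume-constrained least area problem in $\Omega$ one minimizes the area $|\partial N'\cap\Omega|$ among sets $N'\subset\Omega$ of prescribed volume, with no prescription of behavior on $\partial\Omega$. Since $r=1$ on $M\cap\partial B$, one has $M\cap\partial\Omega=M\cap\partial B$. $C^0$-closeness of $M'$ to $M$ is required only of their boundaries on $\partial\Omega$ (equivalently, $N'$ is $C^0$-close to $N$ near $\partial\Omega$). *)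

theory Defs
  imports "HOL-Analysis.Analysis"
begin

section \<open>Sets of finite perimeter\<close>

definition C1_on :: "('a::euclidean_space \<Rightarrow> 'b::real_normed_vector) \<Rightarrow> 'a set \<Rightarrow> bool" where
  "C1_on f U \<longleftrightarrow>
     (\<forall>x\<in>U. f differentiable (at x)) \<and>
     (\<forall>v. continuous_on U (\<lambda>x. frechet_derivative f (at x) v))"

definition divergence :: "('a::euclidean_space \<Rightarrow> 'a) \<Rightarrow> 'a \<Rightarrow> real" where
  "divergence \<psi> x = (\<Sum>b\<in>Basis. frechet_derivative \<psi> (at x) b \<bullet> b)"

definition test_fields :: "'a::euclidean_space set \<Rightarrow> ('a \<Rightarrow> 'a) set" where
  "test_fields \<Omega> = {\<psi>. C1_on \<psi> UNIV \<and> compact (closure {x. \<psi> x \<noteq> 0})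
      \<and> closure {x. \<psi> x \<noteq> 0} \<subseteq> \<Omega> \<and> (\<forall>x. norm (\<psi> x) \<le> 1)}"

text \<open>De Giorgi's perimeter of \<open>E\<close> within the open set \<open>\<Omega>\<close>; it is the area of the part of the
  boundary of \<open>E\<close> that lies inside \<open>\<Omega>\<close>, and nothing on the boundary of \<open>\<Omega>\<close> is counted.\<close>

definition perimeter :: "'a::euclidean_space set \<Rightarrow> 'a set \<Rightarrow> ereal" where
  "perimeter \<Omega> E =
     (SUP \<psi>\<in>test_fields \<Omega>. ereal (set_lebesgue_integral lebesgue E (divergence \<psi>)))"

text \<open>The usual boundary of a set that is only determined up to null sets (for a set of
  finite perimeter: the support of the derivative of its indicator function). For a set with,
  say, Lipschitz boundary this is the topological boundary.\<close>

definition boundary_mod_null :: "'a::euclidean_space set \<Rightarrow> 'a set" where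
  "boundary_mod_null E =
     {x. \<forall>\<rho>>0. \<not> negligible (ball x \<rho> \<inter> E) \<and> \<not> negligible (ball x \<rho> - E)}"

definition boundary_trace :: "'a::euclidean_space set \<Rightarrow> 'a set \<Rightarrow> 'a set" where
  "boundary_trace \<Omega> E = frontier \<Omega> \<inter> closure (\<Omega> \<inter> boundary_mod_null E)"

text \<open>\<open>E'\<close> is \<open>\<delta>\<close>-close to \<open>E\<close> in the \<open>C\<^sup>0\<close> sense at the boundary of \<open>\<Omega>\<close>: near every boundary
  point at distance at least \<open>\<delta>\<close> from the trace of the boundary of \<open>E\<close>, the two sets agree.
  Comparing the traces of the two boundaries alone (say, in Hausdorff distance) would not be
  enough: a thin neighbourhood of the trace of the boundary of \<open>E\<close> has a nearby trace.
  Nothing is required of \<open>E'\<close> away from the boundary of \<open>\<Omega>\<close>.\<close>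

definition C0_close_at_boundary ::
    "real \<Rightarrow> 'a::euclidean_space set \<Rightarrow> 'a set \<Rightarrow> 'a set \<Rightarrow> bool" where
  "C0_close_at_boundary \<delta> \<Omega> E E' \<longleftrightarrow>
     (\<forall>p\<in>frontier \<Omega>. (\<forall>q\<in>boundary_trace \<Omega> E. \<delta> \<le> dist p q) \<longrightarrow>
        (\<exists>\<rho>>0. negligible (\<Omega> \<inter> ball p \<rho> \<inter> ((E - E') \<union> (E' - E)))))"

definition competitor ::
    "real \<Rightarrow> 'a::euclidean_space set \<Rightarrow> 'a set \<Rightarrow> 'a set \<Rightarrow> bool" where
  "competitor \<delta> \<Omega> E E' \<longleftrightarrow>
     E' \<in> sets lebesgue \<and> E' \<subseteq> \<Omega> \<and> C0_close_at_boundary \<delta> \<Omega> E E'"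

definition C0_local_perimeter_minimizer ::
    "'a::euclidean_space set \<Rightarrow> 'a set \<Rightarrow> bool" where
  "C0_local_perimeter_minimizer \<Omega> E \<longleftrightarrow>
     (\<exists>\<delta>>0. \<forall>E'. competitor \<delta> \<Omega> E E' \<longrightarrow> perimeter \<Omega> E \<le> perimeter \<Omega> E')"

definition C0_local_volume_constrained_minimizer ::
    "'a::euclidean_space set \<Rightarrow> 'a set \<Rightarrow> bool" where
  "C0_local_volume_constrained_minimizer \<Omega> E \<longleftrightarrow>
     (\<exists>\<delta>>0. \<forall>E'. competitor \<delta> \<Omega> E E' \<and> measure lebesgue E' = measure lebesgue (E \<inter> \<Omega>) \<longrightarrow>
        perimeter \<Omega> E \<le> perimeter \<Omega> E')"

text \<open>A point of \<open>M\<close> is singular if \<open>M\<close> is not a \<open>C\<^sup>1\<close> (hence not a smooth) embedded hypersurface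
  near it.\<close>

definition singular_point :: "'a::euclidean_space set \<Rightarrow> 'a \<Rightarrow> bool" where
  "singular_point M p \<longleftrightarrow> p \<in> M \<and>
     \<not> (\<exists>U (f :: 'a \<Rightarrow> real). open U \<and> p \<in> U \<and> C1_on f U \<and>
          (\<forall>x\<in>U. frechet_derivative f (at x) \<noteq> (\<lambda>v. 0)) \<and>
          M \<inter> U = {x\<in>U. f x = 0})"


section \<open>The Simons cone and the deformed ball\<close>

text \<open>In the index type \<open>8\<close> the numeral \<open>8\<close> equals \<open>0\<close>, so the indices 1 to 8 are all distinct.\<close>

definition simons_form :: "real ^ 8 \<Rightarrow> real" where
  "simons_form x =
     ((x $ 1)\<^sup>2 + (x $ 2)\<^sup>2 + (x $ 3)\<^sup>2 + (x $ 4)\<^sup>2) -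
     ((x $ 5)\<^sup>2 + (x $ 6)\<^sup>2 + (x $ 7)\<^sup>2 + (x $ 8)\<^sup>2)"

definition simons_cone :: "(real ^ 8) set" where
  "simons_cone = {x. simons_form x = 0}"

text \<open>Which side has the calibrating field as its outward normal depends on the orientation of
  that field; the two sides are exchanged by an isometry that preserves the cone.\<close>

definition simons_sides :: "(real ^ 8) set set" where
  "simons_sides = {{x. simons_form x < 0}, {x. simons_form x > 0}}"

text \<open>The cut-off is called \<open>\<eta>\<close>, as the letter chi is the vector binder in the library.\<close>

definition cutoff :: "real \<Rightarrow> (real \<Rightarrow> real) \<Rightarrow> bool" where
  "cutoff \<upsilon> \<eta> \<longleftrightarrow>
     (\<forall>k. (deriv ^^ k) \<eta> differentiable_on UNIV) \<and>
     (\<forall>a. 0 \<le> \<eta> a) \<and>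
     (\<forall>a. \<bar>a\<bar> \<le> \<upsilon> \<longrightarrow> \<eta> a = 1) \<and>
     (\<forall>a. \<bar>a\<bar> \<ge> 2 * \<upsilon> \<longrightarrow> \<eta> a = 0)"

definition polar_radius :: "real \<Rightarrow> (real \<Rightarrow> real) \<Rightarrow> real ^ 8 \<Rightarrow> real" where
  "polar_radius K \<eta> \<omega> =
     (let \<phi> = (\<lambda>a. a\<^sup>2 * \<eta> a)
      in 1 + K * \<phi> (infdist \<omega> (simons_cone \<inter> sphere 0 1)))"

definition deformed_ball :: "real \<Rightarrow> (real \<Rightarrow> real) \<Rightarrow> (real ^ 8) set" where
  "deformed_ball K \<eta> = {t *\<^sub>R \<omega> | t \<omega>. \<omega> \<in> sphere 0 1 \<and> 0 \<le> t \<and> t < polar_radius K \<eta> \<omega>}"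

end

theory Submission
  imports Defs "HOL-Computational_Algebra.Polynomial" "HOL-Real_Asymp.Real_Asymp"
begin

text \<open>
  Write the cone as \<open>q x = 0\<close> with \<open>q x = x \<bullet> J x\<close>, where \<open>J\<close> is the orthogonal reflection that fixes
  the first four coordinates and reverses the others; \<open>- J\<close> gives the other side. The proof is a
  calibration argument, with a sub-calibration (De Philippis and Paolini) in place of the
  divergence-free field of Bombieri, De Giorgi and Giusti: the unit field \<open>X\<close> in the direction
  of the gradient of \<open>\<bar>y\<bar>\<^sup>4 - \<bar>z\<bar>\<^sup>4\<close> at \<open>x = (y, z)\<close> is explicit, normal to the cone, and its divergence
  is a positive multiple of \<open>q\<^sup>3\<close> (\<open>divergence_X\<close>). If \<open>N = {q < 0}\<close> is replaced by \<open>E\<close>, one adds points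
  where the divergence of \<open>X\<close> is \<open>\<ge> 0\<close> and removes points where it is \<open>< 0\<close>; so the integral of the
  divergence grows, strictly unless \<open>E\<close> and \<open>N\<close> agree up to a null set. By the divergence theorem
  the perimeter grows at least as much, up to the flux of \<open>X\<close> through the part of \<open>\<partial>\<Omega>\<close> where \<open>E\<close>
  and \<open>N\<close> differ.

  The shape of \<open>\<Omega>\<close> gives this boundary flux a sign. With \<open>\<Omega> = {\<rho> > 0}\<close>, the derivative of \<open>\<rho>\<close> along
  \<open>X\<close> near the trace of the cone is a positive multiple of \<open>q\<close> as soon as \<open>K \<ge> 4\<close>
  (\<open>rho_derivative_along_X\<close>, \<open>simons_domain_rho\<close>): the boundary bends away from the cone so fast
  that \<open>X\<close> enters \<open>\<Omega>\<close> where \<open>q > 0\<close> and leaves it where \<open>q < 0\<close>. Closeness at the boundary, together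
  with compactness of \<open>\<partial>\<Omega>\<close>, confines the difference of \<open>E\<close> and \<open>N\<close> to that region (\<open>collar\<close>).

  De Giorgi's definition of the perimeter makes it possible to avoid traces and surface measure.
  The perimeter of \<open>E\<close> is bounded below by testing with \<open>\<theta> g X\<close>, where \<open>g\<close> cuts off at \<open>\<partial>\<Omega>\<close>
  as a monotone function of \<open>\<rho>\<close>, and \<open>\<theta>\<close> cuts off the singularity of \<open>X\<close> at the origin at an
  expense of order \<open>\<epsilon>\<^sup>7\<close>. The perimeter of \<open>N\<close> is bounded above by comparing an
  arbitrary test field with \<open>\<theta> g X\<close> (\<open>flux_le_cut_field\<close>): a field that points out of \<open>N\<close> along the
  cone has nonnegative flux (\<open>calibration_inequality\<close>). Both bounds together leave a gap that does
  not depend on the test field (\<open>strict_flux_gap\<close>).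

  The claims on the shape of \<open>\<Omega>\<close> rest on a formula for the distance of a unit vector to the trace of
  the cone (\<open>unit_infdist_cone\<close>), which depends on \<open>q\<^sup>2\<close> alone.
\<close>

section \<open>Continuously differentiable maps and the divergence theorem\<close>

lemma C1_onI:
  assumes "\<And>x. x \<in> U \<Longrightarrow> (f has_derivative f' x) (at x)"
    and "\<And>v. continuous_on U (\<lambda>x. f' x v)"
  shows "C1_on f U"
proof -
  have eq: "frechet_derivative f (at x) = f' x" if "x \<in> U" for x
    using frechet_derivative_at[OF assms(1)[OF that]] by simp
  have "continuous_on U (\<lambda>x. frechet_derivative f (at x) v)" for v
    using assms(2)[of v] by (rule continuous_on_cong[THEN iffD1, rotated -1]) (auto simp: eq)
  then show ?thesis
    using assms(1) by (auto simp: C1_on_def differentiable_def)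
qed

lemma C1_on_has_derivative:
  assumes "C1_on f U" "x \<in> U"
  shows "(f has_derivative frechet_derivative f (at x)) (at x)"
  using assms by (auto simp: C1_on_def frechet_derivative_works)

lemma C1_on_subset: "C1_on f U \<Longrightarrow> V \<subseteq> U \<Longrightarrow> C1_on f V"
  unfolding C1_on_def by (meson continuous_on_subset subsetD)

lemma C1_on_imp_continuous_on: "C1_on f U \<Longrightarrow> continuous_on U f"
  unfolding C1_on_def
  by (meson continuous_at_imp_continuous_on differentiable_imp_continuous_within)

lemma C1_on_local:
  assumes "\<And>x. x \<in> U \<Longrightarrow> \<exists>V. open V \<and> x \<in> V \<and> C1_on f V"
  shows "C1_on f U"
  unfolding C1_on_def
proof (intro conjI allI ballI)
  fix x assume "x \<in> U"
  then show "f differentiable (at x)" using assms unfolding C1_on_def by blast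
next
  fix v
  have "isCont (\<lambda>x. frechet_derivative f (at x) v) x" if "x \<in> U" for x
  proof -
    obtain V where V: "open V" "x \<in> V" "C1_on f V" using assms[OF \<open>x \<in> U\<close>] by blast
    then have "continuous_on V (\<lambda>x. frechet_derivative f (at x) v)" by (simp add: C1_on_def)
    then show ?thesis using V by (simp add: continuous_on_eq_continuous_at)
  qed
  then show "continuous_on U (\<lambda>x. frechet_derivative f (at x) v)"
    by (simp add: continuous_at_imp_continuous_on)
qed

lemma C1_on_cong_open:
  assumes "C1_on f U" "open U" "\<And>x. x \<in> U \<Longrightarrow> g x = f x"
  shows "C1_on g U"
proof (rule C1_onI)
  show "(g has_derivative frechet_derivative f (at x)) (at x)" if "x \<in> U" for x
    using has_derivative_transform_within_open[OF C1_on_has_derivative[OF assms(1) that] assms(2) that]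
      assms(3) by simp
  show "continuous_on U (\<lambda>x. frechet_derivative f (at x) v)" for v
    using assms(1) by (simp add: C1_on_def)
qed

lemma C1_on_bounded_linear: "bounded_linear f \<Longrightarrow> C1_on f U"
  by (rule C1_onI[where f' = "\<lambda>_. f"]) (auto intro: bounded_linear_imp_has_derivative)

lemma C1_on_const: "C1_on (\<lambda>x. c) U"
  by (rule C1_onI[where f' = "\<lambda>_ _. 0"]) auto

lemma C1_on_add:
  assumes "C1_on f U" "C1_on g U"
  shows "C1_on (\<lambda>x. f x + g x) U"
proof (rule C1_onI)
  show "((\<lambda>x. f x + g x) has_derivative
      (\<lambda>v. frechet_derivative f (at x) v + frechet_derivative g (at x) v)) (at x)" if "x \<in> U" for x
    using that by (intro has_derivative_add C1_on_has_derivative[OF assms(1)] C1_on_has_derivative[OF assms(2)])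
  show "continuous_on U (\<lambda>x. frechet_derivative f (at x) v + frechet_derivative g (at x) v)" for v
    using assms by (intro continuous_on_add) (auto simp: C1_on_def)
qed

lemma C1_on_bilinear:
  assumes b: "bounded_bilinear p" and "C1_on f U" "C1_on g U"
  shows "C1_on (\<lambda>x. p (f x) (g x)) U"
proof (rule C1_onI)
  show "((\<lambda>x. p (f x) (g x)) has_derivative
      (\<lambda>v. p (f x) (frechet_derivative g (at x) v) + p (frechet_derivative f (at x) v) (g x))) (at x)" if "x \<in> U" for x
    using that by (intro bounded_bilinear.FDERIV[OF b] C1_on_has_derivative[OF assms(2)] C1_on_has_derivative[OF assms(3)])
  show "continuous_on U (\<lambda>x. p (f x) (frechet_derivative g (at x) v) + p (frechet_derivative f (at x) v) (g x))" for v
    using C1_on_imp_continuous_on[OF assms(2)] C1_on_imp_continuous_on[OF assms(3)] assms(2,3)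
    unfolding C1_on_def by (intro continuous_on_add bounded_bilinear.continuous_on[OF b]) blast+
qed

lemmas C1_on_scaleR = C1_on_bilinear[OF bounded_bilinear_scaleR]
lemmas C1_on_inner = C1_on_bilinear[OF bounded_bilinear_inner]
lemmas C1_on_mult = C1_on_bilinear[OF bounded_bilinear_mult]

lemma C1_on_diff: "C1_on f U \<Longrightarrow> C1_on g U \<Longrightarrow> C1_on (\<lambda>x. f x - g x) U"
  using C1_on_add[OF _ C1_on_scaleR[OF C1_on_const[of "-1"]], of f U g] by simp

lemma C1_on_compose_real:
  assumes f: "C1_on f U"
    and g: "\<And>x. x \<in> U \<Longrightarrow> (g has_real_derivative g' (f x)) (at (f x))"
    and g': "continuous_on U (\<lambda>x. g' (f x))"
  shows "C1_on (\<lambda>x. g (f x)) U"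
proof (rule C1_onI)
  show "((\<lambda>x. g (f x)) has_derivative (\<lambda>v. frechet_derivative f (at x) v * g' (f x))) (at x)"
    if "x \<in> U" for x
    using has_derivative_compose[OF C1_on_has_derivative[OF f that]
        g[OF that, unfolded has_field_derivative_def]]
    by (simp add: mult.commute)
  show "continuous_on U (\<lambda>x. frechet_derivative f (at x) v * g' (f x))" for v
    using f g' by (intro continuous_on_mult) (auto simp: C1_on_def)
qed

lemma divergence_eqI:
  "(\<psi> has_derivative D) (at x) \<Longrightarrow> divergence \<psi> x = (\<Sum>b\<in>Basis. D b \<bullet> b)"
  unfolding divergence_def using frechet_derivative_at by metis

lemma frechet_derivative_sum_Basis:
  assumes "f differentiable (at x)"
  shows "(\<Sum>b\<in>Basis. frechet_derivative f (at x) b * (v \<bullet> b)) = frechet_derivative f (at x) (v :: 'a::euclidean_space)"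
proof -
  have l: "linear (frechet_derivative f (at x))"
    using assms by (rule linear_frechet_derivative)
  have "frechet_derivative f (at x) v = frechet_derivative f (at x) (\<Sum>b\<in>Basis. (v \<bullet> b) *\<^sub>R b)"
    by (simp only: euclidean_representation)
  also have "\<dots> = (\<Sum>b\<in>Basis. frechet_derivative f (at x) ((v \<bullet> b) *\<^sub>R b))"
    by (rule linear_sum[OF l])
  also have "\<dots> = (\<Sum>b\<in>Basis. frechet_derivative f (at x) b * (v \<bullet> b))"
    by (intro sum.cong refl) (simp add: linear_cmul[OF l])
  finally show ?thesis ..
qed

lemma divergence_scaleR:
  fixes g :: "'a::euclidean_space \<Rightarrow> real"
  assumes "g differentiable (at x)" "\<psi> differentiable (at x)"
  shows "divergence (\<lambda>x. g x *\<^sub>R \<psi> x) x =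
    g x * divergence \<psi> x + frechet_derivative g (at x) (\<psi> x)"
proof -
  have "((\<lambda>x. g x *\<^sub>R \<psi> x) has_derivative
      (\<lambda>v. g x *\<^sub>R frechet_derivative \<psi> (at x) v + frechet_derivative g (at x) v *\<^sub>R \<psi> x)) (at x)"
    using assms by (intro has_derivative_scaleR) (auto simp: frechet_derivative_works)
  from divergence_eqI[OF this] show ?thesis
    by (simp add: divergence_def inner_add_left sum.distrib sum_distrib_left
        frechet_derivative_sum_Basis[OF assms(1)])
qed

lemma divergence_diff:
  assumes "f differentiable (at x)" "g differentiable (at x)"
  shows "divergence (\<lambda>x. f x - g x) x = divergence f x - divergence g x"
proof -
  have "((\<lambda>x. f x - g x) has_derivative
      (\<lambda>v. frechet_derivative f (at x) v - frechet_derivative g (at x) v)) (at x)"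
    using assms by (intro has_derivative_diff) (auto simp: frechet_derivative_works)
  from divergence_eqI[OF this] show ?thesis
    by (simp add: divergence_def inner_diff_left sum_subtractf)
qed

lemma continuous_on_divergence: "C1_on \<psi> U \<Longrightarrow> continuous_on U (divergence \<psi>)"
  unfolding divergence_def [abs_def] C1_on_def by (intro continuous_intros) auto

lemma frechet_derivative_zero_open:
  assumes "open U" "x \<in> U" "\<And>y. y \<in> U \<Longrightarrow> f y = 0"
  shows "frechet_derivative f (at x) = (\<lambda>v. 0)"
proof -
  have "(f has_derivative (\<lambda>v. 0)) (at x)"
    using assms by (intro has_derivative_transform_within_open[OF has_derivative_const[of 0] assms(1,2)]) simp
  from frechet_derivative_at[OF this] show ?thesis by simp
qed

lemma divergence_zero_open:
  assumes "open U" "x \<in> U" "\<And>y. y \<in> U \<Longrightarrow> f y = 0"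
  shows "divergence f x = 0"
  using frechet_derivative_zero_open[OF assms] by (simp add: divergence_def)

lemma integrable_continuous_bounded_support:
  fixes f :: "'a::euclidean_space \<Rightarrow> real"
  assumes "continuous_on UNIV f" "\<And>x. norm x > r \<Longrightarrow> f x = 0"
  shows "integrable lebesgue f"
proof -
  have "set_integrable lborel (cball 0 r) f"
    unfolding set_integrable_def
    by (rule borel_integrable_compact) (auto intro: continuous_on_subset[OF assms(1)])
  moreover have "(\<lambda>x. indicat_real (cball 0 r) x *\<^sub>R f x) = f"
    using assms(2) by (auto simp: fun_eq_iff indicator_def not_le)
  ultimately have "integrable lborel f" by (simp add: set_integrable_def)
  then show ?thesis by (simp add: integrable_completion)
qed

lemma bounded_continuous_bounded_support:
  fixes f :: "'a::euclidean_space \<Rightarrow> 'b::real_normed_vector"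
  assumes "continuous_on UNIV f" "\<And>x. norm x > r \<Longrightarrow> f x = 0"
  obtains C where "C > 0" "\<And>x. norm (f x) \<le> C"
proof -
  have "bounded (f ` cball 0 r)"
    by (intro compact_imp_bounded compact_continuous_image continuous_on_subset[OF assms(1)]) auto
  then obtain C where C: "C > 0" "\<And>x. norm x \<le> r \<Longrightarrow> norm (f x) \<le> C"
    unfolding bounded_pos by (auto simp: dist_norm)
  then have "norm (f x) \<le> C" for x
    using assms(2)[of x] by (cases "norm x \<le> r") (auto simp: not_le less_imp_le)
  then show ?thesis using C that by blast
qed

lemma integral_translation:
  fixes f :: "'a::euclidean_space \<Rightarrow> real"
  assumes "continuous_on UNIV f"
  shows "(\<integral>x. f (c + x) \<partial>lborel) = (\<integral>x. f x \<partial>lborel)"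
proof -
  have m: "f \<in> borel_measurable borel" using assms by (rule borel_measurable_continuous_onI)
  have "(\<integral>x. f x \<partial>lborel) = (\<integral>x. f x \<partial>distr lborel borel ((+) c))"
    by (simp add: lborel_distr_plus)
  also have "\<dots> = (\<integral>x. f (c + x) \<partial>lborel)"
    using m by (intro integral_distr) auto
  finally show ?thesis by simp
qed

text \<open>The integral of a difference quotient vanishes by translation invariance of Lebesgue measure; dominated
  convergence passes to the derivative.\<close>

lemma integral_partial_derivative_zero:
  fixes f :: "'a::euclidean_space \<Rightarrow> real"
  assumes f: "C1_on f UNIV" and supp: "\<And>x. norm x > r \<Longrightarrow> f x = 0"
  shows "(\<integral>x. frechet_derivative f (at x) b \<partial>lebesgue) = 0"
proof -
  let ?D = "\<lambda>x. frechet_derivative f (at x) b"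
  have cont: "continuous_on UNIV f" using f by (rule C1_on_imp_continuous_on)
  have contD: "continuous_on UNIV ?D" using f by (simp add: C1_on_def)
  have D0: "?D x = 0" if "norm x > r" for x
    using frechet_derivative_zero_open[of "- cball 0 r" x f] that supp by (simp add: not_le open_Compl)
  obtain C where C: "C > 0" "\<And>x. norm (?D x) \<le> C"
    using bounded_continuous_bounded_support[OF contD D0] by auto
  define t where "t n = inverse (real (Suc n))" for n
  have t: "0 < t n" "t n \<le> 1" for n by (auto simp: t_def field_simps)
  have t0: "t \<longlonglongrightarrow> 0" unfolding t_def by (rule LIMSEQ_inverse_real_of_nat)
  have hd: "((\<lambda>s. f (x + s *\<^sub>R b)) has_real_derivative ?D (x + s *\<^sub>R b)) (at s)" for x s
  proof -
    have 1: "((\<lambda>s. x + s *\<^sub>R b) has_derivative (\<lambda>h. h *\<^sub>R b)) (at s)"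
      by (auto intro!: derivative_eq_intros)
    have l: "linear (frechet_derivative f (at (x + s *\<^sub>R b)))"
      using f by (intro linear_frechet_derivative) (simp add: C1_on_def)
    have "frechet_derivative f (at (x + s *\<^sub>R b)) (h *\<^sub>R b) = ?D (x + s *\<^sub>R b) * h" for h
      by (simp add: linear_cmul[OF l])
    then show ?thesis
      unfolding has_field_derivative_def
      using has_derivative_compose[OF 1 C1_on_has_derivative[OF f, of "x + s *\<^sub>R b"]]
      by simp
  qed
  define q where "q n x = (f (t n *\<^sub>R b + x) - f x) / t n" for n x
  have qlim: "(\<lambda>n. q n x) \<longlonglongrightarrow> ?D x" for x
  proof -
    have "((\<lambda>h. (f (x + h *\<^sub>R b) - f x) / h) \<longlongrightarrow> ?D x) (at 0)"
      using hd[of x 0] by (simp add: DERIV_def)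
    moreover have "filterlim t (at 0) sequentially"
      unfolding filterlim_at using t0 t by (auto intro!: always_eventually simp: less_imp_neq[OF t(1)] less_imp_neq[OF t(1), symmetric])
    ultimately have "(\<lambda>n. (f (x + t n *\<^sub>R b) - f x) / t n) \<longlonglongrightarrow> ?D x"
      by (rule filterlim_compose)
    then show ?thesis
      unfolding q_def by (simp add: add.commute)
  qed
  have qbound: "norm (q n x) \<le> C * indicat_real (cball 0 (r + norm b)) x" for n x
  proof (cases "norm x > r + norm b")
    case True
    have "norm x \<le> norm (t n *\<^sub>R b + x) + norm (t n *\<^sub>R b)"
      by (metis add_diff_cancel_left' norm_triangle_ineq4 add.commute)
    moreover have "norm (t n *\<^sub>R b) \<le> norm b"
      using t[of n] by (simp add: mult_left_le_one_le)
    ultimately have "norm (t n *\<^sub>R b + x) > r" using True by linarith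
    moreover have "norm x > r" using True norm_ge_zero[of b] by linarith
    ultimately show ?thesis using True by (simp add: q_def supp)
  next
    case False
    obtain z where "z > 0" "z < t n" "f (x + t n *\<^sub>R b) - f (x + 0 *\<^sub>R b) = (t n - 0) * ?D (x + z *\<^sub>R b)"
      using MVT2[OF t(1)[of n], of "\<lambda>s. f (x + s *\<^sub>R b)" "\<lambda>s. ?D (x + s *\<^sub>R b)"] hd by blast
    then have "q n x = ?D (x + z *\<^sub>R b)"
      using t(1)[of n] by (simp add: q_def add.commute)
    then show ?thesis using False C(2) by simp
  qed
  have "(\<lambda>n. \<integral>x. q n x \<partial>lborel) \<longlonglongrightarrow> (\<integral>x. ?D x \<partial>lborel)"
  proof (rule integral_dominated_convergence)
    show "?D \<in> borel_measurable lborel"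
      using contD by (simp add: borel_measurable_continuous_onI)
    show "q n \<in> borel_measurable lborel" for n
      unfolding q_def using cont
      by (simp, intro borel_measurable_continuous_onI continuous_on_divide continuous_intros
        continuous_on_compose2[OF cont]) (auto simp: less_imp_neq[OF t(1), symmetric])
    show "integrable lborel (\<lambda>x. C * indicat_real (cball 0 (r + norm b)) x)"
      by (intro integrable_mult_right integrable_real_indicator) (use emeasure_bounded_finite[OF bounded_cball, of 0 "r + norm b"] in \<open>auto simp: less_top\<close>)
    show "AE x in lborel. (\<lambda>n. q n x) \<longlonglongrightarrow> ?D x" using qlim by simp
    show "AE x in lborel. norm (q n x) \<le> C * indicat_real (cball 0 (r + norm b)) x" for n
      using qbound by simp
  qed
  moreover have "(\<integral>x. q n x \<partial>lborel) = 0" for n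
  proof -
    have i1: "integrable lborel f"
      using integrable_continuous_bounded_support[OF cont supp] cont
      by (simp add: integrable_completion borel_measurable_continuous_onI)
    have c2: "continuous_on UNIV (\<lambda>x. f (t n *\<^sub>R b + x))"
      by (intro continuous_on_compose2[OF cont] continuous_intros) auto
    have "f (t n *\<^sub>R b + x) = 0" if "norm x > r + norm (t n *\<^sub>R b)" for x
    proof (rule supp)
      have "norm x \<le> norm (t n *\<^sub>R b + x) + norm (t n *\<^sub>R b)"
        by (metis add_diff_cancel_left' norm_triangle_ineq4 add.commute)
      then show "norm (t n *\<^sub>R b + x) > r" using that by linarith
    qed
    then have "integrable lebesgue (\<lambda>x. f (t n *\<^sub>R b + x))"
      by (rule integrable_continuous_bounded_support[OF c2])
    then have i2: "integrable lborel (\<lambda>x. f (t n *\<^sub>R b + x))"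
      using c2 by (simp add: integrable_completion borel_measurable_continuous_onI)
    show ?thesis
      unfolding q_def using i1 i2 integral_translation[OF cont, of "t n *\<^sub>R b"] by simp
  qed
  ultimately have "(\<integral>x. ?D x \<partial>lborel) = 0"
    by (simp add: LIMSEQ_const_iff)
  then show ?thesis
    using contD by (simp add: integral_completion borel_measurable_continuous_onI)
qed

lemma divergence_zero_outside:
  assumes "\<And>x. norm x > r \<Longrightarrow> \<psi> x = 0" "norm x > r"
  shows "divergence \<psi> x = 0"
  using divergence_zero_open[of "- cball 0 r" x \<psi>] assms by (simp add: not_le open_Compl)

lemma integrable_divergence:
  assumes "C1_on \<psi> UNIV" "\<And>x. norm x > r \<Longrightarrow> \<psi> x = 0"
  shows "integrable lebesgue (divergence \<psi>)"
  using assms by (intro integrable_continuous_bounded_support[where r = r] continuous_on_divergence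
      divergence_zero_outside)

lemma integral_divergence_zero:
  fixes \<psi> :: "'a::euclidean_space \<Rightarrow> 'a"
  assumes C1: "C1_on \<psi> UNIV" and supp: "\<And>x. norm x > r \<Longrightarrow> \<psi> x = 0"
  shows "(\<integral>x. divergence \<psi> x \<partial>lebesgue) = 0"
proof -
  have comp: "C1_on (\<lambda>x. \<psi> x \<bullet> b) UNIV" for b
    by (intro C1_on_inner C1 C1_on_const)
  have fd: "frechet_derivative (\<lambda>x. \<psi> x \<bullet> b) (at x) b = frechet_derivative \<psi> (at x) b \<bullet> b" for b x
  proof -
    have "((\<lambda>x. \<psi> x \<bullet> b) has_derivative (\<lambda>v. frechet_derivative \<psi> (at x) v \<bullet> b)) (at x)"
      using C1_on_has_derivative[OF C1, of x] by (auto intro!: derivative_eq_intros)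
    from frechet_derivative_at[OF this] show ?thesis by metis
  qed
  have int: "integrable lebesgue (\<lambda>x. frechet_derivative (\<lambda>x. \<psi> x \<bullet> b) (at x) b)" for b
  proof (rule integrable_continuous_bounded_support)
    show "continuous_on UNIV (\<lambda>x. frechet_derivative (\<lambda>x. \<psi> x \<bullet> b) (at x) b)"
      using comp[of b] by (simp add: C1_on_def)
    show "frechet_derivative (\<lambda>x. \<psi> x \<bullet> b) (at x) b = 0" if "norm x > r" for x
      using frechet_derivative_zero_open[of "- cball 0 r" x "\<lambda>x. \<psi> x \<bullet> b"] that supp
      by (simp add: not_le open_Compl)
  qed
  have "(\<integral>x. divergence \<psi> x \<partial>lebesgue) =
      (\<Sum>b\<in>Basis. \<integral>x. frechet_derivative (\<lambda>x. \<psi> x \<bullet> b) (at x) b \<partial>lebesgue)"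
    unfolding divergence_def fd[symmetric] using int by (rule Bochner_Integration.integral_sum)
  also have "\<dots> = 0"
    using supp by (intro sum.neutral ballI integral_partial_derivative_zero[OF comp, of r]) auto
  finally show ?thesis .
qed

section \<open>Smooth cut-off functions\<close>

text \<open>Tracking a finite order of differentiability through an explicit derivative makes products and compositions
  accessible to induction on the order.\<close>

fun times_differentiable :: "nat \<Rightarrow> (real \<Rightarrow> real) \<Rightarrow> bool" where
  "times_differentiable 0 f \<longleftrightarrow> True"
| "times_differentiable (Suc n) f \<longleftrightarrow>
     (\<exists>f'. (\<forall>x. (f has_real_derivative f' x) (at x)) \<and> times_differentiable n f')"

lemma times_differentiable_SucI:
  "(\<And>x. (f has_real_derivative f' x) (at x)) \<Longrightarrow> times_differentiable n f' \<Longrightarrow>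
    times_differentiable (Suc n) f"
  by auto

lemma times_differentiable_Suc_imp: "times_differentiable (Suc n) f \<Longrightarrow> times_differentiable n f"
  by (induction n arbitrary: f) (simp, metis times_differentiable.simps(2))

lemma times_differentiable_const: "times_differentiable n (\<lambda>_. c)"
proof (induction n arbitrary: c)
  case (Suc n)
  show ?case by (rule times_differentiable_SucI[OF _ Suc[of 0]]) simp
qed simp

lemma times_differentiable_add:
  "times_differentiable n f \<Longrightarrow> times_differentiable n g \<Longrightarrow> times_differentiable n (\<lambda>x. f x + g x)"
proof (induction n arbitrary: f g)
  case (Suc n)
  then obtain f' g' where "\<And>x. (f has_real_derivative f' x) (at x)" "times_differentiable n f'"
    "\<And>x. (g has_real_derivative g' x) (at x)" "times_differentiable n g'" by auto
  then show ?case
    by (intro times_differentiable_SucI[where f' = "\<lambda>x. f' x + g' x"] Suc.IH DERIV_add)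
qed simp

lemma times_differentiable_mult:
  "times_differentiable n f \<Longrightarrow> times_differentiable n g \<Longrightarrow> times_differentiable n (\<lambda>x. f x * g x)"
proof (induction n arbitrary: f g)
  case (Suc n)
  then obtain f' g' where *: "\<And>x. (f has_real_derivative f' x) (at x)" "times_differentiable n f'"
    "\<And>x. (g has_real_derivative g' x) (at x)" "times_differentiable n g'" by auto
  have "times_differentiable n f" "times_differentiable n g"
    using Suc.prems times_differentiable_Suc_imp by auto
  with * have "times_differentiable n (\<lambda>x. f' x * g x + g' x * f x)"
    by (intro times_differentiable_add Suc.IH)
  with * show ?case
    by (intro times_differentiable_SucI[where f' = "\<lambda>x. f' x * g x + g' x * f x"] DERIV_mult)
qed simp

lemma times_differentiable_compose:
  "times_differentiable n f \<Longrightarrow> times_differentiable n g \<Longrightarrow> times_differentiable n (\<lambda>x. f (g x))"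
proof (induction n arbitrary: f g)
  case (Suc n)
  then obtain f' g' where *: "\<And>x. (f has_real_derivative f' x) (at x)" "times_differentiable n f'"
    "\<And>x. (g has_real_derivative g' x) (at x)" "times_differentiable n g'" by auto
  have "times_differentiable n g"
    using Suc.prems times_differentiable_Suc_imp by auto
  with * have "times_differentiable n (\<lambda>x. f' (g x) * g' x)"
    by (intro times_differentiable_mult Suc.IH[of f' g])
  moreover have "((\<lambda>x. f (g x)) has_real_derivative f' (g x) * g' x) (at x)" for x
    using * by (intro DERIV_chain2) auto
  ultimately show ?case
    by (intro times_differentiable_SucI)
qed simp

lemma times_differentiable_id: "times_differentiable n (\<lambda>x. x)"
proof (cases n)
  case (Suc m)
  show ?thesis unfolding Suc
    by (rule times_differentiable_SucI[OF _ times_differentiable_const[of m 1]]) simp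
qed simp

lemma times_differentiable_affine: "times_differentiable n (\<lambda>x. a * x + b)"
  by (intro times_differentiable_add times_differentiable_mult times_differentiable_const times_differentiable_id)

lemma times_differentiable_iterated_deriv:
  "(\<And>n. times_differentiable n f) \<Longrightarrow> (deriv ^^ k) f differentiable_on UNIV"
proof -
  have "times_differentiable (Suc k) f \<Longrightarrow> (deriv ^^ k) f differentiable_on UNIV"
  proof (induction k arbitrary: f)
    case 0
    then show ?case
      by (auto simp: differentiable_on_def real_differentiable_def)
  next
    case (Suc k)
    then obtain f' where f': "\<And>x. (f has_real_derivative f' x) (at x)"
      and "times_differentiable (Suc k) f'" by auto
    moreover have "deriv f = f'" using DERIV_imp_deriv[OF f'] by (simp add: fun_eq_iff)
    ultimately show ?case using Suc.IH[of f'] by (simp add: funpow_Suc_right del: funpow.simps)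
  qed
  then show "(\<And>n. times_differentiable n f) \<Longrightarrow> (deriv ^^ k) f differentiable_on UNIV" by blast
qed

text \<open>These functions are closed under differentiation, and all of them vanish to infinite order at 0;
  \<open>flat_poly 1\<close> is the classical \<open>exp (- 1 / x)\<close>.\<close>

definition flat_poly :: "real poly \<Rightarrow> real \<Rightarrow> real" where
  "flat_poly p x = (if x \<le> 0 then 0 else poly p (1 / x) * exp (- (1 / x)))"

lemma exp_beats_poly: "((\<lambda>t. poly p t * exp (- t)) \<longlongrightarrow> (0::real)) at_top"
proof (induction p)
  case (pCons a p)
  have "((\<lambda>t. t * (poly p t * exp (- t))) \<longlongrightarrow> 0) at_top"
  proof -
    have "((\<lambda>t. t ^ k * exp (- t) :: real) \<longlongrightarrow> 0) at_top" for k
      by real_asymp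
    then have "((\<lambda>t. \<Sum>i\<le>degree p. coeff p i * (t ^ Suc i * exp (- t))) \<longlongrightarrow> (\<Sum>i\<le>degree p. coeff p i * 0)) at_top"
      by (intro tendsto_intros)
    moreover have "(\<Sum>i\<le>degree p. coeff p i * (t ^ Suc i * exp (- t))) = t * (poly p t * exp (- t))" for t
      by (simp add: poly_altdef sum_distrib_left sum_distrib_right mult_ac)
    ultimately show ?thesis by simp
  qed
  moreover have "((\<lambda>t. a * exp (- t)) \<longlongrightarrow> 0) at_top" by real_asymp
  ultimately have "((\<lambda>t. a * exp (- t) + t * (poly p t * exp (- t))) \<longlongrightarrow> 0 + 0) at_top"
    by (intro tendsto_add)
  then show ?case by (simp add: algebra_simps)
qed simp

lemma flat_poly_deriv:
  "(flat_poly p has_real_derivative flat_poly ([:0, 0, 1:] * (p - pderiv p)) x) (at x)"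
proof -
  consider "x < 0" | "x = 0" | "x > 0" by linarith
  then show ?thesis
  proof cases
    case 1
    have "(flat_poly p has_real_derivative 0) (at x)"
      by (rule has_field_derivative_transform_within_open[of "\<lambda>_. 0" _ _ "{..<0}"])
        (use 1 in \<open>auto simp: flat_poly_def\<close>)
    then show ?thesis using 1 by (simp add: flat_poly_def)
  next
    case 3
    have "((\<lambda>x. poly p (1 / x) * exp (- (1 / x))) has_real_derivative
        poly ([:0, 0, 1:] * (p - pderiv p)) (1 / x) * exp (- (1 / x))) (at x)"
      using 3
      by (auto intro!: derivative_eq_intros simp: field_simps power2_eq_square)
    then have "(flat_poly p has_real_derivative
        poly ([:0, 0, 1:] * (p - pderiv p)) (1 / x) * exp (- (1 / x))) (at x)"
      by (rule has_field_derivative_transform_within_open[of _ _ _ "{0<..}"])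
        (use 3 in \<open>auto simp: flat_poly_def\<close>)
    then show ?thesis using 3 by (simp add: flat_poly_def)
  next
    case 2
    have "((\<lambda>h. flat_poly p h / h) \<longlongrightarrow> 0) (at_right 0)"
    proof -
      have "((\<lambda>h. poly (pCons 0 p) (1 / h) * exp (- (1 / h))) \<longlongrightarrow> (0::real)) (at_right 0)"
        by (rule filterlim_compose[OF exp_beats_poly]) real_asymp
      moreover have "\<forall>\<^sub>F h in at_right 0. poly (pCons 0 p) (1 / h) * exp (- (1 / h)) = flat_poly p h / h"
        by (rule eventually_at_right_less[THEN eventually_mono]) (simp add: flat_poly_def)
      ultimately show ?thesis by (rule Lim_transform_eventually)
    qed
    moreover have "((\<lambda>h. flat_poly p h / h) \<longlongrightarrow> 0) (at_left 0)"
      by (rule Lim_transform_eventually[OF tendsto_const])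
        (auto simp: flat_poly_def eventually_at_filter intro!: always_eventually)
    ultimately have "((\<lambda>h. flat_poly p h / h) \<longlongrightarrow> 0) (at 0)"
      by (simp add: filterlim_split_at)
    then show ?thesis using 2 by (simp add: DERIV_def flat_poly_def)
  qed
qed

lemma times_differentiable_flat_poly: "times_differentiable n (flat_poly p)"
proof (induction n arbitrary: p)
  case (Suc n)
  show ?case by (rule times_differentiable_SucI[OF flat_poly_deriv Suc])
qed simp

text \<open>Applying \<open>flat_poly 1\<close> twice avoids a normalising quotient: the inner function vanishes for
  \<open>x \<le> 0\<close>, where the outer one takes its value \<open>exp (- 1)\<close>, and it is at least
  \<open>exp (- 1)\<close> for \<open>x \<ge> 1\<close>, where the outer argument is no longer positive.\<close>

definition smooth_step :: "real \<Rightarrow> real" where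
  "smooth_step x = 1 - exp 1 * flat_poly 1 (1 - exp 1 * flat_poly 1 x)"

lemma times_differentiable_smooth_step: "times_differentiable n smooth_step"
proof -
  have "times_differentiable n (\<lambda>x. flat_poly 1 (1 - exp 1 * flat_poly 1 x))"
    using times_differentiable_compose[OF times_differentiable_flat_poly,
       OF times_differentiable_compose[OF times_differentiable_affine times_differentiable_flat_poly],
       of n 1 "- exp 1" 1 1] by (simp add: algebra_simps)
  from times_differentiable_compose[OF times_differentiable_affine this, of "- exp 1" 1]
  show ?thesis unfolding smooth_step_def [abs_def] by (simp add: algebra_simps)
qed

lemma flat_1_nonneg: "0 \<le> flat_poly 1 x" by (simp add: flat_poly_def)

lemma smooth_step_0: "x \<le> 0 \<Longrightarrow> smooth_step x = 0"
  by (simp add: smooth_step_def flat_poly_def exp_add[symmetric] exp_minus field_simps)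

lemma flat_1_ge: "x \<ge> 1 \<Longrightarrow> exp 1 * flat_poly 1 x \<ge> 1"
  by (simp add: flat_poly_def exp_add[symmetric] field_simps)

lemma smooth_step_1: "x \<ge> 1 \<Longrightarrow> smooth_step x = 1"
  using flat_1_ge[of x] by (simp add: smooth_step_def flat_poly_def)

lemma smooth_step_le_1: "smooth_step x \<le> 1"
  using flat_1_nonneg by (simp add: smooth_step_def)

lemma smooth_step_nonneg: "0 \<le> smooth_step x"
proof -
  let ?y = "1 - exp 1 * flat_poly 1 x"
  have "?y \<le> 1" using flat_1_nonneg[of x] by simp
  then have "exp 1 * flat_poly 1 ?y \<le> 1"
    by (auto simp: flat_poly_def mult_exp_exp)
  then show ?thesis by (simp add: smooth_step_def)
qed

lemma
  shows DERIV_smooth_step: "(smooth_step has_real_derivative deriv smooth_step x) (at x)"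
    and continuous_on_deriv_smooth_step: "continuous_on UNIV (deriv smooth_step)"
    and deriv_smooth_step_nonneg: "0 \<le> deriv smooth_step x"
    and deriv_smooth_step_0: "x \<le> 0 \<or> x \<ge> 1 \<Longrightarrow> deriv smooth_step x = 0"
    and deriv_smooth_step_bounded: "\<exists>L>0. \<forall>x. deriv smooth_step x \<le> L"
proof -
  define F where "F = flat_poly ([:0, 0, 1:] * (1 - pderiv 1))"
  have dF: "(flat_poly 1 has_real_derivative F x) (at x)" for x
    unfolding F_def by (rule flat_poly_deriv)
  have cF: "continuous_on UNIV F"
    unfolding F_def by (meson DERIV_isCont continuous_at_imp_continuous_on flat_poly_deriv)
  have c1: "continuous_on UNIV (flat_poly 1)"
    by (meson DERIV_isCont continuous_at_imp_continuous_on flat_poly_deriv)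
  have F0: "0 \<le> F x" "x \<le> 0 \<Longrightarrow> F x = 0" for x by (auto simp: F_def flat_poly_def)
  define S' where "S' x = exp 1 * exp 1 * F (1 - exp 1 * flat_poly 1 x) * F x" for x
  have d: "(smooth_step has_real_derivative S' x) (at x)" for x
    unfolding smooth_step_def [abs_def] S'_def
    by (rule derivative_eq_intros DERIV_chain2[OF dF] dF refl)+ simp
  have c: "continuous_on UNIV S'"
    unfolding S'_def [abs_def]
    by (intro continuous_intros cF continuous_on_compose2[OF cF] c1) auto
  have n: "0 \<le> S' x" for x unfolding S'_def by (intro mult_nonneg_nonneg F0) auto
  have z: "x \<le> 0 \<Longrightarrow> S' x = 0" "x \<ge> 1 \<Longrightarrow> S' x = 0" for x
    using flat_1_ge[of x] by (auto simp: S'_def F0)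
  have "compact (S' ` {0..1})" by (intro compact_continuous_image continuous_on_subset[OF c]) auto
  then obtain L where L: "\<And>x. x \<in> {0..1} \<Longrightarrow> norm (S' x) \<le> L" "L > 0"
    using compact_imp_bounded bounded_pos by (metis imageI)
  have "S' x \<le> L" for x
  proof (cases "x \<in> {0..1}")
    case True then show ?thesis using L(1)[of x] by simp
  next
    case False then show ?thesis using z[of x] L(2) by fastforce
  qed
  then have b: "\<exists>L>0. \<forall>x. S' x \<le> L" using L(2) by blast
  have "deriv smooth_step = S'" using DERIV_imp_deriv[OF d] by (simp add: fun_eq_iff)
  with d c n z b show
    "(smooth_step has_real_derivative deriv smooth_step x) (at x)"
    "continuous_on UNIV (deriv smooth_step)" "0 \<le> deriv smooth_step x"
    "x \<le> 0 \<or> x \<ge> 1 \<Longrightarrow> deriv smooth_step x = 0" "\<exists>L>0. \<forall>x. deriv smooth_step x \<le> L"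
    by auto
qed

lemma cutoff_exists:
  assumes "\<upsilon> > 0"
  obtains \<eta> where "cutoff \<upsilon> \<eta>" "\<And>a. \<eta> a \<le> 1"
proof
  define \<eta> where "\<eta> a = smooth_step (2 - a / \<upsilon>) * smooth_step (2 + a / \<upsilon>)" for a
  have "times_differentiable n \<eta>" for n
  proof -
    have "times_differentiable n (\<lambda>a. smooth_step (c * a + 2))" for c
      by (rule times_differentiable_compose[OF times_differentiable_smooth_step times_differentiable_affine])
    from times_differentiable_mult[OF this[of "- 1 / \<upsilon>"] this[of "1 / \<upsilon>"]] show ?thesis by (simp add: \<eta>_def [abs_def] add.commute)
  qed
  then have "(deriv ^^ k) \<eta> differentiable_on UNIV" for k
    by (rule times_differentiable_iterated_deriv)
  moreover have "\<eta> a = 1" if "\<bar>a\<bar> \<le> \<upsilon>" for a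
    using that assms unfolding \<eta>_def by (subst (1 2) smooth_step_1) (auto simp: field_simps)
  moreover have "\<eta> a = 0" if "\<bar>a\<bar> \<ge> 2 * \<upsilon>" for a
  proof (cases "a \<ge> 0")
    case True
    then have "2 - a / \<upsilon> \<le> 0" using that assms by (simp add: field_simps)
    then show ?thesis by (simp add: \<eta>_def smooth_step_0)
  next
    case False
    then have "2 + a / \<upsilon> \<le> 0" using that assms by (simp add: field_simps)
    then show ?thesis by (simp add: \<eta>_def smooth_step_0)
  qed
  ultimately show "cutoff \<upsilon> \<eta>"
    unfolding cutoff_def by (auto simp: \<eta>_def smooth_step_nonneg)
  show "\<eta> a \<le> 1" for a
    unfolding \<eta>_def by (intro mult_le_one smooth_step_le_1 smooth_step_nonneg)
qed

section \<open>The cone and its sub-calibration\<close>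

text \<open>The eight-dimensional setting without coordinates. The trace condition makes the two eigenspaces
  four-dimensional. This decides the divergence of \<open>X\<close>, which for two eigenspaces of dimension
  three would no longer have the sign of \<open>q\<close>.\<close>

locale simons_involution =
  fixes J :: "'a::euclidean_space \<Rightarrow> 'a"
  assumes linear_J: "linear J"
    and J_J [simp]: "J (J x) = x"
    and J_sym: "J x \<bullet> y = x \<bullet> J y"
    and trace_J: "(\<Sum>b\<in>Basis. J b \<bullet> b) = 0"
    and dim: "DIM('a) = 8"
    and plus_vector: "\<exists>e. norm e = 1 \<and> J e = e"
    and minus_vector: "\<exists>e. norm e = 1 \<and> J e = - e"
begin

definition q :: "'a \<Rightarrow> real" where "q x = x \<bullet> J x"

definition null_cone :: "'a set" where "null_cone = {x. q x = 0}"

definition neg_side :: "'a set" where "neg_side = {x. q x < 0}"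

lemma bounded_linear_J: "bounded_linear J"
  using linear_J by (simp add: linear_conv_bounded_linear)

lemma J_add: "J (x + y) = J x + J y" and J_scaleR: "J (c *\<^sub>R x) = c *\<^sub>R J x"
  and J_diff: "J (x - y) = J x - J y" and J_0 [simp]: "J 0 = 0" and J_minus: "J (- x) = - J x"
  using linear_J by (simp_all add: linear_add linear_cmul linear_diff linear_0 linear_neg)

lemma J_inner_J [simp]: "J x \<bullet> J y = x \<bullet> y" by (simp add: J_sym)

lemma norm_J [simp]: "norm (J x) = norm x" by (simp add: norm_eq_sqrt_inner)

lemma q_0 [simp]: "q 0 = 0" by (simp add: q_def)

lemma q_scaleR: "q (c *\<^sub>R x) = c\<^sup>2 * q x"
  by (simp add: q_def J_scaleR power2_eq_square)

lemma q_J [simp]: "q (J x) = q x" by (simp add: q_def J_sym)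

lemma J_swap: "y \<bullet> J x = x \<bullet> J y"
  by (metis J_sym inner_commute)

lemma q_add: "q (x + y) = q x + 2 * (x \<bullet> J y) + q y"
  by (simp add: q_def J_add inner_add_left inner_add_right J_swap[of y x])

text \<open>Moving along \<open>J x\<close>, which is normal to the cone, changes \<open>q\<close> at a rate comparable to
  the squared norm; this is how points near the cone are joined to it.\<close>

lemma q_flow: "q (x + t *\<^sub>R J x) = q x * (1 + t\<^sup>2) + 2 * t * (x \<bullet> x)"
  by (simp add: q_add q_scaleR J_scaleR algebra_simps)

lemma abs_q_le: "\<bar>q x\<bar> \<le> x \<bullet> x"
  using Cauchy_Schwarz_ineq2[of x "J x"] by (simp add: q_def dot_square_norm power2_eq_square)

lemma q_diff_le: "\<bar>q x - q y\<bar> \<le> norm (x - y) * norm (x + y)"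
proof -
  have "q x - q y = (x - y) \<bullet> J (x + y)"
    by (simp add: q_def J_add inner_diff_left inner_add_right J_swap[of y x])
  then show ?thesis using Cauchy_Schwarz_ineq2[of "x - y" "J (x + y)"] by simp
qed

lemma C1_on_J: "C1_on J U" by (rule C1_on_bounded_linear[OF bounded_linear_J])

lemma C1_on_id: "C1_on (\<lambda>x. x) U" by (rule C1_on_bounded_linear[OF bounded_linear_ident])

lemma C1_on_q: "C1_on q U"
  unfolding q_def [abs_def] by (intro C1_on_inner C1_on_id C1_on_J)

lemma C1_on_square_norm: "C1_on (\<lambda>x::'a. x \<bullet> x) U"
  by (intro C1_on_inner C1_on_id)

lemma continuous_on_q [continuous_intros]: "continuous_on U q"
  using C1_on_q by (rule C1_on_imp_continuous_on)

lemma has_derivative_q: "(q has_derivative (\<lambda>v. 2 * (J x \<bullet> v))) (at x)"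
proof -
  have "((\<lambda>x. x \<bullet> J x) has_derivative (\<lambda>v. x \<bullet> J v + v \<bullet> J x)) (at x)"
    by (intro derivative_intros bounded_linear_imp_has_derivative[OF bounded_linear_J])
  moreover have "x \<bullet> J v + v \<bullet> J x = 2 * (J x \<bullet> v)" for v
    by (simp add: J_swap[of v x] J_sym)
  ultimately show ?thesis by (simp add: q_def [abs_def])
qed

lemma has_derivative_square_norm: "((\<lambda>x::'a. x \<bullet> x) has_derivative (\<lambda>v. 2 * (x \<bullet> v))) (at x)"
  by (auto intro!: derivative_eq_intros simp: inner_commute)

text \<open>With \<open>x = (y, z)\<close> this is twice the vector
  \<open>(\<bar>y\<bar>\<^sup>2 y, - \<bar>z\<bar>\<^sup>2 z)\<close>, hence twice the gradient of
  \<open>(\<bar>y\<bar>\<^sup>4 - \<bar>z\<bar>\<^sup>4) / 4\<close>; \<open>B\<close> is its squared norm and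
  \<open>X\<close> its normalisation.\<close>

definition Z :: "'a \<Rightarrow> 'a" where "Z x = q x *\<^sub>R x + (x \<bullet> x) *\<^sub>R J x"

definition B :: "'a \<Rightarrow> real" where "B x = (x \<bullet> x) ^ 3 + 3 * (q x)\<^sup>2 * (x \<bullet> x)"

definition X :: "'a \<Rightarrow> 'a" where "X x = (1 / sqrt (B x)) *\<^sub>R Z x"

lemma inner_Z: "x \<bullet> Z x = 2 * q x * (x \<bullet> x)" "J x \<bullet> Z x = (q x)\<^sup>2 + (x \<bullet> x)\<^sup>2"
  by (simp_all add: Z_def inner_add_right q_def power2_eq_square J_sym)

lemma Z_inner_Z: "Z x \<bullet> Z x = B x"
proof -
  have "Z x \<bullet> Z x = q x * (x \<bullet> Z x) + (x \<bullet> x) * (J x \<bullet> Z x)"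
    by (subst Z_def, simp add: inner_add_left)
  then show ?thesis by (simp add: inner_Z B_def power2_eq_square power3_eq_cube algebra_simps)
qed

lemma B_pos: "x \<noteq> 0 \<Longrightarrow> B x > 0"
  unfolding B_def by (intro add_pos_nonneg) auto

lemma norm_X: "x \<noteq> 0 \<Longrightarrow> norm (X x) = 1"
  using B_pos[of x] by (simp add: X_def norm_eq_sqrt_inner[of "Z x"] Z_inner_Z)

lemma inner_X: "x \<bullet> X x = 2 * q x * (x \<bullet> x) / sqrt (B x)"
  "J x \<bullet> X x = ((q x)\<^sup>2 + (x \<bullet> x)\<^sup>2) / sqrt (B x)"
  by (simp_all add: X_def inner_Z)

lemma C1_on_B: "C1_on B U"
proof -
  have "C1_on (\<lambda>x. (x \<bullet> x) * (x \<bullet> x) * (x \<bullet> x) + 3 * (q x * q x) * (x \<bullet> x)) U"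
    by (intro C1_on_add C1_on_mult C1_on_square_norm C1_on_q C1_on_const)
  then show ?thesis by (simp add: B_def [abs_def] power2_eq_square power3_eq_cube)
qed

lemma C1_on_Z: "C1_on Z U"
  unfolding Z_def [abs_def]
  by (intro C1_on_add C1_on_scaleR C1_on_square_norm C1_on_q C1_on_id C1_on_J)

lemma DERIV_inverse_sqrt:
  "b > 0 \<Longrightarrow> ((\<lambda>b. 1 / sqrt b) has_real_derivative - 1 / (2 * b * sqrt b)) (at b)"
  by (auto intro!: derivative_eq_intros simp: field_simps)

lemma C1_on_X: "C1_on X (- {0})"
  unfolding X_def [abs_def]
proof (intro C1_on_scaleR C1_on_Z C1_on_compose_real[where g = "\<lambda>b. 1 / sqrt b" and f = B])
  show "((\<lambda>b. 1 / sqrt b) has_real_derivative - 1 / (2 * B x * sqrt (B x))) (at (B x))"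
    if "x \<in> - {0}" for x
    using that by (intro DERIV_inverse_sqrt B_pos) auto
  show "continuous_on (- {0}) (\<lambda>x. - 1 / (2 * B x * sqrt (B x)))"
    using B_pos by (intro continuous_intros C1_on_imp_continuous_on[OF C1_on_B])
       (force dest: less_imp_neq[symmetric])
qed (rule C1_on_B)

lemma divergence_Z: "divergence Z x = 12 * q x"
proof -
  have "(Z has_derivative (\<lambda>v. (q x *\<^sub>R v + (2 * (J x \<bullet> v)) *\<^sub>R x) +
      ((x \<bullet> x) *\<^sub>R J v + (2 * (x \<bullet> v)) *\<^sub>R J x))) (at x)"
    unfolding Z_def [abs_def]
    by (intro derivative_intros has_derivative_q has_derivative_square_norm
        bounded_linear_imp_has_derivative[OF bounded_linear_J])
  from divergence_eqI[OF this]
  have "divergence Z x = q x * (\<Sum>b\<in>(Basis :: 'a set). b \<bullet> b) + 4 * (\<Sum>b\<in>Basis. (x \<bullet> b) * (J x \<bullet> b))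
      + (x \<bullet> x) * (\<Sum>b\<in>Basis. J b \<bullet> b)"
    by (simp add: inner_add_left sum.distrib sum_distrib_left mult_ac)
  also have "\<dots> = 8 * q x + 4 * q x + 0"
    unfolding euclidean_inner[symmetric] trace_J using dim by (simp add: q_def)
  finally show ?thesis by simp
qed

text \<open>All terms of order one in \<open>q\<close> cancel, which is special to two blocks of dimension four. What
  remains has the sign of \<open>q\<close>.\<close>

lemma divergence_X:
  assumes "x \<noteq> 0"
  shows "divergence X x = 24 * (q x) ^ 3 * (x \<bullet> x) / (B x * sqrt (B x))"
proof -
  let ?r = "x \<bullet> x"
  have "(B has_derivative (\<lambda>v. (6 * ?r\<^sup>2 + 6 * (q x)\<^sup>2) * (x \<bullet> v) + 12 * q x * ?r * (J x \<bullet> v))) (at x)"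
    unfolding B_def [abs_def]
    by (rule derivative_eq_intros has_derivative_q has_derivative_square_norm refl)+
      (simp add: fun_eq_iff algebra_simps power2_eq_square)
  from has_derivative_compose[OF this DERIV_inverse_sqrt[OF B_pos[OF assms], unfolded has_field_derivative_def]]
  have w: "((\<lambda>x. 1 / sqrt (B x)) has_derivative (\<lambda>v. - 1 / (2 * B x * sqrt (B x)) *
      ((6 * ?r\<^sup>2 + 6 * (q x)\<^sup>2) * (x \<bullet> v) + 12 * q x * ?r * (J x \<bullet> v)))) (at x)" .
  have "divergence X x = 1 / sqrt (B x) * divergence Z x +
      frechet_derivative (\<lambda>x. 1 / sqrt (B x)) (at x) (Z x)"
    unfolding X_def [abs_def]
    using w C1_on_Z[of UNIV] by (intro divergence_scaleR) (auto simp: C1_on_def differentiable_def)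
  also have "\<dots> = 12 * q x / sqrt (B x) - 1 / (2 * B x * sqrt (B x)) *
      ((6 * ?r\<^sup>2 + 6 * (q x)\<^sup>2) * (2 * q x * ?r) + 12 * q x * ?r * ((q x)\<^sup>2 + ?r\<^sup>2))"
    unfolding frechet_derivative_at[OF w, symmetric] by (simp add: divergence_Z inner_Z)
  also have "\<dots> = (12 * q x * B x - ((3 * ?r\<^sup>2 + 3 * (q x)\<^sup>2) * (2 * q x * ?r) + 6 * q x * ?r * ((q x)\<^sup>2 + ?r\<^sup>2)))
      / (B x * sqrt (B x))"
    using B_pos[OF assms] by (simp add: field_simps)
  also have "12 * q x * B x - ((3 * ?r\<^sup>2 + 3 * (q x)\<^sup>2) * (2 * q x * ?r) + 6 * q x * ?r * ((q x)\<^sup>2 + ?r\<^sup>2))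
      = 24 * (q x) ^ 3 * ?r"
    by (simp add: B_def power2_eq_square power3_eq_cube algebra_simps)
  finally show ?thesis .
qed

lemma divergence_X_sign:
  assumes "x \<noteq> 0"
  shows "q x > 0 \<Longrightarrow> divergence X x > 0" "q x < 0 \<Longrightarrow> divergence X x < 0"
proof -
  have D: "B x * sqrt (B x) > 0" "x \<bullet> x > 0" using B_pos[OF assms] assms by auto
  show "q x > 0 \<Longrightarrow> divergence X x > 0"
    unfolding divergence_X[OF assms] using D by (intro divide_pos_pos[OF _ D(1)] mult_pos_pos) auto
  show "q x < 0 \<Longrightarrow> divergence X x < 0"
    unfolding divergence_X[OF assms] using D
    by (intro divide_neg_pos[OF _ D(1)] mult_neg_pos mult_pos_neg) (auto simp: power_less_zero_eq)
qed

lemma open_neg_side: "open neg_side"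
  unfolding neg_side_def by (intro open_Collect_less continuous_intros)

lemma closed_cone: "closed null_cone"
  unfolding null_cone_def by (intro closed_Collect_eq continuous_intros)

text \<open>A ray that starts at a point \<open>a\<close> with \<open>q a > 0\<close> meets the cone in the zeros of a
  quadratic polynomial. On the half space defining \<open>S a\<close> this polynomial has only one positive
  zero, so \<open>S a\<close> meets every ray from \<open>a\<close> at most once and is negligible. Scaling
  \<open>a\<close> to zero exhausts the cone.\<close>

lemma negligible_cone: "negligible null_cone"
proof -
  define S where "S a = {z. q z = 0 \<and> q a \<le> z \<bullet> J a}" for a
  have neg: "negligible (S a)" if "q a > 0" for a
  proof (rule starlike_negligible[where a = a])
    show "closed (S a)"
      unfolding S_def by (intro closed_Collect_conj closed_Collect_eq closed_Collect_le continuous_intros)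
    fix c x assume c: "0 \<le> c" and 1: "a + c *\<^sub>R x \<in> S a" and 2: "a + x \<in> S a"
    define p where "p = x \<bullet> J a"
    have e1: "q a + 2 * c * p + c\<^sup>2 * q x = 0" "0 \<le> c * p"
      using 1 by (auto simp: S_def q_add q_scaleR J_scaleR p_def J_swap[of a x] inner_add_left q_def[of a])
    have e2: "q a + 2 * p + q x = 0" "0 \<le> p"
      using 2 by (auto simp: S_def q_add p_def J_swap[of a x] inner_add_left q_def[of a])
    have "q a + 2 * c * p - c\<^sup>2 * (q a + 2 * p) = 0" using e1(1) e2(1) by algebra
    then have "(1 - c) * (q a * (1 + c) + 2 * c * p) = 0" by (simp add: algebra_simps power2_eq_square)
    moreover have "q a * (1 + c) + 2 * c * p > 0" using that c e1(2) by (intro add_pos_nonneg) auto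
    ultimately show "c = 1" by simp
  qed
  define A where "A = (\<lambda>b. b + J b) ` Basis \<union> (\<lambda>b. - (b + J b)) ` Basis"
  have "null_cone \<subseteq> {0} \<union> (\<Union>n. \<Union>a\<in>{a\<in>A. q a > 0}. S ((1 / real (Suc n)) *\<^sub>R a))"
  proof
    fix z assume z: "z \<in> null_cone"
    show "z \<in> {0} \<union> (\<Union>n. \<Union>a\<in>{a\<in>A. q a > 0}. S ((1 / real (Suc n)) *\<^sub>R a))"
    proof (cases "z = 0")
      case False
      have "z + J z \<noteq> 0"
      proof
        assume "z + J z = 0"
        then have "q z = - (z \<bullet> z)" by (simp add: q_def add_eq_0_iff)
        then show False using z False by (simp add: null_cone_def)
      qed
      then obtain b where b: "b \<in> Basis" "(z + J z) \<bullet> b \<noteq> 0"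
        by (metis euclidean_all_zero_iff)
      have zb: "z \<bullet> J (b + J b) = (z + J z) \<bullet> b"
        by (simp add: J_add inner_add_left inner_add_right J_sym)
      obtain a where a: "a \<in> A" "J a = a" "z \<bullet> J a > 0"
      proof (cases "(z + J z) \<bullet> b > 0")
        case True
        then show ?thesis using that[of "b + J b"] b(1) zb by (auto simp: A_def J_add add.commute)
      next
        case False
        then show ?thesis using that[of "- (b + J b)"] b zb
          by (auto simp: A_def J_add J_diff J_minus inner_add_left inner_add_right inner_diff_right)
      qed
      then have "a \<noteq> 0" by auto
      then have qa: "q a > 0" using a(2) by (simp add: q_def)
      obtain n :: nat where n: "q a / (z \<bullet> J a) < real n" using reals_Archimedean2 by blast
      then have "q a < real (Suc n) * (z \<bullet> J a)" using a(3) by (simp add: field_simps)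
      moreover define m where "m = real (Suc n)"
      ultimately have "m > 0" "q a < m * (z \<bullet> J a)" by simp_all
      then have "(1 / m)\<^sup>2 * q a \<le> (1 / m) * (z \<bullet> J a)"
        by (simp add: power2_eq_square field_simps)
      then have "z \<in> S ((1 / real (Suc n)) *\<^sub>R a)"
        using z by (simp add: S_def null_cone_def q_scaleR J_scaleR m_def)
      then show ?thesis using a(1) qa by blast
    qed simp
  qed
  moreover have "negligible ({0} \<union> (\<Union>n. \<Union>a\<in>{a\<in>A. q a > 0}. S ((1 / real (Suc n)) *\<^sub>R a)))"
  proof (intro negligible_Un negligible_countable_Union negligible_sing)
    have "finite A" by (simp add: A_def)
    then have "negligible (\<Union>a\<in>{a\<in>A. q a > 0}. S ((1 / real (Suc n)) *\<^sub>R a))" for n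
      by (intro negligible_Union) (auto intro!: neg simp: q_scaleR)
    then show "\<And>T. T \<in> range (\<lambda>n. \<Union>a\<in>{a\<in>A. q a > 0}. S ((1 / real (Suc n)) *\<^sub>R a)) \<Longrightarrow> negligible T"
      by blast
  qed simp
  ultimately show ?thesis by (rule negligible_subset[rotated])
qed

end

section \<open>Cut-offs at the origin and fields that point out of the cone\<close>

lemma C1_on_smooth_step:
  assumes "C1_on f U"
  shows "C1_on (\<lambda>x. smooth_step (f x)) U"
  using continuous_on_compose2[OF continuous_on_deriv_smooth_step C1_on_imp_continuous_on[OF assms]]
  by (intro C1_on_compose_real[OF assms DERIV_smooth_step]) auto

lemma frechet_derivative_compose_real:
  assumes "f differentiable (at x)" "(g has_real_derivative d) (at (f x))"
  shows "frechet_derivative (\<lambda>x. g (f x)) (at x) v = d * frechet_derivative f (at x) v"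
proof -
  have "(f has_derivative frechet_derivative f (at x)) (at x)"
    using assms(1) by (simp add: frechet_derivative_works)
  from has_derivative_compose[OF this assms(2)[unfolded has_field_derivative_def]]
  show ?thesis using frechet_derivative_at by metis
qed

lemma C1_lipschitz:
  fixes f :: "'a::euclidean_space \<Rightarrow> real"
  assumes f: "C1_on f UNIV" and supp: "\<And>x. norm x > r \<Longrightarrow> f x = 0"
  obtains C where "C > 0" "\<And>x y. \<bar>f x - f y\<bar> \<le> C * norm (x - y)"
    "\<And>x v. \<bar>frechet_derivative f (at x) v\<bar> \<le> C * norm v"
proof -
  let ?D = "\<lambda>x. frechet_derivative f (at x)"
  have "\<exists>C>0. \<forall>x. \<bar>?D x b\<bar> \<le> C" for b
  proof -
    have c: "continuous_on UNIV (\<lambda>x. ?D x b)" using f by (simp add: C1_on_def)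
    have z: "?D x b = 0" if "norm x > r" for x
      using frechet_derivative_zero_open[of "- cball 0 r" x f] that supp by (simp add: not_le open_Compl)
    from bounded_continuous_bounded_support[OF c z] show ?thesis by (metis real_norm_def)
  qed
  then obtain C where C: "\<And>b. C b > 0" "\<And>b x. \<bar>?D x b\<bar> \<le> C b" by metis
  have bound: "norm (?D x v) \<le> (\<Sum>b\<in>Basis. C b) * norm v" for x v
  proof -
    have "?D x v = (\<Sum>b\<in>Basis. ?D x b * (v \<bullet> b))"
      using f by (simp add: frechet_derivative_sum_Basis C1_on_def)
    also have "\<bar>\<dots>\<bar> \<le> (\<Sum>b\<in>Basis. \<bar>?D x b * (v \<bullet> b)\<bar>)" by (rule sum_abs)
    also have "\<dots> \<le> (\<Sum>b\<in>Basis. C b * norm v)"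
      unfolding abs_mult by (intro sum_mono mult_mono C Basis_le_norm) (auto intro: less_imp_le C)
    finally show ?thesis by (simp add: sum_distrib_right)
  qed
  have "(\<Sum>b\<in>Basis. C b) > 0" using C(1) by (intro sum_pos) auto
  moreover have "\<bar>f x - f y\<bar> \<le> (\<Sum>b\<in>Basis. C b) * norm (x - y)" for x y
    using differentiable_bound[of UNIV f ?D "\<Sum>b\<in>Basis. C b" x y] onorm_le[OF bound] C1_on_has_derivative[OF f] by simp
  ultimately show ?thesis using that bound by simp
qed

text \<open>The gradient bound \<open>C / \<epsilon>\<close>, integrated over a ball of radius
  \<open>2 \<epsilon>\<close>, tends to 0 with \<open>\<epsilon>\<close> in dimension at least two
  (\<open>small_ball_error\<close>), so the singularity of \<open>X\<close> costs nothing in the limit.\<close>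

definition origin_cutoff :: "real \<Rightarrow> real \<Rightarrow> ('a::euclidean_space \<Rightarrow> real) \<Rightarrow> bool" where
  "origin_cutoff C \<epsilon> \<theta> \<longleftrightarrow> C1_on \<theta> UNIV \<and> (\<forall>x. 0 \<le> \<theta> x \<and> \<theta> x \<le> 1) \<and>
     (\<forall>x. norm x \<le> \<epsilon> \<longrightarrow> \<theta> x = 0) \<and> (\<forall>x. norm x \<ge> 2 * \<epsilon> \<longrightarrow> \<theta> x = 1) \<and>
     (\<forall>x v. norm v \<le> 1 \<longrightarrow>
        \<bar>frechet_derivative \<theta> (at x) v\<bar> \<le> C / \<epsilon> * indicat_real (cball 0 (2 * \<epsilon>)) x)"

lemma origin_cutoffs:
  obtains C where "C > 0"
    "\<And>\<epsilon>. \<epsilon> > 0 \<Longrightarrow> \<exists>\<theta> :: 'a::euclidean_space \<Rightarrow> real. origin_cutoff C \<epsilon> \<theta>"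
proof -
  obtain L where L: "L > 0" "\<And>x. deriv smooth_step x \<le> L"
    using deriv_smooth_step_bounded by blast
  note S = DERIV_smooth_step deriv_smooth_step_nonneg L(2) deriv_smooth_step_0[OF disjI2] L(1)
  let ?S' = "deriv smooth_step"
  have "\<exists>\<theta> :: 'a \<Rightarrow> real. origin_cutoff (4 * L) \<epsilon> \<theta>"
    if "\<epsilon> > 0" for \<epsilon> :: real
    unfolding origin_cutoff_def
  proof (intro exI conjI allI impI)
    let ?f = "\<lambda>x::'a. (x \<bullet> x) * (1 / \<epsilon>\<^sup>2) - 1"
    have f: "C1_on ?f UNIV"
      by (intro C1_on_diff C1_on_mult C1_on_inner C1_on_const C1_on_bounded_linear bounded_linear_ident)
    then show "C1_on (\<lambda>x. smooth_step (?f x)) UNIV" by (rule C1_on_smooth_step)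
    show "0 \<le> smooth_step (?f x)" "smooth_step (?f x) \<le> 1" for x
      by (rule smooth_step_nonneg smooth_step_le_1)+
    have n: "x \<bullet> x = (norm x)\<^sup>2" for x :: 'a by (simp add: dot_square_norm)
    show "smooth_step (?f x) = 0" if "norm x \<le> \<epsilon>" for x :: 'a
      using power_mono[OF that, of 2] \<open>\<epsilon> > 0\<close> by (intro smooth_step_0) (simp add: n field_simps)
    have big: "?f x \<ge> 1" if "norm x \<ge> 2 * \<epsilon>" for x :: 'a
    proof -
      have "4 \<le> (x \<bullet> x) * (1 / \<epsilon>\<^sup>2)"
        using power_mono[OF that, of 2] \<open>\<epsilon> > 0\<close> by (simp add: n field_simps)
      then show ?thesis by simp
    qed
    show "smooth_step (?f x) = 1" if "norm x \<ge> 2 * \<epsilon>" for x :: 'a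
      using big[OF that] by (rule smooth_step_1)
    fix x v :: 'a assume v: "norm v \<le> 1"
    have "(?f has_derivative (\<lambda>v. (x \<bullet> v + v \<bullet> x) * (1 / \<epsilon>\<^sup>2) - 0)) (at x)"
      by (intro derivative_intros)
    then have "frechet_derivative ?f (at x) = (\<lambda>v. (x \<bullet> v + v \<bullet> x) * (1 / \<epsilon>\<^sup>2) - 0)"
      by (rule frechet_derivative_at[symmetric])
    then have "frechet_derivative ?f (at x) v = 2 * (x \<bullet> v) * (1 / \<epsilon>\<^sup>2)"
      by (simp add: inner_commute)
    then have eq: "frechet_derivative (\<lambda>x. smooth_step (?f x)) (at x) v = ?S' (?f x) * (2 * (x \<bullet> v) * (1 / \<epsilon>\<^sup>2))"
      using f by (subst frechet_derivative_compose_real[OF _ S(1)]) (auto simp: C1_on_def)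
    show "\<bar>frechet_derivative (\<lambda>x. smooth_step (?f x)) (at x) v\<bar> \<le> 4 * L / \<epsilon> * indicat_real (cball 0 (2 * \<epsilon>)) x"
    proof (cases "norm x \<le> 2 * \<epsilon>")
      case True
      have "\<bar>x \<bullet> v\<bar> \<le> norm x * norm v" by (rule Cauchy_Schwarz_ineq2)
      also have "\<dots> \<le> (2 * \<epsilon>) * 1" using True v \<open>\<epsilon> > 0\<close> by (intro mult_mono) auto
      finally have xv: "\<bar>x \<bullet> v\<bar> \<le> 2 * \<epsilon>" by simp
      have "\<bar>?S' (?f x) * (2 * (x \<bullet> v) * (1 / \<epsilon>\<^sup>2))\<bar> = ?S' (?f x) * (2 * \<bar>x \<bullet> v\<bar> * (1 / \<epsilon>\<^sup>2))"
        using S(2) by (simp add: abs_mult)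
      also have "\<dots> \<le> L * (2 * (2 * \<epsilon>) * (1 / \<epsilon>\<^sup>2))"
        using S(3) xv S(5) by (intro mult_mono) auto
      also have "\<dots> = 4 * L / \<epsilon>" using \<open>\<epsilon> > 0\<close> by (simp add: power2_eq_square)
      finally show ?thesis unfolding eq using True by simp
    next
      case False
      then show ?thesis unfolding eq using S(4)[OF big[of x]] by simp
    qed
  qed
  then show ?thesis using S(5) by (intro that[of "4 * L"]) auto
qed

lemma small_ball_error:
  assumes "DIM('a::euclidean_space) > 1"
  shows "((\<lambda>\<epsilon>. (c + C / \<epsilon>) * measure lebesgue (cball (0::'a) (2 * \<epsilon>))) \<longlongrightarrow> 0) (at_right 0)"
proof -
  let ?d = "DIM('a)"
  have 1: "((\<lambda>\<epsilon>. (c * \<epsilon> + C) * (unit_ball_vol (real ?d) * (2 ^ ?d * \<epsilon> ^ (?d - 1)))) \<longlongrightarrow>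
      (c * 0 + C) * (unit_ball_vol (real ?d) * (2 ^ ?d * 0 ^ (?d - 1)))) (at_right 0)"
    by (intro tendsto_intros)
  have eq: "(c * \<epsilon> + C) * (unit_ball_vol (real ?d) * (2 ^ ?d * \<epsilon> ^ (?d - 1)))
      = (c + C / \<epsilon>) * measure lebesgue (cball (0::'a) (2 * \<epsilon>))" if "\<epsilon> > 0" for \<epsilon> :: real
  proof -
    have "\<epsilon> ^ ?d = \<epsilon> * \<epsilon> ^ (?d - 1)" by (metis DIM_positive power_eq_if not_less0)
    then show ?thesis
      using that by (simp add: content_cball power_mult_distrib field_simps)
  qed
  have "\<forall>\<^sub>F \<epsilon> in at_right 0. (c * \<epsilon> + C) * (unit_ball_vol (real ?d) * (2 ^ ?d * \<epsilon> ^ (?d - 1)))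
      = (c + C / \<epsilon>) * measure lebesgue (cball (0::'a) (2 * \<epsilon>))"
    by (rule eventually_mono[OF eventually_at_right_less eq])
  from Lim_transform_eventually[OF 1 this]
  show ?thesis using assms by (simp only: zero_power zero_less_diff mult_zero_right)
qed

context simons_involution
begin

text \<open>Multiply \<open>\<zeta>\<close> by a smooth step function of \<open>- n q\<close> and integrate the divergence
  over the whole space. In the transition layer the normal component of \<open>\<zeta>\<close> is at least a
  negative multiple of \<open>\<bar>q\<bar>\<close>, since it is nonnegative on the cone and Lipschitz; this
  compensates the slope \<open>n\<close> of the step, and the layers decrease to the empty set.\<close>

lemma calibration_inequality:
  assumes C1: "C1_on \<zeta> UNIV" and supp: "\<And>x. norm x > r \<Longrightarrow> \<zeta> x = 0"
    and origin: "\<epsilon> > 0" "\<And>x. norm x < \<epsilon> \<Longrightarrow> \<zeta> x = 0"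
    and outward: "\<And>x. q x = 0 \<Longrightarrow> 0 \<le> \<zeta> x \<bullet> J x"
  shows "0 \<le> set_lebesgue_integral lebesgue neg_side (divergence \<zeta>)"
proof -
  obtain L where L: "L > 0" "\<And>x. deriv smooth_step x \<le> L"
    using deriv_smooth_step_bounded by blast
  note S = DERIV_smooth_step deriv_smooth_step_nonneg L(2)
    deriv_smooth_step_0[OF disjI1] deriv_smooth_step_0[OF disjI2] L(1)
  let ?S' = "deriv smooth_step"
  define a where "a x = \<zeta> x \<bullet> J x" for x
  have a: "C1_on a UNIV" unfolding a_def [abs_def] by (intro C1_on_inner C1 C1_on_J)
  have a0: "a x = 0" if "norm x > r" for x using supp[OF that] by (simp add: a_def)
  obtain C where C: "C > 0" "\<And>x y. \<bar>a x - a y\<bar> \<le> C * norm (x - y)"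
    "\<And>x v. \<bar>frechet_derivative a (at x) v\<bar> \<le> C * norm v"
    by (rule C1_lipschitz[of a r, OF a a0]) (assumption, rule that)
  have a_lower: "- (C / \<epsilon>) * \<bar>q x\<bar> \<le> a x" if "q x < 0" for x
  proof (cases "norm x < \<epsilon>")
    case True
    then show ?thesis using origin C(1) by (simp add: a_def)
  next
    case False
    have nz: "x \<noteq> 0" using that by auto
    \<comment> \<open>By \<open>q_flow\<close> the flow along \<open>J x\<close> reaches the cone no later than at time \<open>s\<close>.\<close>
    define s where "s = - q x / (x \<bullet> x)"
    have "x \<bullet> x > 0" using nz by simp
    then have s: "0 \<le> s" "s \<le> 1" "s * (x \<bullet> x) = - q x"
      using that abs_q_le[of x] by (auto simp: s_def divide_nonpos_nonneg pos_le_divide_eq)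
    have "s\<^sup>2 \<le> 1" using s by (simp add: power_le_one)
    then have "q x * s\<^sup>2 \<ge> q x * 1" using that by (intro mult_left_mono_neg) auto
    then have "q (x + s *\<^sub>R J x) \<ge> 0"
      unfolding q_flow using s(3) by (simp add: algebra_simps)
    moreover have "continuous_on {0..s} (\<lambda>t. q (x + t *\<^sub>R J x))"
      by (intro continuous_on_compose2[OF continuous_on_q[of UNIV]] continuous_intros) auto
    moreover have "q (x + 0 *\<^sub>R J x) \<le> 0" using that by simp
    ultimately obtain t where t: "0 \<le> t" "t \<le> s" "q (x + t *\<^sub>R J x) = 0"
      using IVT'[of "\<lambda>t. q (x + t *\<^sub>R J x)" 0 0 s] s(1) by blast
    have "s * norm x * \<epsilon> \<le> s * norm x * norm x"
      using False s by (intro mult_left_mono) auto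
    also have "\<dots> = - q x" using s(3) by (simp add: dot_square_norm power2_eq_square)
    finally have "s * norm x \<le> \<bar>q x\<bar> / \<epsilon>" using origin(1) that by (simp add: field_simps)
    then have "t * norm x \<le> \<bar>q x\<bar> / \<epsilon>"
      using t(2) by (meson mult_right_mono norm_ge_zero order_trans)
    then have "\<bar>a x - a (x + t *\<^sub>R J x)\<bar> \<le> C * (\<bar>q x\<bar> / \<epsilon>)"
      using C(2)[of x "x + t *\<^sub>R J x"] C(1) t(1)
      by (smt (verit) add_diff_cancel_left' mult_left_mono norm_J norm_minus_commute norm_scaleR)
    moreover have "a (x + t *\<^sub>R J x) \<ge> 0" using outward[OF t(3)] by (simp add: a_def)
    ultimately show ?thesis by (simp add: abs_le_iff)
  qed
  define H where "H n x = smooth_step (- real n * q x)" for n x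
  have H_C1: "C1_on (H n) UNIV" for n
    unfolding H_def [abs_def] by (intro C1_on_smooth_step C1_on_mult C1_on_const C1_on_q)
  have H_deriv: "frechet_derivative (H n) (at x) v = ?S' (- real n * q x) * (- real n * (2 * (J x \<bullet> v)))" for n x v
  proof -
    have "((\<lambda>x. - real n * q x) has_derivative (\<lambda>v. - real n * (2 * (J x \<bullet> v)))) (at x)"
      by (intro derivative_intros has_derivative_q)
    then have "frechet_derivative (\<lambda>x. - real n * q x) (at x) v = - real n * (2 * (J x \<bullet> v))"
      and "(\<lambda>x. - real n * q x) differentiable (at x)"
      using frechet_derivative_at unfolding differentiable_def by metis+
    then show ?thesis unfolding H_def [abs_def]
      by (subst frechet_derivative_compose_real[OF _ S(1)]) auto
  qed
  \<comment> \<open>The layer in which the step function is not constant; it contains no point of the cone.\<close>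
  define A where "A n = {x. norm x \<le> r \<and> q x < 0 \<and> - 1 \<le> real n * q x}" for n
  define D where "D = 2 * L * (C / \<epsilon>)"
  have D: "D \<ge> 0" using S(6) C(1) origin(1) by (simp add: D_def)
  have div_le: "divergence (\<lambda>x. H n x *\<^sub>R \<zeta> x) x \<le> H n x * divergence \<zeta> x + D * indicat_real (A n) x" for n x
  proof -
    have eq: "divergence (\<lambda>x. H n x *\<^sub>R \<zeta> x) x =
        H n x * divergence \<zeta> x - 2 * real n * ?S' (- real n * q x) * a x"
      using H_C1[of n] C1
      by (subst divergence_scaleR) (auto simp: C1_on_def H_deriv a_def inner_commute)
    have "- (2 * real n * ?S' (- real n * q x) * a x) \<le> D * indicat_real (A n) x"
    proof (cases "x \<in> A n")
      case True
      have "- a x \<le> C / \<epsilon> * \<bar>q x\<bar>" using a_lower[of x] True by (simp add: A_def)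
      then have "2 * real n * ?S' (- real n * q x) * (- a x) \<le> 2 * real n * ?S' (- real n * q x) * (C / \<epsilon> * \<bar>q x\<bar>)"
        using S(2) by (intro mult_left_mono) auto
      also have "\<dots> = 2 * ?S' (- real n * q x) * (C / \<epsilon>) * (real n * \<bar>q x\<bar>)" by simp
      also have "\<dots> \<le> 2 * L * (C / \<epsilon>) * 1"
        using S(2,3,6) C(1) origin(1) True by (intro mult_mono) (auto simp: A_def mult_nonneg_nonpos)
      finally show ?thesis using True by (simp add: D_def)
    next
      case False
      then consider "norm x > r" | "q x \<ge> 0" | "real n * q x < - 1" by (force simp: A_def)
      then have "?S' (- real n * q x) * a x = 0"
      proof cases
        case 1 then show ?thesis by (simp add: a_def supp)
      next
        case 2
        then have "- real n * q x \<le> 0" by simp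
        then show ?thesis using S(4) by simp
      next
        case 3
        then have "- real n * q x \<ge> 1" by simp
        then show ?thesis using S(5) by simp
      qed
      then show ?thesis using D by (auto simp: mult.assoc)
    qed
    then show ?thesis unfolding eq by simp
  qed
  have int_div: "integrable lebesgue (divergence \<zeta>)" using C1 supp by (rule integrable_divergence)
  have A_meas: "A n \<in> sets borel" for n
  proof -
    have "A n = cball 0 r \<inter> neg_side \<inter> {x. - 1 \<le> real n * q x}" by (auto simp: A_def neg_side_def)
    moreover have "closed {x. - 1 \<le> real n * q x}" by (intro closed_Collect_le continuous_intros)
    ultimately show ?thesis using open_neg_side by auto
  qed
  have neg_side_meas: "neg_side \<in> sets borel" using open_neg_side by simp
  have H_meas: "H n \<in> borel_measurable borel" for n
    using C1_on_imp_continuous_on[OF H_C1] by (rule borel_measurable_continuous_onI)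
  have H_le: "0 \<le> H n x" "H n x \<le> 1" for n x
    by (auto simp: H_def smooth_step_nonneg smooth_step_le_1)
  have div_meas: "divergence \<zeta> \<in> borel_measurable borel"
    by (intro borel_measurable_continuous_onI continuous_on_divergence C1)
  have cball_int: "integrable lebesgue (indicat_real (cball (0::'a) r))"
    by (intro integrable_real_indicator) (use emeasure_bounded_finite[OF bounded_cball, of 0 r] in \<open>auto simp: less_top\<close>)
  let ?w = "\<lambda>n x. H n x * divergence \<zeta> x + D * indicat_real (A n) x"
  have dom: "\<bar>?w n x\<bar> \<le> \<bar>divergence \<zeta> x\<bar> + D * indicat_real (cball 0 r) x" for n x
  proof -
    have "\<bar>H n x * divergence \<zeta> x\<bar> \<le> \<bar>divergence \<zeta> x\<bar>"
      using H_le[of n x] by (simp add: abs_mult mult_left_le_one_le)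
    moreover have "\<bar>D * indicat_real (A n) x\<bar> \<le> D * indicat_real (cball 0 r) x"
      using D by (auto simp: A_def indicator_def)
    ultimately show ?thesis by linarith
  qed
  have dom_int: "integrable lebesgue (\<lambda>x. \<bar>divergence \<zeta> x\<bar> + D * indicat_real (cball 0 r) x)"
    using int_div cball_int by auto
  have w_meas: "?w n \<in> borel_measurable lebesgue" for n
    using H_meas[of n] div_meas A_meas[of n] by (intro measurable_completion) simp
  have w_lim: "(\<lambda>n. ?w n x) \<longlonglongrightarrow> indicat_real neg_side x * divergence \<zeta> x" for x
  proof (cases "q x < 0")
    case True
    obtain m :: nat where m: "1 / \<bar>q x\<bar> < real m" using reals_Archimedean2 by blast
    have "?w n x = divergence \<zeta> x" if "n \<ge> m" for n
    proof -
      have "1 / \<bar>q x\<bar> < real n" using m that by simp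
      then have "real n * q x < - 1" using True by (simp add: field_simps)
      then show ?thesis by (simp add: H_def smooth_step_1 A_def)
    qed
    then have "(\<lambda>n. ?w n x) \<longlonglongrightarrow> divergence \<zeta> x"
      by (intro tendsto_eventually) (auto simp: eventually_sequentially)
    then show ?thesis using True by (simp add: neg_side_def)
  next
    case False
    then have "?w n x = 0" for n by (simp add: H_def smooth_step_0 A_def)
    then show ?thesis using False by (simp add: neg_side_def)
  qed
  have "(\<lambda>n. \<integral>x. ?w n x \<partial>lebesgue) \<longlonglongrightarrow> (\<integral>x. indicat_real neg_side x * divergence \<zeta> x \<partial>lebesgue)"
  proof (rule integral_dominated_convergence[OF _ _ dom_int])
    show "(\<lambda>x. indicat_real neg_side x * divergence \<zeta> x) \<in> borel_measurable lebesgue"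
      using neg_side_meas div_meas by (intro measurable_completion) simp
  qed (use w_meas w_lim dom in auto)
  moreover have "0 \<le> (\<integral>x. ?w n x \<partial>lebesgue)" for n
  proof -
    have C1': "C1_on (\<lambda>x. H n x *\<^sub>R \<zeta> x) UNIV" by (intro C1_on_scaleR H_C1 C1)
    have supp': "H n x *\<^sub>R \<zeta> x = 0" if "norm x > r" for x using supp[OF that] by simp
    have "0 = (\<integral>x. divergence (\<lambda>x. H n x *\<^sub>R \<zeta> x) x \<partial>lebesgue)"
      using integral_divergence_zero[OF C1' supp'] by simp
    also have "\<dots> \<le> (\<integral>x. ?w n x \<partial>lebesgue)"
    proof (rule integral_mono[OF integrable_divergence[OF C1' supp'] _ div_le])
      show "integrable lebesgue (?w n)"
        by (rule Bochner_Integration.integrable_bound[OF dom_int w_meas]) (use dom[of n] D in \<open>auto simp: abs_of_nonneg\<close>)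
    qed
    finally show ?thesis .
  qed
  ultimately show ?thesis
    unfolding set_lebesgue_integral_def by (simp add: LIMSEQ_le_const)
qed

end

section \<open>Comparison of fluxes through the cone\<close>

abbreviation flux :: "'a::euclidean_space set \<Rightarrow> ('a \<Rightarrow> 'a) \<Rightarrow> real" where
  "flux E \<psi> \<equiv> set_lebesgue_integral lebesgue E (divergence \<psi>)"

lemma set_integrable_divergence:
  assumes "C1_on \<psi> UNIV" "\<And>x. norm x > r \<Longrightarrow> \<psi> x = 0" "E \<in> sets lebesgue"
  shows "set_integrable lebesgue E (divergence \<psi>)"
  unfolding set_integrable_def
  using assms(3) integrable_divergence[OF assms(1,2)] by (rule integrable_mult_indicator)

lemma divergence_bounded:
  assumes C1: "C1_on \<psi> UNIV" and supp: "\<And>x. norm x > r \<Longrightarrow> \<psi> x = 0"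
  shows "\<exists>c>0. \<forall>x. \<bar>divergence \<psi> x\<bar> \<le> c"
proof -
  have 0: "divergence \<psi> x = 0" if "norm x > r" for x
    using supp that by (rule divergence_zero_outside)
  show ?thesis
    by (rule bounded_continuous_bounded_support[of "divergence \<psi>" r, OF continuous_on_divergence[OF C1] 0])
      (assumption, force)
qed

lemma integrable_indicator_cball: "integrable lebesgue (indicat_real (cball (0::'a::euclidean_space) r))"
  by (intro integrable_real_indicator)
    (use emeasure_bounded_finite[OF bounded_cball, of 0 r] in \<open>auto simp: less_top\<close>)

lemma test_fieldsD:
  assumes "\<psi> \<in> test_fields \<Omega>"
  shows "C1_on \<psi> UNIV" "norm (\<psi> x) \<le> 1" "compact (closure {x. \<psi> x \<noteq> 0})"
    "closure {x. \<psi> x \<noteq> 0} \<subseteq> \<Omega>" "\<exists>r>0. \<forall>x. norm x > r \<longrightarrow> \<psi> x = 0"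
proof -
  show "C1_on \<psi> UNIV" "norm (\<psi> x) \<le> 1" "compact (closure {x. \<psi> x \<noteq> 0})"
    "closure {x. \<psi> x \<noteq> 0} \<subseteq> \<Omega>"
    using assms by (auto simp: test_fields_def)
  then obtain r where "r > 0" "\<And>x. x \<in> closure {x. \<psi> x \<noteq> 0} \<Longrightarrow> norm x \<le> r"
    using compact_imp_bounded bounded_pos by metis
  moreover have "{x. \<psi> x \<noteq> 0} \<subseteq> closure {x. \<psi> x \<noteq> 0}" by (rule closure_subset)
  ultimately show "\<exists>r>0. \<forall>x. norm x > r \<longrightarrow> \<psi> x = 0"
    by (intro exI[of _ r]) (auto simp: not_le[symmetric])
qed

context simons_involution
begin

lemma C1_on_cut_field:
  assumes \<theta>: "origin_cutoff C \<epsilon> \<theta>" "0 < \<epsilon>" and g: "C1_on g (- {0})"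
  shows "C1_on (\<lambda>x. (\<theta> x * g x) *\<^sub>R X x) UNIV"
proof (rule C1_on_local)
  fix x :: 'a
  have "C1_on \<theta> (- {0})" using \<theta>(1) C1_on_subset unfolding origin_cutoff_def by blast
  then have 1: "C1_on (\<lambda>x. (\<theta> x * g x) *\<^sub>R X x) (- {0})"
    by (intro C1_on_scaleR C1_on_mult g C1_on_X)
  have 2: "C1_on (\<lambda>x. (\<theta> x * g x) *\<^sub>R X x) (ball 0 \<epsilon>)"
    by (rule C1_on_cong_open[OF C1_on_const[of 0]]) (use \<theta>(1) in \<open>auto simp: origin_cutoff_def\<close>)
  show "\<exists>V. open V \<and> x \<in> V \<and> C1_on (\<lambda>x. (\<theta> x * g x) *\<^sub>R X x) V"
  proof (cases "x = 0")
    case True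
    then show ?thesis using 2 \<theta>(2) by (intro exI[of _ "ball 0 \<epsilon>"]) simp
  next
    case False
    then show ?thesis using 1 by (intro exI[of _ "- {0}"]) (simp add: open_Compl)
  qed
qed

lemma divergence_cut_field:
  assumes \<theta>: "origin_cutoff C \<epsilon> \<theta>" and g: "C1_on g (- {0})" and x: "x \<noteq> 0"
  shows "divergence (\<lambda>x. (\<theta> x * g x) *\<^sub>R X x) x =
    \<theta> x * g x * divergence X x + \<theta> x * frechet_derivative g (at x) (X x)
      + g x * frechet_derivative \<theta> (at x) (X x)"
proof -
  have d: "\<theta> differentiable (at x)" "g differentiable (at x)" "X differentiable (at x)"
    using \<theta> g x C1_on_X by (auto simp: origin_cutoff_def C1_on_def)
  then have "((\<lambda>x. \<theta> x * g x) has_derivative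
      (\<lambda>v. \<theta> x * frechet_derivative g (at x) v + frechet_derivative \<theta> (at x) v * g x)) (at x)"
    by (intro has_derivative_mult) (auto simp: frechet_derivative_works)
  from frechet_derivative_at[OF this, symmetric]
  show ?thesis using d
    by (subst divergence_scaleR) (auto simp: differentiable_mult algebra_simps)
qed

lemma X_on_cone:
  assumes "q x = 0" "x \<noteq> 0"
  shows "X x \<bullet> J x = norm x"
proof -
  have "B x = ((norm x) ^ 3)\<^sup>2"
    using assms by (simp add: B_def dot_square_norm power_mult [symmetric])
  then have "sqrt (B x) = norm x ^ 3" by (simp only: real_sqrt_abs) simp
  then have "J x \<bullet> X x = norm x"
    using assms by (simp add: inner_X dot_square_norm power2_eq_square power3_eq_cube)
  then show ?thesis by (simp add: inner_commute)
qed

text \<open>On the cone \<open>X\<close> is the unit normal, so \<open>g X\<close> dominates \<open>\<psi>\<close> in the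
  normal direction; apply \<open>calibration_inequality\<close> to \<open>\<theta> (g X - \<psi>)\<close>. The
  last term pays for cutting \<open>\<psi>\<close> off at the origin.\<close>

lemma flux_le_cut_field:
  assumes \<theta>: "origin_cutoff C \<epsilon> \<theta>" "0 < \<epsilon>" "0 \<le> C"
    and g: "C1_on g (- {0})" "\<And>x. 0 \<le> g x" "\<And>x. norm x > r \<Longrightarrow> g x = 0"
    and \<psi>: "C1_on \<psi> UNIV" "\<And>x. norm (\<psi> x) \<le> 1" "\<And>x. norm x > r \<Longrightarrow> \<psi> x = 0"
    and c: "\<And>x. \<bar>divergence \<psi> x\<bar> \<le> c"
    and g1: "\<And>x. x \<noteq> 0 \<Longrightarrow> \<psi> x \<noteq> 0 \<Longrightarrow> 1 \<le> g x"
  shows "flux neg_side \<psi> \<le> flux neg_side (\<lambda>x. (\<theta> x * g x) *\<^sub>R X x)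
    + (c + C / \<epsilon>) * measure lebesgue (cball (0::'a) (2 * \<epsilon>))"
proof -
  define F where "F x = (\<theta> x * g x) *\<^sub>R X x" for x
  define P where "P x = \<theta> x *\<^sub>R \<psi> x" for x
  have th: "C1_on \<theta> UNIV" "0 \<le> \<theta> x" "\<theta> x \<le> 1" "norm x \<le> \<epsilon> \<Longrightarrow> \<theta> x = 0" for x
    using \<theta>(1) by (auto simp: origin_cutoff_def)
  have F: "C1_on F UNIV" "norm x > r \<Longrightarrow> F x = 0" for x
    unfolding F_def [abs_def] using C1_on_cut_field[OF \<theta>(1,2) g(1)] g(3) by auto
  have P: "C1_on P UNIV" "norm x > r \<Longrightarrow> P x = 0" for x
    unfolding P_def [abs_def] using th(1) \<psi>(1,3) by (auto intro: C1_on_scaleR)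
  have neg_side: "neg_side \<in> sets lebesgue" using open_neg_side by simp
  have int: "set_integrable lebesgue neg_side (divergence F)" "set_integrable lebesgue neg_side (divergence P)"
    "set_integrable lebesgue neg_side (divergence \<psi>)"
    by (rule set_integrable_divergence[OF F neg_side] set_integrable_divergence[OF P neg_side]
        set_integrable_divergence[OF \<psi>(1,3) neg_side]; assumption)+
  have "0 \<le> flux neg_side (\<lambda>x. F x - P x)"
  proof (rule calibration_inequality[of _ r \<epsilon>])
    show "C1_on (\<lambda>x. F x - P x) UNIV" by (intro C1_on_diff F P)
    show "F x - P x = 0" if "norm x > r" for x using F(2) P(2) that by simp
    show "F x - P x = 0" if "norm x < \<epsilon>" for x using th(4)[of x] that by (simp add: F_def P_def)
    fix x assume x: "q x = 0"
    show "0 \<le> (F x - P x) \<bullet> J x"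
    proof (cases "x = 0")
      case False
      have "\<psi> x \<bullet> J x \<le> g x * norm x"
      proof (cases "\<psi> x = 0")
        case False
        have "\<psi> x \<bullet> J x \<le> norm (\<psi> x) * norm (J x)" by (rule norm_cauchy_schwarz)
        also have "\<dots> \<le> g x * norm x"
          using g1[OF \<open>x \<noteq> 0\<close> False] \<psi>(2)[of x] by (simp add: mult_right_mono)
        finally show ?thesis .
      qed (simp add: g(2))
      then have "0 \<le> \<theta> x * (g x * norm x - \<psi> x \<bullet> J x)" using th(2)[of x] by simp
      also have "\<dots> = (F x - P x) \<bullet> J x"
        using X_on_cone[OF x False] by (simp add: F_def P_def inner_diff_left algebra_simps)
      finally show ?thesis .
    qed simp
  qed (use \<theta>(2) in auto)
  also have "flux neg_side (\<lambda>x. F x - P x) = flux neg_side F - flux neg_side P"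
  proof -
    have "divergence (\<lambda>x. F x - P x) = (\<lambda>x. divergence F x - divergence P x)"
      using F(1) P(1) by (auto simp: fun_eq_iff divergence_diff C1_on_def)
    then show ?thesis using set_integral_diff(2)[OF int(1,2)] by simp
  qed
  finally have 1: "flux neg_side P \<le> flux neg_side F" by simp
  have "flux neg_side \<psi> - flux neg_side P = (\<integral>x. indicat_real neg_side x * (divergence \<psi> x - divergence P x) \<partial>lebesgue)"
    using int by (subst set_integral_diff(2)[symmetric]) (simp_all add: set_lebesgue_integral_def)
  also have "\<dots> \<le> (\<integral>x. (c + C / \<epsilon>) * indicat_real (cball (0::'a) (2 * \<epsilon>)) x \<partial>lebesgue)"
  proof (rule integral_mono)
    show "integrable lebesgue (\<lambda>x. indicat_real neg_side x * (divergence \<psi> x - divergence P x))"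
      using set_integral_diff(1)[OF int(3,2)] by (simp add: set_integrable_def)
    show "integrable lebesgue (\<lambda>x. (c + C / \<epsilon>) * indicat_real (cball (0::'a) (2 * \<epsilon>)) x)"
      using integrable_indicator_cball by auto
    fix x :: 'a
    have "c \<ge> 0" using c[of x] by linarith
    have "divergence P x = \<theta> x * divergence \<psi> x + frechet_derivative \<theta> (at x) (\<psi> x)"
      unfolding P_def [abs_def] using th(1) \<psi>(1) by (intro divergence_scaleR) (auto simp: C1_on_def)
    moreover have "\<bar>frechet_derivative \<theta> (at x) (\<psi> x)\<bar> \<le> C / \<epsilon> * indicat_real (cball (0::'a) (2 * \<epsilon>)) x"
      using \<theta>(1) \<psi>(2) by (simp add: origin_cutoff_def)
    moreover have "(1 - \<theta> x) * divergence \<psi> x \<le> c * indicat_real (cball (0::'a) (2 * \<epsilon>)) x"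
    proof (cases "norm x \<le> 2 * \<epsilon>")
      case True
      have "(1 - \<theta> x) * divergence \<psi> x \<le> (1 - \<theta> x) * c"
        using c[of x] th(3)[of x] by (intro mult_left_mono) auto
      also have "\<dots> \<le> 1 * c" using th(2)[of x] \<open>c \<ge> 0\<close> by (intro mult_right_mono) auto
      finally show ?thesis using True by simp
    next
      case False
      then have "\<theta> x = 1" using \<theta>(1) by (simp add: origin_cutoff_def)
      then show ?thesis using False by simp
    qed
    ultimately have "divergence \<psi> x - divergence P x \<le> (c + C / \<epsilon>) * indicat_real (cball (0::'a) (2 * \<epsilon>)) x"
      by (simp add: algebra_simps)
    moreover have "0 \<le> (c + C / \<epsilon>) * indicat_real (cball (0::'a) (2 * \<epsilon>)) x"
      using \<open>c \<ge> 0\<close> \<theta>(2,3) by simp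
    ultimately show "indicat_real neg_side x * (divergence \<psi> x - divergence P x)
        \<le> (c + C / \<epsilon>) * indicat_real (cball (0::'a) (2 * \<epsilon>)) x"
      by (cases "x \<in> neg_side") auto
  qed
  also have "\<dots> = (c + C / \<epsilon>) * measure lebesgue (cball (0::'a) (2 * \<epsilon>))"
    by simp
  finally show ?thesis using 1 by (simp add: F_def [abs_def])
qed

text \<open>Compare every test field with one cut-off of \<open>X\<close> on a large ball. Inside \<open>neg_side\<close>
  the divergence of \<open>X\<close> is negative, and only the gradients of the cut-offs contribute.\<close>

lemma perimeter_neg_side_finite:
  assumes "bounded \<Omega>"
  shows "perimeter \<Omega> neg_side < \<infinity>"
proof -
  obtain r where r: "r > 0" "\<And>x. x \<in> \<Omega> \<Longrightarrow> norm x \<le> r"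
    using assms bounded_pos by metis
  define g :: "'a \<Rightarrow> real" where "g x = smooth_step (2 - (x \<bullet> x) * (1 / r\<^sup>2))" for x
  have g: "C1_on g UNIV"
    unfolding g_def [abs_def] by (intro C1_on_smooth_step C1_on_diff C1_on_mult C1_on_const C1_on_square_norm)
  have g0: "g x = 0" if "norm x > 2 * r" for x
  proof -
    have "4 * r\<^sup>2 \<le> x \<bullet> x"
      using power_mono[of "2 * r" "norm x" 2] that r(1) by (simp add: dot_square_norm)
    then have "4 \<le> (x \<bullet> x) * (1 / r\<^sup>2)" using r(1) by (simp add: field_simps)
    then show ?thesis by (simp add: g_def smooth_step_0)
  qed
  have g1: "g x = 1" if "norm x \<le> r" for x
  proof -
    have "x \<bullet> x \<le> r\<^sup>2"
      using power_mono[of "norm x" r 2] that r(1) by (simp add: dot_square_norm)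
    then have "(x \<bullet> x) * (1 / r\<^sup>2) \<le> 1" using r(1) by (simp add: field_simps)
    then show ?thesis by (simp add: g_def smooth_step_1)
  qed
  obtain L where L: "L > 0" "\<And>x y. \<bar>g x - g y\<bar> \<le> L * norm (x - y)"
    "\<And>x v. \<bar>frechet_derivative g (at x) v\<bar> \<le> L * norm v"
    by (rule C1_lipschitz[of g "2 * r", OF g g0]) (assumption, rule that)
  obtain C where C: "C > 0" "\<And>\<epsilon>. \<epsilon> > 0 \<Longrightarrow> \<exists>\<theta> :: 'a \<Rightarrow> real. origin_cutoff C \<epsilon> \<theta>"
    by (rule origin_cutoffs) (rule that)
  define V where "V \<epsilon> = measure lebesgue (cball (0::'a) (2 * \<epsilon>))" for \<epsilon>
  define M where "M = L * measure lebesgue (cball (0::'a) (2 * r))"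
  have "flux neg_side \<psi> \<le> M" if \<psi>: "\<psi> \<in> test_fields \<Omega>" for \<psi>
  proof -
    note \<psi>' = test_fieldsD[OF \<psi>]
    have out: "\<psi> x = 0" if "norm x > r" for x
      using \<psi>'(4) r(2)[of x] closure_subset[of "{x. \<psi> x \<noteq> 0}"] that by force
    then have out2: "\<psi> x = 0" if "norm x > 2 * r" for x using that r(1) by simp
    obtain c where c: "c > 0" "\<And>x. \<bar>divergence \<psi> x\<bar> \<le> c"
      using divergence_bounded[of \<psi> r] \<psi>'(1) out by blast
    have le: "flux neg_side \<psi> \<le> M + (c + 2 * C / \<epsilon>) * V \<epsilon>" if \<epsilon>: "\<epsilon> > 0" for \<epsilon>
    proof -
      obtain \<theta> :: "'a \<Rightarrow> real" where \<theta>: "origin_cutoff C \<epsilon> \<theta>" using C(2)[OF \<epsilon>] by blast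
      define F where "F x = (\<theta> x * g x) *\<^sub>R X x" for x
      have g': "C1_on g (- {0})" using C1_on_subset[OF g] by blast
      have F: "C1_on F UNIV" "norm x > 2 * r \<Longrightarrow> F x = 0" for x
        unfolding F_def [abs_def] using C1_on_cut_field[OF \<theta> \<epsilon> g'] g0 by auto
      have neg_side: "neg_side \<in> sets lebesgue" using open_neg_side by simp
      have "flux neg_side \<psi> \<le> flux neg_side F + (c + C / \<epsilon>) * V \<epsilon>"
        unfolding V_def F_def [abs_def]
      proof (rule flux_le_cut_field[OF \<theta> \<epsilon> _ g' _ g0 \<psi>'(1,2) out2])
        show "0 \<le> g x" for x by (simp add: g_def smooth_step_nonneg)
        show "1 \<le> g x" if "\<psi> x \<noteq> 0" for x using g1[of x] out[of x] that by force
        show "\<bar>divergence \<psi> x\<bar> \<le> c" for x by (rule c(2))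
      qed (use C(1) in auto)
      also have "flux neg_side F \<le> (\<integral>x. L * indicat_real (cball (0::'a) (2 * r)) x +
          C / \<epsilon> * indicat_real (cball (0::'a) (2 * \<epsilon>)) x \<partial>lebesgue)"
        unfolding set_lebesgue_integral_def
      proof (rule integral_mono)
        show "integrable lebesgue (\<lambda>x. indicat_real neg_side x *\<^sub>R divergence F x)"
          using set_integrable_divergence[of F "2 * r"] F neg_side by (simp add: set_integrable_def)
        show "integrable lebesgue (\<lambda>x. L * indicat_real (cball (0::'a) (2 * r)) x +
            C / \<epsilon> * indicat_real (cball (0::'a) (2 * \<epsilon>)) x)"
          using integrable_indicator_cball by (intro Bochner_Integration.integrable_add integrable_mult_right)
        fix x :: 'a
        have rhs: "0 \<le> L * indicat_real (cball 0 (2 * r)) x + C / \<epsilon> * indicat_real (cball (0::'a) (2 * \<epsilon>)) x"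
          using L(1) C(1) \<epsilon> by simp
        show "indicat_real neg_side x *\<^sub>R divergence F x
          \<le> L * indicat_real (cball 0 (2 * r)) x + C / \<epsilon> * indicat_real (cball (0::'a) (2 * \<epsilon>)) x"
        proof (cases "x \<in> neg_side")
          case True
          then have x: "x \<noteq> 0" "q x < 0" by (auto simp: neg_side_def)
          have th: "0 \<le> \<theta> x" "\<theta> x \<le> 1"
            "\<bar>frechet_derivative \<theta> (at x) (X x)\<bar> \<le> C / \<epsilon> * indicat_real (cball (0::'a) (2 * \<epsilon>)) x"
            using \<theta> norm_X[OF x(1)] by (auto simp: origin_cutoff_def)
          have gx: "0 \<le> g x" "g x \<le> 1" by (simp_all add: g_def smooth_step_nonneg smooth_step_le_1)
          have "\<theta> x * g x * divergence X x \<le> 0"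
            using th(1) gx(1) divergence_X_sign(2)[OF x] by (intro mult_nonneg_nonpos) auto
          moreover have "\<theta> x * frechet_derivative g (at x) (X x) \<le> L * indicat_real (cball 0 (2 * r)) x"
          proof (cases "norm x \<le> 2 * r")
            case True
            have "\<theta> x * frechet_derivative g (at x) (X x) \<le> \<theta> x * L"
              using L(3)[of x "X x"] norm_X[OF x(1)] th(1) by (intro mult_left_mono) auto
            also have "\<dots> \<le> L" using th(2) L(1) by simp
            finally show ?thesis using True by simp
          next
            case False
            then have "frechet_derivative g (at x) = (\<lambda>v. 0)"
              using g0 by (intro frechet_derivative_zero_open[of "- cball 0 (2 * r)"]) (auto simp: open_Compl)
            then show ?thesis using False by simp
          qed
          moreover have "g x * frechet_derivative \<theta> (at x) (X x) \<le> C / \<epsilon> * indicat_real (cball (0::'a) (2 * \<epsilon>)) x"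
          proof -
            have "g x * frechet_derivative \<theta> (at x) (X x) \<le> g x * \<bar>frechet_derivative \<theta> (at x) (X x)\<bar>"
              using gx by (intro mult_left_mono) auto
            also have "\<dots> \<le> \<bar>frechet_derivative \<theta> (at x) (X x)\<bar>"
              using gx by (simp add: mult_left_le_one_le)
            finally show ?thesis using th(3) by linarith
          qed
          ultimately show ?thesis
            unfolding F_def [abs_def] divergence_cut_field[OF \<theta> g' x(1)] using True by simp
        qed (use rhs in simp)
      qed
      also have "\<dots> = M + C / \<epsilon> * V \<epsilon>"
        using integrable_indicator_cball by (subst Bochner_Integration.integral_add) (auto simp: M_def V_def)
      finally show ?thesis by (simp add: algebra_simps)
    qed
    have "((\<lambda>\<epsilon>. M + (c + 2 * C / \<epsilon>) * V \<epsilon>) \<longlongrightarrow> M + 0) (at_right 0)"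
      unfolding V_def using dim by (intro tendsto_add tendsto_const small_ball_error) simp
    then show ?thesis
      using le by (intro tendsto_lowerbound[of _ "M", OF _ eventually_mono[OF eventually_at_right_less]]) auto
  qed
  then have "perimeter \<Omega> neg_side \<le> ereal M"
    unfolding perimeter_def by (intro SUP_least) simp
  also have "ereal M < \<infinity>" by simp
  finally show ?thesis .
qed

end

section \<open>Strict minimality in a domain that bends away from the cone\<close>

lemma borel_superlevel_punctured:
  fixes f :: "'a::euclidean_space \<Rightarrow> real"
  assumes "continuous_on (- {0}) f"
  shows "{x. x \<noteq> 0 \<and> c \<le> f x} \<in> sets borel"
proof -
  obtain T where T: "closed T" "(- {0}) \<inter> f -` {c..} = T \<inter> (- {0})"
    using continuous_on_closed_invariant[THEN iffD1, OF assms, rule_format, of "{c..}"] by auto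
  have "{x. x \<noteq> 0 \<and> c \<le> f x} = (- {0}) \<inter> T" using T(2) by auto
  moreover have "(- {0}) \<in> sets (borel :: 'a measure)" by auto
  moreover have "T \<in> sets borel" using T(1) by simp
  ultimately show ?thesis by simp
qed

text \<open>At the origin \<open>\<rho>\<close> need not be smooth, nor even continuous, since the latitude of a point is
  undefined there; this is why the origin is added to \<open>\<Omega>\<close> by hand.\<close>

locale superlevel_domain = simons_involution +
  fixes \<rho> :: "'a \<Rightarrow> real" and \<Omega> :: "'a set" and r :: real
  assumes \<Omega>_eq: "\<Omega> = {x. x = 0 \<or> 0 < \<rho> x}"
    and C1_\<rho>: "C1_on \<rho> (- {0})"
    and \<rho>_origin: "x \<noteq> 0 \<Longrightarrow> norm x < 1 / 2 \<Longrightarrow> 1 / 2 < \<rho> x"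
    and \<rho>_bounded: "r \<le> norm x \<Longrightarrow> \<rho> x \<le> 0"
begin

lemma continuous_on_\<rho>: "continuous_on (- {0}) \<rho>"
  using C1_\<rho> by (rule C1_on_imp_continuous_on)

lemma open_\<Omega>: "open \<Omega>"
proof -
  have "open ((- {0}) \<inter> \<rho> -` {0<..})"
    by (rule continuous_open_preimage[OF continuous_on_\<rho>]) (auto simp: open_Compl)
  moreover have "\<Omega> = ball 0 (1 / 2) \<union> ((- {0}) \<inter> \<rho> -` {0<..})"
    using \<rho>_origin by (force simp: \<Omega>_eq)
  ultimately show ?thesis by (simp only: open_Un open_ball)
qed

lemma norm_\<Omega>: "x \<in> \<Omega> \<Longrightarrow> x \<noteq> 0 \<Longrightarrow> norm x < r"
  using \<rho>_bounded[of x] by (force simp: \<Omega>_eq not_le[symmetric])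

lemma bounded_\<Omega>: "bounded \<Omega>"
  unfolding bounded_iff
proof (intro exI ballI)
  show "norm x \<le> max 0 r" if "x \<in> \<Omega>" for x
    using norm_\<Omega>[OF that] by (cases "x = 0") auto
qed

lemma \<rho>_lower_bound:
  assumes "compact F" "F \<subseteq> \<Omega>"
  obtains m where "m > 0" "\<And>x. x \<in> F \<Longrightarrow> x \<noteq> 0 \<Longrightarrow> m \<le> \<rho> x"
proof -
  let ?F = "F - ball 0 (1 / 2)"
  have F: "compact ?F" using assms(1) by (simp add: compact_diff)
  have c: "continuous_on ?F \<rho>" by (rule continuous_on_subset[OF continuous_on_\<rho>]) auto
  obtain m where m: "m > 0" "\<And>x. x \<in> ?F \<Longrightarrow> m \<le> \<rho> x"
  proof (cases "?F = {}")
    case True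
    show ?thesis by (rule that[of 1]) (use True in auto)
  next
    case False
    then obtain y where y: "y \<in> ?F" "\<And>x. x \<in> ?F \<Longrightarrow> \<rho> y \<le> \<rho> x"
      using continuous_attains_inf[OF F False c] by blast
    moreover have "\<rho> y > 0" using y(1) assms(2) by (force simp: \<Omega>_eq)
    ultimately show ?thesis using that by blast
  qed
  show ?thesis
  proof (rule that[of "min m (1 / 2)"])
    show "min m (1 / 2) \<le> \<rho> x" if "x \<in> F" "x \<noteq> 0" for x
      using m(2)[of x] \<rho>_origin[of x] that by (cases "norm x < 1 / 2") auto
  qed (use m(1) in simp)
qed

end

text \<open>\<open>G\<close> is a neighbourhood of the trace of the cone in which the boundary bends away from the cone;
  \<open>\<delta>\<close> is small enough for every boundary point within \<open>\<delta>\<close> of the trace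
  to lie in \<open>G\<close>.\<close>

locale simons_domain = superlevel_domain J \<rho> \<Omega> r
  for J :: "'a::euclidean_space \<Rightarrow> 'a" and \<rho> \<Omega> r +
  fixes G :: "'a set" and \<delta> :: real
  assumes open_G: "open G"
    and \<rho>_sign: "x \<in> G \<Longrightarrow> x \<noteq> 0 \<and> 0 \<le> q x * frechet_derivative \<rho> (at x) (X x)"
    and \<delta>_pos: "0 < \<delta>"
    and far_from_trace:
      "p \<in> frontier \<Omega> \<Longrightarrow> p \<notin> G \<Longrightarrow> z \<in> boundary_trace \<Omega> neg_side \<Longrightarrow> \<delta> \<le> dist p z"
begin

text \<open>Away from \<open>G\<close> the frontier is compact and covered by balls on which the competitor agrees with
  \<open>neg_side\<close>. Finitely many of them, with \<open>G\<close>, cover a neighbourhood of the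
  frontier, and \<open>\<rho>\<close> has a positive minimum on the rest.\<close>

lemma collar:
  assumes "competitor \<delta> \<Omega> neg_side E"
  obtains k where "k > 0"
    "AE x in lebesgue. x \<in> \<Omega> \<longrightarrow> x \<noteq> 0 \<longrightarrow> \<rho> x < k \<longrightarrow> x \<in> G \<or> (x \<in> E \<longleftrightarrow> x \<in> neg_side)"
proof -
  let ?D = "(neg_side - E) \<union> (E - neg_side)"
  have "\<exists>s>0. negligible (\<Omega> \<inter> ball p s \<inter> ?D)" if "p \<in> frontier \<Omega> - G" for p
    using assms far_from_trace that unfolding competitor_def C0_close_at_boundary_def by blast
  then obtain s where s: "\<And>p. p \<in> frontier \<Omega> - G \<Longrightarrow> s p > 0"
    "\<And>p. p \<in> frontier \<Omega> - G \<Longrightarrow> negligible (\<Omega> \<inter> ball p (s p) \<inter> ?D)" by metis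
  have "compact (frontier \<Omega> - G)"
    using compact_frontier_bounded[OF bounded_\<Omega>] open_G by (rule compact_diff)
  moreover have "open (ball p (s p))" for p by simp
  moreover have "frontier \<Omega> - G \<subseteq> (\<Union>p\<in>frontier \<Omega> - G. ball p (s p))" using s(1) by force
  ultimately obtain P where P: "P \<subseteq> frontier \<Omega> - G" "finite P" "frontier \<Omega> - G \<subseteq> (\<Union>p\<in>P. ball p (s p))"
    by (rule compactE_image[where f = "\<lambda>p. ball p (s p)"]) (rule that)
  define V where "V = G \<union> (\<Union>p\<in>P. ball p (s p))"
  have "open V" unfolding V_def using open_G by (intro open_Un open_UN) auto
  have fr: "frontier \<Omega> \<subseteq> V" using P(3) by (auto simp: V_def)
  have "compact (closure \<Omega> - V)"
    using bounded_\<Omega> \<open>open V\<close> by (intro compact_diff) (auto simp: compact_closure)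
  moreover have "closure \<Omega> - V \<subseteq> \<Omega>"
    using fr open_\<Omega> by (auto simp: frontier_def interior_open)
  ultimately obtain k where k: "k > 0" "\<And>x. x \<in> closure \<Omega> - V \<Longrightarrow> x \<noteq> 0 \<Longrightarrow> k \<le> \<rho> x"
    by (rule \<rho>_lower_bound) (rule that)
  define W where "W = (\<Union>p\<in>P. \<Omega> \<inter> ball p (s p) \<inter> ?D)"
  have "negligible W"
    unfolding W_def using P(1,2) s(2) by (intro negligible_Union) auto
  then have "AE x in lebesgue. x \<notin> W"
    by (intro AE_not_in) (simp add: negligible_iff_null_sets)
  then have "AE x in lebesgue. x \<in> \<Omega> \<longrightarrow> x \<noteq> 0 \<longrightarrow> \<rho> x < k \<longrightarrow> x \<in> G \<or> (x \<in> E \<longleftrightarrow> x \<in> neg_side)"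
  proof (rule AE_mp, intro AE_I2 impI)
    fix x assume x: "x \<notin> W" "x \<in> \<Omega>" "x \<noteq> 0" "\<rho> x < k"
    then have "x \<in> V" using k(2)[of x] closure_subset[of \<Omega>] by force
    then show "x \<in> G \<or> (x \<in> E \<longleftrightarrow> x \<in> neg_side)"
      using x(1,2) by (auto simp: V_def W_def)
  qed
  then show ?thesis using k(1) that by blast
qed

lemma continuous_on_divergence_X: "continuous_on (- {0}) (\<lambda>x. \<bar>divergence X x\<bar>)"
  by (intro continuous_intros continuous_on_divergence C1_on_X)

lemma cut_field_test:
  assumes \<theta>: "origin_cutoff C \<epsilon> \<theta>" "0 < \<epsilon>" and k: "k > 0"
  defines "F \<equiv> \<lambda>x. (\<theta> x * smooth_step (k * \<rho> x - 1)) *\<^sub>R X x"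
  shows "F \<in> test_fields \<Omega>"
    and "\<And>x. norm x < \<epsilon> \<or> k * \<rho> x < 1 \<Longrightarrow> divergence F x = 0"
proof -
  define Q where "Q = {x \<in> - ball 0 \<epsilon>. 1 \<le> k * \<rho> x}"
  have "closed Q" unfolding Q_def
    by (rule continuous_on_closed_Collect_le)
      (use \<theta>(2) in \<open>auto intro!: continuous_intros continuous_on_subset[OF continuous_on_\<rho>]\<close>)
  have "F x = 0" if "x \<notin> Q" for x
    using that \<theta> k by (auto simp: F_def Q_def origin_cutoff_def smooth_step_0)
  then have sub: "closure {x. F x \<noteq> 0} \<subseteq> Q"
    using \<open>closed Q\<close> by (intro closure_minimal) auto
  have Q\<Omega>: "Q \<subseteq> \<Omega>"
  proof
    fix x assume "x \<in> Q"
    then have "0 < k * \<rho> x" by (auto simp: Q_def)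
    then show "x \<in> \<Omega>" using k by (simp add: \<Omega>_eq zero_less_mult_iff)
  qed
  have "C1_on (\<lambda>x. smooth_step (k * \<rho> x - 1)) (- {0})"
    by (intro C1_on_smooth_step C1_on_diff C1_on_mult C1_on_const C1_\<rho>)
  then have C1: "C1_on F UNIV" unfolding F_def by (rule C1_on_cut_field[OF \<theta>])
  have "norm (F x) \<le> 1" for x
  proof (cases "x = 0")
    case True
    then have "F x = 0" using \<theta> by (simp add: F_def origin_cutoff_def)
    then show ?thesis by simp
  next
    case False
    have "\<theta> x * smooth_step (k * \<rho> x - 1) \<le> 1"
      using \<theta>(1) by (intro mult_le_one smooth_step_nonneg smooth_step_le_1) (auto simp: origin_cutoff_def)
    then show ?thesis
      using norm_X[OF False] \<theta>(1) by (simp add: F_def origin_cutoff_def smooth_step_nonneg)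
  qed
  then show "F \<in> test_fields \<Omega>"
    using C1 sub Q\<Omega> bounded_subset[OF bounded_\<Omega>, of "closure {x. F x \<noteq> 0}"]
    by (auto simp: test_fields_def compact_eq_bounded_closed)
  show "divergence F x = 0" if "norm x < \<epsilon> \<or> k * \<rho> x < 1" for x
  proof (rule divergence_zero_open[of "- Q" x])
    show "x \<in> - Q" using that by (auto simp: Q_def)
  qed (use \<open>closed Q\<close> \<open>\<And>x. x \<notin> Q \<Longrightarrow> F x = 0\<close> in \<open>auto simp: open_Compl\<close>)
qed

text \<open>The gap \<open>d\<close> is half of a lower bound for what the divergence of \<open>X\<close> contributes on a
  piece \<open>Sn n\<close> of the symmetric difference that stays away from the cone, the origin and the
  frontier. It is fixed before the test field; only afterwards the steepness \<open>k\<close> and the radius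
  \<open>\<epsilon>\<close> are chosen.\<close>

lemma strict_flux_gap:
  assumes comp: "competitor \<delta> \<Omega> neg_side E"
    and diff: "\<not> negligible (\<Omega> \<inter> ((neg_side - E) \<union> (E - neg_side)))"
  obtains d where "d > 0" "\<And>\<psi>. \<psi> \<in> test_fields \<Omega> \<Longrightarrow> ereal (flux neg_side \<psi> + d) \<le> perimeter \<Omega> E"
proof -
  have E: "E \<in> sets lebesgue" using comp by (simp add: competitor_def)
  have N: "neg_side \<in> sets lebesgue" using open_neg_side by simp
  define S where "S = \<Omega> \<inter> ((neg_side - E) \<union> (E - neg_side))"
  have S_meas: "S \<in> sets lebesgue" 
    unfolding S_def using open_\<Omega> by (intro sets.Int sets.Un sets.Diff E N) simp
  define Sn where "Sn n = S \<inter> {x. x \<noteq> 0 \<and> 1 / real (Suc n) \<le> \<rho> x} \<inter> {x. x \<noteq> 0 \<and> 1 / real (Suc n) \<le> norm x}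
     \<inter> {x. x \<noteq> 0 \<and> 1 / real (Suc n) \<le> \<bar>divergence X x\<bar>}" for n
  have Sn_meas: "Sn n \<in> sets lebesgue" for n
    unfolding Sn_def
    using S_meas borel_superlevel_punctured[OF continuous_on_\<rho>] borel_superlevel_punctured[OF continuous_on_divergence_X]
      borel_superlevel_punctured[of norm] by (intro sets.Int) (auto intro: continuous_intros)
  have "S \<subseteq> null_cone \<union> (\<Union>n. Sn n)"
  proof
    fix x assume x: "x \<in> S"
    show "x \<in> null_cone \<union> (\<Union>n. Sn n)"
    proof (cases "q x = 0")
      case False
      then have "x \<noteq> 0" by auto
      have pos: "\<rho> x > 0" "norm x > 0" "\<bar>divergence X x\<bar> > 0"
        using x False \<open>x \<noteq> 0\<close> divergence_X_sign[OF \<open>x \<noteq> 0\<close>] by (auto simp: S_def \<Omega>_eq neq_iff)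
      define m where "m = min (\<rho> x) (min (norm x) \<bar>divergence X x\<bar>)"
      have "m > 0" using pos by (simp add: m_def)
      then obtain n where "inverse (real (Suc n)) < m" using reals_Archimedean by blast
      then have "x \<in> Sn n" using x \<open>x \<noteq> 0\<close> by (auto simp: Sn_def m_def inverse_eq_divide)
      then show ?thesis by blast
    qed (simp add: null_cone_def)
  qed
  then have "\<not> negligible (\<Union>n. Sn n)"
    using diff negligible_cone unfolding S_def[symmetric]
    by (meson negligible_Un negligible_subset)
  then obtain n where n: "\<not> negligible (Sn n)"
    using negligible_countable_Union[of "range Sn"] by auto
  define a where "a = 1 / real (Suc n)"
  have a: "a > 0" by (simp add: a_def)
  have Sn: "x \<in> Sn n \<longleftrightarrow> x \<in> S \<and> x \<noteq> 0 \<and> a \<le> \<rho> x \<and> a \<le> norm x \<and> a \<le> \<bar>divergence X x\<bar>" for x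
    by (auto simp: Sn_def a_def)
  define \<mu> where "\<mu> = measure lebesgue (Sn n)"
  have Sn_fin: "Sn n \<in> lmeasurable"
    using bounded_\<Omega> Sn_meas[of n] by (intro bounded_set_imp_lmeasurable bounded_subset[OF bounded_\<Omega>]) (auto simp: Sn S_def)
  then have "\<mu> > 0" using n
    by (simp add: \<mu>_def negligible_iff_measure0[OF Sn_fin] zero_less_measure_iff)
  obtain k0 where k0: "k0 > 0"
    "AE x in lebesgue. x \<in> \<Omega> \<longrightarrow> x \<noteq> 0 \<longrightarrow> \<rho> x < k0 \<longrightarrow> x \<in> G \<or> (x \<in> E \<longleftrightarrow> x \<in> neg_side)"
    by (rule collar[OF comp]) (rule that)
  obtain C where C: "C > 0" "\<And>\<epsilon>. \<epsilon> > 0 \<Longrightarrow> \<exists>\<theta> :: 'a \<Rightarrow> real. origin_cutoff C \<epsilon> \<theta>"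
    by (rule origin_cutoffs) (rule that)
  define V where "V \<epsilon> = measure lebesgue (cball (0::'a) (2 * \<epsilon>))" for \<epsilon>
  define d where "d = a * \<mu> / 2"
  have "d > 0" using a \<open>\<mu> > 0\<close> by (simp add: d_def)
  moreover have "ereal (flux neg_side \<psi> + d) \<le> perimeter \<Omega> E" if \<psi>: "\<psi> \<in> test_fields \<Omega>" for \<psi>
  proof -
    note \<psi>' = test_fieldsD[OF \<psi>]
    have out: "\<psi> x = 0" if "norm x > max r 1" for x
      using \<psi>'(4) norm_\<Omega>[of x] closure_subset[of "{x. \<psi> x \<noteq> 0}"] that by force
    obtain c where c: "c > 0" "\<And>x. \<bar>divergence \<psi> x\<bar> \<le> c"
      using divergence_bounded[of \<psi> "max r 1"] \<psi>'(1) out by blast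
    obtain m where m: "m > 0" "\<And>x. x \<in> closure {x. \<psi> x \<noteq> 0} \<Longrightarrow> x \<noteq> 0 \<Longrightarrow> m \<le> \<rho> x"
      by (rule \<rho>_lower_bound[OF \<psi>'(3,4)]) (rule that)
    \<comment> \<open>For this steepness \<open>g = 1\<close> on the support of \<open>\<psi>\<close> and on \<open>Sn n\<close>, and \<open>g\<close> is constant where \<open>\<rho> \<ge> k0\<close>.\<close>
    define k where "k = 2 / min m (min a k0)"
    have mk: "min m (min a k0) > 0" using m(1) a k0(1) by simp
    then have "k > 0" by (simp add: k_def)
    have k: "2 \<le> k * t" if "m \<le> t \<or> a \<le> t \<or> k0 \<le> t" for t
    proof -
      have "k * min m (min a k0) \<le> k * t" using that \<open>k > 0\<close> by (intro mult_left_mono) auto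
      moreover have "min m (min a k0) \<noteq> 0" using mk by (metis less_irrefl)
      then have "k * min m (min a k0) = 2" unfolding k_def by (rule nonzero_eq_divide_eq[THEN iffD1, OF _ refl])
      ultimately show ?thesis by simp
    qed
    have "((\<lambda>\<epsilon>. (c + 2 * C / \<epsilon>) * V \<epsilon>) \<longlongrightarrow> 0) (at_right 0)"
      unfolding V_def using dim by (intro small_ball_error) simp
    then have "\<forall>\<^sub>F \<epsilon> in at_right 0. (c + 2 * C / \<epsilon>) * V \<epsilon> < d"
      using \<open>d > 0\<close> by (rule order_tendstoD)
    moreover have "\<forall>\<^sub>F \<epsilon> in at_right 0. \<epsilon> < a / 2"
      using a by (intro eventually_at_right_field[THEN iffD2] exI[of _ "a / 2"]) auto
    ultimately have "\<forall>\<^sub>F \<epsilon> in at_right (0::real). (c + 2 * C / \<epsilon>) * V \<epsilon> < d \<and> \<epsilon> < a / 2 \<and> 0 < \<epsilon>"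
      using eventually_at_right_less[of "0::real"] by eventually_elim simp
    then obtain \<epsilon> where \<epsilon>: "(c + 2 * C / \<epsilon>) * V \<epsilon> < d" "\<epsilon> < a / 2" "0 < \<epsilon>"
      using eventually_happens'[OF trivial_limit_at_right_real] by blast
    obtain \<theta> :: "'a \<Rightarrow> real" where \<theta>: "origin_cutoff C \<epsilon> \<theta>" using C(2)[OF \<epsilon>(3)] by blast
    define g where "g x = smooth_step (k * \<rho> x - 1)" for x
    define F where "F x = (\<theta> x * g x) *\<^sub>R X x" for x
    have g_C1: "C1_on g (- {0})" unfolding g_def [abs_def]
      by (intro C1_on_smooth_step C1_on_diff C1_on_mult C1_on_const C1_\<rho>)
    have g01: "0 \<le> g x" "g x \<le> 1" for x by (simp_all add: g_def smooth_step_nonneg smooth_step_le_1)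
    have g1: "g x = 1" if "m \<le> \<rho> x \<or> a \<le> \<rho> x \<or> k0 \<le> \<rho> x" for x
      using k[OF that] by (simp add: g_def smooth_step_1)
    have g0: "g x = 0" if "norm x > max r 1" for x
      using \<rho>_bounded[of x] that \<open>k > 0\<close> by (simp add: g_def smooth_step_0 mult_nonneg_nonpos order_trans[of _ 0])
    have F: "F \<in> test_fields \<Omega>" "norm x < \<epsilon> \<or> k * \<rho> x < 1 \<Longrightarrow> divergence F x = 0" for x
      using cut_field_test[OF \<theta> \<epsilon>(3) \<open>k > 0\<close>] unfolding F_def [abs_def] g_def by blast+
    have "flux neg_side \<psi> \<le> flux neg_side F + (c + C / \<epsilon>) * V \<epsilon>"
      unfolding V_def F_def [abs_def]
    proof (rule flux_le_cut_field[where r = "max r 1", OF \<theta> \<epsilon>(3) _ g_C1 g01(1) g0 \<psi>'(1,2) out c(2)])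
      show "1 \<le> g x" if "x \<noteq> 0" "\<psi> x \<noteq> 0" for x
        using g1[of x] m(2)[of x] closure_subset[of "{x. \<psi> x \<noteq> 0}"] that by force
    qed (use C(1) in auto)
    moreover have "a * \<mu> - C / \<epsilon> * V \<epsilon> \<le> flux E F - flux neg_side F"
    proof -
      have F': "C1_on F UNIV" "norm x > max r 1 \<Longrightarrow> F x = 0" for x
        using test_fieldsD[OF F(1)] g0 by (auto simp: F_def)
      have intE: "set_integrable lebesgue E (divergence F)"
        and intN: "set_integrable lebesgue neg_side (divergence F)"
        using set_integrable_divergence[of F "max r 1"] F' E N by auto
      have i1: "integrable lebesgue (\<lambda>x. a * indicat_real (Sn n) x)"
        using Sn_meas[of n] fmeasurableD2[OF Sn_fin]
        by (intro integrable_mult_right integrable_real_indicator) (auto simp: less_top)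
      have i2: "integrable lebesgue (\<lambda>x. C / \<epsilon> * indicat_real (cball (0::'a) (2 * \<epsilon>)) x)"
        by (intro integrable_mult_right integrable_indicator_cball)
      have "a * \<mu> - C / \<epsilon> * V \<epsilon> =
          (\<integral>x. a * indicat_real (Sn n) x - C / \<epsilon> * indicat_real (cball (0::'a) (2 * \<epsilon>)) x \<partial>lebesgue)"
        by (simp only: Bochner_Integration.integral_diff[OF i1 i2]) (simp add: \<mu>_def V_def)
      also have "\<dots> \<le> (\<integral>x. indicat_real E x * divergence F x - indicat_real neg_side x * divergence F x \<partial>lebesgue)"
      proof (rule integral_mono_AE)
        show "integrable lebesgue (\<lambda>x. a * indicat_real (Sn n) x - C / \<epsilon> * indicat_real (cball (0::'a) (2 * \<epsilon>)) x)"
          using i1 i2 by (rule Bochner_Integration.integrable_diff)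
        show "integrable lebesgue (\<lambda>x. indicat_real E x * divergence F x - indicat_real neg_side x * divergence F x)"
          using intE intN by (intro Bochner_Integration.integrable_diff) (simp_all add: set_integrable_def)
        have "AE x in lebesgue. x \<notin> null_cone"
          using negligible_cone by (intro AE_not_in) (simp add: negligible_iff_null_sets)
        with k0(2) show "AE x in lebesgue. a * indicat_real (Sn n) x - C / \<epsilon> * indicat_real (cball (0::'a) (2 * \<epsilon>)) x
          \<le> indicat_real E x * divergence F x - indicat_real neg_side x * divergence F x"
        proof eventually_elim
          case (elim x)
          have ind: "0 \<le> C / \<epsilon> * indicat_real (cball (0::'a) (2 * \<epsilon>)) x" using C(1) \<epsilon>(3) by simp
          show ?case
          proof (cases "x \<in> S \<and> \<epsilon> \<le> norm x \<and> 1 \<le> k * \<rho> x")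
            case False
            then have "x \<notin> Sn n" using k[of "\<rho> x"] \<epsilon>(2) a by (auto simp: Sn)
            moreover have "divergence F x = 0 \<or> (x \<in> E \<longleftrightarrow> x \<in> neg_side)"
            proof -
              have "x \<notin> \<Omega> \<Longrightarrow> x \<noteq> 0 \<and> \<rho> x \<le> 0" by (auto simp: \<Omega>_eq)
              then have "x \<notin> \<Omega> \<Longrightarrow> k * \<rho> x < 1"
                using \<open>k > 0\<close> by (meson mult_nonneg_nonpos less_imp_le le_less_trans zero_less_one)
              then show ?thesis using False F(2)[of x] by (auto simp: S_def not_le)
            qed
            ultimately show ?thesis using ind by (auto simp: indicator_def)
          next
            case True
            then have x: "x \<noteq> 0" "x \<in> \<Omega>" "q x \<noteq> 0" "(x \<in> E) \<noteq> (x \<in> neg_side)"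
              using \<epsilon>(3) elim(2) by (auto simp: S_def null_cone_def)
            \<comment> \<open>A point that is added has \<open>q > 0\<close> and one that is removed has \<open>q < 0\<close>, so \<open>e\<close> restores the sign in each term of the divergence.\<close>
            define e where "e = indicat_real E x - indicat_real neg_side x"
            have e: "e = sgn (q x)"
              using x(3,4) by (auto simp: e_def neg_side_def indicator_def sgn_if)
            have th: "0 \<le> \<theta> x" "\<theta> x \<le> 1" "norm x \<ge> 2 * \<epsilon> \<Longrightarrow> \<theta> x = 1"
              "\<bar>frechet_derivative \<theta> (at x) (X x)\<bar> \<le> C / \<epsilon> * indicat_real (cball (0::'a) (2 * \<epsilon>)) x"
              using \<theta> norm_X[OF x(1)] by (auto simp: origin_cutoff_def)
            have "e * divergence X x = \<bar>divergence X x\<bar>"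
              using divergence_X_sign[OF x(1)] x(3) by (auto simp: e sgn_if)
            moreover have "a * indicat_real (Sn n) x \<le> \<theta> x * g x * \<bar>divergence X x\<bar>"
            proof (cases "x \<in> Sn n")
              case True
              then show ?thesis using th(3) g1[of x] \<epsilon>(2) by (simp add: Sn)
            qed (use th(1) g01 in simp)
            ultimately have t1: "a * indicat_real (Sn n) x \<le> e * (\<theta> x * g x * divergence X x)"
              by (metis mult.left_commute)
            have "0 \<le> e * frechet_derivative g (at x) (X x)"
            proof -
              have \<rho>d: "\<rho> differentiable (at x)" using C1_\<rho> x(1) by (simp add: C1_on_def)
              have hd: "((\<lambda>x. k * \<rho> x - 1) has_derivative (\<lambda>v. k * frechet_derivative \<rho> (at x) v - 0)) (at x)"
                using \<rho>d by (intro derivative_intros) (simp add: frechet_derivative_works)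
              have "frechet_derivative (\<lambda>x. k * \<rho> x - 1) (at x) (X x) = k * frechet_derivative \<rho> (at x) (X x)"
                by (simp add: frechet_derivative_at[OF hd, symmetric])
              moreover have "(\<lambda>x. k * \<rho> x - 1) differentiable (at x)"
                using hd unfolding differentiable_def by blast
              ultimately have eq: "frechet_derivative g (at x) (X x) =
                  deriv smooth_step (k * \<rho> x - 1) * (k * frechet_derivative \<rho> (at x) (X x))"
                unfolding g_def [abs_def] by (subst frechet_derivative_compose_real[OF _ DERIV_smooth_step]) auto
              show ?thesis
              proof (cases "\<rho> x < k0")
                case True
                then have "x \<in> G" using elim(1) x by auto
                from \<rho>_sign[OF this] have "0 \<le> e * frechet_derivative \<rho> (at x) (X x)"
                  using x(3) by (auto simp: e sgn_if zero_le_mult_iff)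
                then have "0 \<le> deriv smooth_step (k * \<rho> x - 1) * (k * (e * frechet_derivative \<rho> (at x) (X x)))"
                  using \<open>k > 0\<close>
                  by (intro mult_nonneg_nonneg[OF deriv_smooth_step_nonneg] mult_nonneg_nonneg[of k]) auto
                then show ?thesis unfolding eq by (simp add: algebra_simps)
              next
                case False
                then have "deriv smooth_step (k * \<rho> x - 1) = 0"
                  using k[of "\<rho> x"] by (intro deriv_smooth_step_0) auto
                then show ?thesis unfolding eq by simp
              qed
            qed
            then have t2: "0 \<le> e * (\<theta> x * frechet_derivative g (at x) (X x))"
              using th(1) by (metis mult.left_commute mult_nonneg_nonneg)
            have "\<bar>e * (g x * frechet_derivative \<theta> (at x) (X x))\<bar> \<le> \<bar>frechet_derivative \<theta> (at x) (X x)\<bar>"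
              using g01[of x] x(3) by (simp add: e abs_mult sgn_if mult_left_le_one_le)
            then have t3: "- (C / \<epsilon> * indicat_real (cball (0::'a) (2 * \<epsilon>)) x) \<le> e * (g x * frechet_derivative \<theta> (at x) (X x))"
              using th(4) by linarith
            have "indicat_real E x * divergence F x - indicat_real neg_side x * divergence F x =
                e * (\<theta> x * g x * divergence X x) + e * (\<theta> x * frechet_derivative g (at x) (X x))
                + e * (g x * frechet_derivative \<theta> (at x) (X x))"
              unfolding F_def [abs_def] divergence_cut_field[OF \<theta> g_C1 x(1)] e_def
              by (simp add: algebra_simps)
            then show ?thesis using t1 t2 t3 by linarith
          qed
        qed
      qed
      also have "\<dots> = flux E F - flux neg_side F"
        using intE intN by (subst Bochner_Integration.integral_diff)
          (simp_all add: set_integrable_def set_lebesgue_integral_def)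
      finally show ?thesis .
    qed
    moreover have "(c + 2 * C / \<epsilon>) * V \<epsilon> = (c + C / \<epsilon>) * V \<epsilon> + C / \<epsilon> * V \<epsilon>"
      by (simp add: algebra_simps)
    moreover have "a * \<mu> = 2 * d" by (simp add: d_def)
    ultimately have "flux neg_side \<psi> + d \<le> flux E F"
      using \<epsilon>(1) by linarith
    also have "ereal (flux E F) \<le> perimeter \<Omega> E"
      unfolding perimeter_def using F(1) by (intro SUP_upper) auto
    finally show ?thesis by simp
  qed
  ultimately show ?thesis using that by blast
qed

lemma perimeter_less:
  assumes "competitor \<delta> \<Omega> neg_side E"
    and "\<not> negligible (\<Omega> \<inter> ((neg_side - E) \<union> (E - neg_side)))"
  shows "perimeter \<Omega> neg_side < perimeter \<Omega> E"
proof -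
  obtain d where d: "d > 0"
    "\<And>\<psi>. \<psi> \<in> test_fields \<Omega> \<Longrightarrow> ereal (flux neg_side \<psi> + d) \<le> perimeter \<Omega> E"
    by (rule strict_flux_gap[OF assms]) (rule that)
  show ?thesis
  proof (cases "perimeter \<Omega> E")
    case (real p)
    have "perimeter \<Omega> neg_side \<le> ereal (p - d)"
      unfolding perimeter_def[of \<Omega> neg_side]
    proof (rule SUP_least)
      fix \<psi> assume "\<psi> \<in> test_fields \<Omega>"
      from d(2)[OF this] show "ereal (flux neg_side \<psi>) \<le> ereal (p - d)"
        unfolding real by simp
    qed
    also have "\<dots> < perimeter \<Omega> E" using d(1) by (simp add: real)
    finally show ?thesis .
  next
    case PInf
    then show ?thesis using perimeter_neg_side_finite[OF bounded_\<Omega>] by simp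
  next
    case MInf
    have "(\<lambda>x. 0) \<in> test_fields \<Omega>" by (simp add: test_fields_def C1_on_const)
    from d(2)[OF this] show ?thesis unfolding MInf by simp
  qed
qed

end

lemma perimeter_cong_negligible:
  assumes "negligible (\<Omega> \<inter> ((E - E') \<union> (E' - E)))" "E \<in> sets lebesgue" "E' \<in> sets lebesgue"
  shows "perimeter \<Omega> E = perimeter \<Omega> E'"
  unfolding perimeter_def
proof (rule SUP_cong)
  fix \<psi> assume \<psi>: "\<psi> \<in> test_fields \<Omega>"
  note \<psi>' = test_fieldsD[OF this]
  have m: "divergence \<psi> \<in> borel_measurable lebesgue"
    using \<psi>'(1) by (intro measurable_completion) (simp add: borel_measurable_continuous_onI continuous_on_divergence)
  have "flux E \<psi> = flux E' \<psi>"
    unfolding set_lebesgue_integral_def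
  proof (rule integral_cong_AE)
    have "AE x in lebesgue. x \<notin> \<Omega> \<inter> ((E - E') \<union> (E' - E))"
      using assms(1) by (intro AE_not_in) (simp add: negligible_iff_null_sets)
    then show "AE x in lebesgue. indicat_real E x *\<^sub>R divergence \<psi> x = indicat_real E' x *\<^sub>R divergence \<psi> x"
    proof eventually_elim
      case (elim x)
      show ?case
      proof (cases "x \<in> \<Omega>")
        case False
        have "divergence \<psi> x = 0"
          using False \<psi>'(4) closure_subset[of "{x. \<psi> x \<noteq> 0}"]
          by (intro divergence_zero_open[of "- closure {x. \<psi> x \<noteq> 0}"]) (auto simp: open_Compl)
        then show ?thesis by simp
      qed (use elim in \<open>auto simp: indicator_def\<close>)
    qed
  qed (use m assms in auto)
  then show "ereal (flux E \<psi>) = ereal (flux E' \<psi>)" by simp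
qed simp

lemma boundary_mod_null_cong:
  assumes "negligible (\<Omega> \<inter> ((E - E') \<union> (E' - E)))" "open \<Omega>"
  shows "boundary_mod_null E \<inter> \<Omega> = boundary_mod_null E' \<inter> \<Omega>"
proof -
  have "x \<in> boundary_mod_null E'"
    if x: "x \<in> boundary_mod_null E" "x \<in> \<Omega>" and neg: "negligible (\<Omega> \<inter> ((E - E') \<union> (E' - E)))" for x E E'
    unfolding boundary_mod_null_def
  proof (intro CollectI allI impI)
    fix s :: real assume "s > 0"
    obtain t where t: "t > 0" "ball x t \<subseteq> \<Omega>" using x(2) assms(2) openE by blast
    define u where "u = min s t"
    have u: "u > 0" "ball x u \<subseteq> ball x s" "ball x u \<subseteq> \<Omega>"
      using \<open>s > 0\<close> t by (auto simp: u_def)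
    have "ball x u \<inter> E \<subseteq> (ball x s \<inter> E') \<union> (\<Omega> \<inter> ((E - E') \<union> (E' - E)))"
      "ball x u - E \<subseteq> (ball x s - E') \<union> (\<Omega> \<inter> ((E - E') \<union> (E' - E)))"
      using u(2,3) by blast+
    moreover have "\<not> negligible (ball x u \<inter> E)" "\<not> negligible (ball x u - E)"
      using x(1) u(1) by (auto simp: boundary_mod_null_def)
    ultimately show "\<not> negligible (ball x s \<inter> E') \<and> \<not> negligible (ball x s - E')"
      using neg negligible_Un negligible_subset by meson
  qed
  from this[OF _ _ assms(1)] this[of _ E' E] assms(1) show ?thesis
    by (auto simp: Un_commute)
qed

section \<open>The profile of the deformed ball\<close>

lemma
  fixes g :: "real \<Rightarrow> real"
  assumes "C1_on g V"
  shows C1_on_DERIV: "t \<in> V \<Longrightarrow> (g has_real_derivative deriv g t) (at t)"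
    and C1_on_continuous_deriv: "continuous_on V (deriv g)"
proof -
  have d: "(g has_real_derivative deriv g t) (at t)" if "t \<in> V" for t
    using assms that by (simp add: C1_on_def DERIV_deriv_iff_real_differentiable)
  then show "t \<in> V \<Longrightarrow> (g has_real_derivative deriv g t) (at t)" .
  have "frechet_derivative g (at t) 1 = deriv g t" if "t \<in> V" for t
    using frechet_derivative_at[OF d[OF that, unfolded has_field_derivative_def]] by (metis mult.right_neutral)
  moreover have "continuous_on V (\<lambda>t. frechet_derivative g (at t) 1)" using assms by (simp add: C1_on_def)
  ultimately show "continuous_on V (deriv g)" by (simp cong: continuous_on_cong)
qed

lemma C1_on_compose_C1:
  fixes g :: "real \<Rightarrow> real"
  assumes "C1_on f U" "C1_on g V" "\<And>x. x \<in> U \<Longrightarrow> f x \<in> V"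
  shows "C1_on (\<lambda>x. g (f x)) U"
  using C1_on_DERIV[OF assms(2)] C1_on_continuous_deriv[OF assms(2)] assms(3)
  by (intro C1_on_compose_real[OF assms(1), where g' = "deriv g"]
      continuous_on_compose2[OF _ C1_on_imp_continuous_on[OF assms(1)]]) auto

text \<open>For a unit vector with \<open>q\<^sup>2 = t\<close> this is the squared distance to the trace of the cone on
  the unit sphere (\<open>unit_infdist_cone\<close>). For \<open>t > 1\<close> the square root of a negative
  number is negative, and \<open>cone_gap\<close> is still continuous and monotone.\<close>

definition cone_gap :: "real \<Rightarrow> real" where
  "cone_gap t = 2 - sqrt 2 * sqrt (1 + sqrt (1 - t))"

definition profile :: "(real \<Rightarrow> real) \<Rightarrow> real \<Rightarrow> real" where
  "profile \<eta> t = cone_gap t * \<eta> (sqrt (cone_gap t))"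

lemma cone_gap_mono: "s \<le> t \<Longrightarrow> cone_gap s \<le> cone_gap t"
  by (simp add: cone_gap_def)

lemma cone_gap_0 [simp]: "cone_gap 0 = 0"
  by (simp add: cone_gap_def)

lemma cone_gap_nonneg: "0 \<le> t \<Longrightarrow> 0 \<le> cone_gap t"
  using cone_gap_mono[of 0 t] by simp

lemma cone_gap_1: "1 \<le> t \<Longrightarrow> 1 / 2 < cone_gap t"
proof -
  have "sqrt 2 < 3 / 2" by (rule real_less_lsqrt) (auto simp: power2_eq_square)
  then have "1 / 2 < cone_gap 1" by (simp add: cone_gap_def)
  then show "1 \<le> t \<Longrightarrow> 1 / 2 < cone_gap t" using cone_gap_mono[of 1 t] by simp
qed

lemma continuous_on_cone_gap: "continuous_on U cone_gap"
  unfolding cone_gap_def [abs_def] by (intro continuous_intros)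

definition cone_gap' :: "real \<Rightarrow> real" where
  "cone_gap' t = sqrt 2 / (4 * sqrt (1 + sqrt (1 - t)) * sqrt (1 - t))"

lemma DERIV_cone_gap:
  assumes "t < 1"
  shows "(cone_gap has_real_derivative cone_gap' t) (at t)"
proof -
  have 1: "((\<lambda>t. sqrt (1 - t)) has_real_derivative inverse (sqrt (1 - t)) / 2 * (0 - 1)) (at t)"
    using assms by (intro DERIV_chain2[OF DERIV_real_sqrt DERIV_diff[OF DERIV_const DERIV_ident]]) simp
  have "1 + sqrt (1 - t) > 0" using assms by (intro add_pos_pos) auto
  note 2 = DERIV_chain2[OF DERIV_real_sqrt[OF this] DERIV_add[OF DERIV_const 1]]
  have "(cone_gap has_real_derivative 0 - sqrt 2 * (inverse (sqrt (1 + sqrt (1 - t))) / 2 *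
      (0 + inverse (sqrt (1 - t)) / 2 * (0 - 1)))) (at t)"
    unfolding cone_gap_def [abs_def]
    by (rule DERIV_diff[OF DERIV_const DERIV_cmult[OF 2]])
  then show ?thesis by (rule DERIV_cong) (simp add: cone_gap'_def inverse_eq_divide)
qed

text \<open>The slope \<open>1 / 4\<close> at the cone is what the constant \<open>K \<ge> 4\<close> is measured against.\<close>

lemma cone_gap'_ge: 
  assumes "0 \<le> t" "t < 1"
  shows "1 / 4 \<le> cone_gap' t"
proof -
  have s: "0 < sqrt (1 - t)" "sqrt (1 - t) \<le> 1" using assms by auto
  then have "sqrt (1 + sqrt (1 - t)) \<le> sqrt 2" by simp
  then have "sqrt (1 + sqrt (1 - t)) * sqrt (1 - t) \<le> sqrt 2 * 1"
    using s by (intro mult_mono) auto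
  moreover have "0 < sqrt (1 + sqrt (1 - t)) * sqrt (1 - t)"
    using s by (intro mult_pos_pos real_sqrt_gt_zero add_pos_pos) auto
  ultimately show ?thesis by (simp add: cone_gap'_def field_simps)
qed

lemma C1_on_cone_gap: "C1_on cone_gap {..<1}"
proof -
  have "1 + sqrt (1 - t) \<noteq> 0" if "t < 1" for t
    using add_pos_nonneg[of 1 "sqrt (1 - t)"] that by simp
  then have "continuous_on {..<1} cone_gap'"
    unfolding cone_gap'_def [abs_def] by (intro continuous_intros) auto
  then show ?thesis
    using C1_on_compose_real[of "\<lambda>t. t" "{..<1}" cone_gap cone_gap'] DERIV_cone_gap
      C1_on_bounded_linear[OF bounded_linear_ident] by auto
qed

lemma abs_sqrt: "\<bar>sqrt x\<bar> = sqrt \<bar>x\<bar>"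
  by (cases "0 \<le> x") (auto simp: real_sqrt_minus)

lemma cutoff_C1:
  assumes "cutoff \<upsilon> \<eta>"
  shows "C1_on \<eta> UNIV"
proof -
  have *: "(deriv ^^ k) \<eta> differentiable_on UNIV" for k
    using assms by (simp add: cutoff_def)
  have "(\<eta> has_real_derivative deriv \<eta> t) (at t)" for t
    using *[of 0] by (simp add: differentiable_on_def DERIV_deriv_iff_real_differentiable)
  moreover have "continuous_on UNIV (deriv \<eta>)"
    using *[of 1] by (simp add: differentiable_imp_continuous_on)
  ultimately show ?thesis
    using C1_on_compose_real[of "\<lambda>t. t" UNIV \<eta> "deriv \<eta>"]
      C1_on_bounded_linear[OF bounded_linear_ident] by auto
qed

lemma profile_eq_cone_gap:
  assumes "0 < \<upsilon>" "cutoff \<upsilon> \<eta>" "\<bar>cone_gap t\<bar> < \<upsilon>\<^sup>2"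
  shows "profile \<eta> t = cone_gap t"
proof -
  have "sqrt \<bar>cone_gap t\<bar> < sqrt (\<upsilon>\<^sup>2)" using assms(3) by (rule real_sqrt_less_mono)
  then have "\<bar>sqrt (cone_gap t)\<bar> \<le> \<upsilon>" using assms(1) by (simp add: abs_sqrt)
  then show ?thesis using assms(2) by (simp add: profile_def cutoff_def)
qed

text \<open>The square root is not differentiable at 0, but there the cut-off is constant; and it vanishes before
  \<open>cone_gap\<close> loses smoothness at 1, because \<open>4 \<upsilon>\<^sup>2 < 1 / 2\<close>.\<close>

lemma C1_on_profile:
  assumes \<upsilon>: "0 < \<upsilon>" "\<upsilon> < 1 / 4" and \<eta>: "cutoff \<upsilon> \<eta>"
  shows "C1_on (profile \<eta>) {0..}"
proof (rule C1_on_local)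
  fix t :: real assume t: "t \<in> {0..}"
  have "4 * \<upsilon>\<^sup>2 < 4 * (1 / 4)\<^sup>2" using \<upsilon> by (intro mult_strict_left_mono power_strict_mono) auto
  then have small: "4 * \<upsilon>\<^sup>2 < 1 / 2" by (simp add: power2_eq_square)
  have lt1: "t < 1" if "cone_gap t \<le> 4 * \<upsilon>\<^sup>2" for t
    using cone_gap_1[of t] small that by linarith
  consider "cone_gap t < \<upsilon>\<^sup>2" | "0 < cone_gap t" "t < 1" | "4 * \<upsilon>\<^sup>2 < cone_gap t"
    using lt1[of t] zero_less_power[OF \<upsilon>(1), of 2] by linarith
  then show "\<exists>V. open V \<and> t \<in> V \<and> C1_on (profile \<eta>) V"
  proof cases
    case 1
    let ?V = "{t. \<bar>cone_gap t\<bar> < \<upsilon>\<^sup>2}"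
    have V: "open ?V" by (intro open_Collect_less continuous_intros continuous_on_cone_gap)
    moreover have "t \<in> ?V" using 1 t cone_gap_nonneg[of t] by auto
    moreover have "C1_on (profile \<eta>) ?V"
    proof (rule C1_on_cong_open[OF _ V])
      show "C1_on cone_gap ?V"
        by (rule C1_on_subset[OF C1_on_cone_gap]) (use zero_less_power[OF \<upsilon>(1), of 2] in \<open>auto intro!: lt1\<close>)
      show "profile \<eta> t = cone_gap t" if "t \<in> ?V" for t
        using that profile_eq_cone_gap[OF \<upsilon>(1) \<eta>] by simp
    qed
    ultimately show ?thesis by blast
  next
    case 2
    let ?V = "{t. 0 < cone_gap t} \<inter> {..<1}"
    have V: "open ?V" by (intro open_Int open_Collect_less continuous_intros continuous_on_cone_gap)
    have g: "C1_on cone_gap ?V" by (rule C1_on_subset[OF C1_on_cone_gap]) auto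
    have "C1_on (\<lambda>t. sqrt (cone_gap t)) ?V"
    proof (rule C1_on_compose_real[OF g])
      show "(sqrt has_real_derivative inverse (sqrt (cone_gap t)) / 2) (at (cone_gap t))" if "t \<in> ?V" for t
        using that by (intro DERIV_real_sqrt) simp
      show "continuous_on ?V (\<lambda>t. inverse (sqrt (cone_gap t)) / 2)"
        by (intro continuous_intros continuous_on_cone_gap) auto
    qed
    then have "C1_on (profile \<eta>) ?V"
      unfolding profile_def [abs_def]
      by (intro C1_on_mult g C1_on_compose_C1[OF _ cutoff_C1[OF \<eta>]]) auto
    then show ?thesis using V 2 by blast
  next
    case 3
    let ?V = "{t. 4 * \<upsilon>\<^sup>2 < cone_gap t}"
    have V: "open ?V" by (intro open_Collect_less continuous_intros continuous_on_cone_gap)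
    moreover have "C1_on (profile \<eta>) ?V"
    proof (rule C1_on_cong_open[OF C1_on_const[of 0] V])
      fix t assume "t \<in> ?V"
      then have "sqrt (4 * \<upsilon>\<^sup>2) \<le> sqrt (cone_gap t)" by (intro real_sqrt_le_mono) simp
      then have "2 * \<upsilon> \<le> \<bar>sqrt (cone_gap t)\<bar>" using \<upsilon>(1) by (simp add: real_sqrt_mult)
      then show "profile \<eta> t = 0" using \<eta> by (simp add: profile_def cutoff_def)
    qed
    ultimately show ?thesis using 3 by blast
  qed
qed

lemma profile_near_0:
  assumes \<upsilon>: "0 < \<upsilon>" "\<upsilon> < 1 / 4" and \<eta>: "cutoff \<upsilon> \<eta>"
  obtains s where "0 < s" "s \<le> 1 / 4" "\<And>t. 0 \<le> t \<Longrightarrow> t < s \<Longrightarrow> 1 / 4 \<le> deriv (profile \<eta>) t"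
proof -
  let ?V = "{t. \<bar>cone_gap t\<bar> < \<upsilon>\<^sup>2} \<inter> {..<1/4}"
  have V: "open ?V" by (intro open_Int open_Collect_less continuous_intros continuous_on_cone_gap)
  have "0 \<in> ?V" using \<upsilon>(1) by simp
  then obtain s where s: "s > 0" "ball 0 s \<subseteq> ?V" using V openE by blast
  have "1 / 4 \<le> deriv (profile \<eta>) t" if t: "0 \<le> t" "t < s" for t
  proof -
    have "t \<in> ball 0 s" using t by simp
    then have tV: "t \<in> ?V" using s(2) by blast
    have "(profile \<eta> has_real_derivative cone_gap' t) (at t)"
      by (rule has_field_derivative_transform_within_open[OF DERIV_cone_gap V tV]) (use tV in \<open>auto simp: profile_eq_cone_gap[OF \<upsilon>(1) \<eta>]\<close>)
    then have "deriv (profile \<eta>) t = cone_gap' t" by (rule DERIV_imp_deriv)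
    then show ?thesis using cone_gap'_ge[of t] t(1) tV by simp
  qed
  then show ?thesis using s(1) that[of "min s (1 / 4)"] by simp
qed

lemma profile_nonneg: "cutoff \<upsilon> \<eta> \<Longrightarrow> 0 \<le> t \<Longrightarrow> 0 \<le> profile \<eta> t"
  by (simp add: profile_def cutoff_def cone_gap_nonneg)

lemma profile_0 [simp]: "profile \<eta> 0 = 0"
  by (simp add: profile_def)

context simons_involution
begin

text \<open>Constant on rays, 0 exactly on the cone, and smooth away from the origin, unlike the distance to the trace.\<close>

definition latitude :: "'a \<Rightarrow> real" where
  "latitude x = (q x * (1 / (x \<bullet> x)))\<^sup>2"

definition rho :: "real \<Rightarrow> (real \<Rightarrow> real) \<Rightarrow> 'a \<Rightarrow> real" where
  "rho K \<Phi> x = 1 + K * \<Phi> (latitude x) - sqrt (x \<bullet> x)"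

lemma latitude_nonneg: "0 \<le> latitude x" by (simp add: latitude_def)

lemma latitude_scaleR: "c \<noteq> 0 \<Longrightarrow> latitude (c *\<^sub>R x) = latitude x"
  by (simp add: latitude_def q_scaleR power2_eq_square)

lemma latitude_le_1: "latitude x \<le> 1"
proof (cases "x = 0")
  case False
  then have "\<bar>q x * (1 / (x \<bullet> x))\<bar> \<le> 1" using abs_q_le[of x] by (simp add: abs_mult field_simps)
  then show ?thesis unfolding latitude_def using abs_square_le_1 by blast
qed (simp add: latitude_def)

lemma latitude_unit: "norm x = 1 \<Longrightarrow> latitude x = (q x)\<^sup>2"
  by (simp add: latitude_def dot_square_norm)

lemma C1_on_latitude: "C1_on latitude (- {0})"
proof -
  have "C1_on (\<lambda>x::'a. 1 / (x \<bullet> x)) (- {0})"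
  proof (rule C1_on_compose_real[OF C1_on_square_norm])
    show "((\<lambda>t. 1 / t) has_real_derivative - (1 / (x \<bullet> x)\<^sup>2)) (at (x \<bullet> x))" if "x \<in> - {0}" for x :: 'a
      using that by (auto intro!: derivative_eq_intros simp: power2_eq_square)
    show "continuous_on (- {0}) (\<lambda>x::'a. - (1 / (x \<bullet> x)\<^sup>2))"
      by (intro continuous_intros) auto
  qed
  then show ?thesis
    unfolding latitude_def [abs_def] power2_eq_square by (intro C1_on_mult C1_on_q)
qed

lemma C1_on_rho:
  assumes "C1_on \<Phi> {0..}"
  shows "C1_on (rho K \<Phi>) (- {0})"
proof -
  have "C1_on (\<lambda>x::'a. sqrt (x \<bullet> x)) (- {0})"
  proof (rule C1_on_compose_real[OF C1_on_square_norm])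
    show "(sqrt has_real_derivative inverse (sqrt (x \<bullet> x)) / 2) (at (x \<bullet> x))" if "x \<in> - {0}" for x :: 'a
      using that by (intro DERIV_real_sqrt) simp
    show "continuous_on (- {0}) (\<lambda>x::'a. inverse (sqrt (x \<bullet> x)) / 2)"
      by (intro continuous_intros) auto
  qed
  moreover have "C1_on (\<lambda>x. \<Phi> (latitude x)) (- {0})"
    by (rule C1_on_compose_C1[OF C1_on_latitude assms]) (simp add: latitude_nonneg)
  ultimately show ?thesis
    unfolding rho_def [abs_def] by (intro C1_on_diff C1_on_add C1_on_mult C1_on_const)
qed

text \<open>The first term comes from the bending of the boundary, the second from the radial direction; both carry the
  factor \<open>q\<close>.\<close>

lemma rho_derivative_along_X:
  assumes x: "x \<noteq> 0" and \<Phi>: "(\<Phi> has_real_derivative d) (at (latitude x))"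
  shows "frechet_derivative (rho K \<Phi>) (at x) (X x) =
    q x / sqrt (B x) * (4 * K * d * (1 - latitude x) - 2 * norm x)"
proof -
  define R where "R = x \<bullet> x"
  have R: "R > 0" using x by (simp add: R_def)
  have inv: "((\<lambda>x::'a. 1 / (x \<bullet> x)) has_derivative (\<lambda>v. - (1 / R\<^sup>2) * (2 * (x \<bullet> v)))) (at x)"
  proof -
    have "((\<lambda>t. 1 / t) has_real_derivative - (1 / R\<^sup>2)) (at (x \<bullet> x))"
      using R by (auto intro!: derivative_eq_intros simp: power2_eq_square R_def)
    from has_derivative_compose[OF has_derivative_square_norm this[unfolded has_field_derivative_def]]
    show ?thesis .
  qed
  let ?s = "\<lambda>x. q x * (1 / (x \<bullet> x))"
  let ?s' = "\<lambda>v. 2 * (J x \<bullet> v) / R - q x * (2 * (x \<bullet> v)) / R\<^sup>2"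
  have s: "(?s has_derivative ?s') (at x)"
    using has_derivative_mult[OF has_derivative_q inv]
    by (rule has_derivative_eq_rhs) (simp add: R_def[symmetric] fun_eq_iff)
  have lat: "(latitude has_derivative (\<lambda>v. 2 * (q x / R) * ?s' v)) (at x)"
    using has_derivative_mult[OF s s] unfolding latitude_def [abs_def] power2_eq_square
    by (rule has_derivative_eq_rhs) (simp add: R_def[symmetric] fun_eq_iff power2_eq_square algebra_simps)
  have sq: "((\<lambda>x. sqrt (x \<bullet> x)) has_derivative (\<lambda>v. inverse (sqrt R) / 2 * (2 * (x \<bullet> v)))) (at x)"
    unfolding R_def
    using has_derivative_compose[OF has_derivative_square_norm[of x]
      DERIV_real_sqrt[unfolded has_field_derivative_def, of "x \<bullet> x"]] x by simp
  have ph: "((\<lambda>x. \<Phi> (latitude x)) has_derivative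
      (\<lambda>v. d * (2 * (q x / R) * (2 * (J x \<bullet> v) / R - q x * (2 * (x \<bullet> v)) / R\<^sup>2)))) (at x)"
    using has_derivative_compose[OF lat \<Phi>[unfolded has_field_derivative_def]] .
  have "(rho K \<Phi> has_derivative (\<lambda>v. 0 + K * (d * (2 * (q x / R) * (2 * (J x \<bullet> v) / R - q x * (2 * (x \<bullet> v)) / R\<^sup>2)))
      - inverse (sqrt R) / 2 * (2 * (x \<bullet> v)))) (at x)"
    unfolding rho_def [abs_def] by (intro has_derivative_diff has_derivative_add has_derivative_const
      has_derivative_mult_right sq ph)
  from frechet_derivative_at[OF this, symmetric]
  have "frechet_derivative (rho K \<Phi>) (at x) (X x) =
     K * (d * (2 * (q x / R) * (2 * (J x \<bullet> X x) / R - q x * (2 * (x \<bullet> X x)) / R\<^sup>2)))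
      - inverse (sqrt R) / 2 * (2 * (x \<bullet> X x))" by simp
  also have "2 * (J x \<bullet> X x) / R - q x * (2 * (x \<bullet> X x)) / R\<^sup>2 = 2 * R * (1 - latitude x) / sqrt (B x)"
    unfolding inner_X latitude_def R_def[symmetric] using R B_pos[OF x]
    by (simp add: field_simps power2_eq_square)
  also have "inverse (sqrt R) / 2 * (2 * (x \<bullet> X x)) = 2 * q x * norm x / sqrt (B x)"
  proof -
    have "sqrt R = norm x" by (simp add: R_def norm_eq_sqrt_inner)
    moreover have "R = norm x * norm x" by (simp add: R_def dot_square_norm power2_eq_square)
    ultimately show ?thesis unfolding inner_X R_def[symmetric] using x by (simp add: field_simps)
  qed
  also have "2 * (q x / R) * (2 * R * (1 - latitude x) / sqrt (B x)) = 4 * q x * (1 - latitude x) / sqrt (B x)"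
    using R by simp
  finally show ?thesis by (simp add: algebra_simps diff_divide_distrib)
qed

text \<open>Split \<open>w = u a + v b\<close> along the eigenspaces of \<open>J\<close> with unit vectors
  \<open>a\<close> and \<open>b\<close>. The points of the trace have components of norm
  \<open>1 / sqrt 2\<close>, so by Cauchy-Schwarz the nearest one is \<open>(a + b) / sqrt 2\<close>.\<close>

lemma unit_infdist_cone:
  assumes w: "norm w = 1"
  shows "infdist w (null_cone \<inter> sphere 0 1) = sqrt (cone_gap ((q w)\<^sup>2))"
proof -
  define u v where "u = norm ((1/2) *\<^sub>R (w + J w))" and "v = norm ((1/2) *\<^sub>R (w - J w))"
  have ww: "w \<bullet> w = 1" using w by (simp add: dot_square_norm)
  have sq: "(norm ((1/2) *\<^sub>R (z + J z)))\<^sup>2 = (z \<bullet> z + q z) / 2"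
    "(norm ((1/2) *\<^sub>R (z - J z)))\<^sup>2 = (z \<bullet> z - q z) / 2" for z
    by (simp_all add: power2_norm_eq_inner inner_add_left inner_add_right inner_diff_left inner_diff_right
        q_def J_sym field_simps)
  have u2: "u\<^sup>2 = (1 + q w) / 2" and v2: "v\<^sup>2 = (1 - q w) / 2"
    by (simp_all only: u_def v_def sq ww)
  have uv0: "0 \<le> u" "0 \<le> v" by (simp_all add: u_def v_def)
  have "(2 * u * v)\<^sup>2 = 4 * u\<^sup>2 * v\<^sup>2" by (simp add: power_mult_distrib)
  also have "\<dots> = 1 - (q w)\<^sup>2"
    unfolding u2 v2 by (simp add: field_simps power2_eq_square)
  finally have "(2 * u * v)\<^sup>2 = 1 - (q w)\<^sup>2" .
  then have "sqrt (1 - (q w)\<^sup>2) = 2 * u * v" using uv0 by (metis real_sqrt_unique mult_nonneg_nonneg zero_le_numeral)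
  moreover have "1 + 2 * u * v = (u + v)\<^sup>2" using u2 v2 by (simp add: power2_sum)
  ultimately have "sqrt (1 + sqrt (1 - (q w)\<^sup>2)) = u + v" using uv0 by simp
  then have gap: "cone_gap ((q w)\<^sup>2) = 2 - sqrt 2 * (u + v)" by (simp add: cone_gap_def)
  obtain a where a: "norm a = 1" "J a = a" "(1/2) *\<^sub>R (w + J w) = u *\<^sub>R a"
  proof (cases "u = 0")
    case True
    then show ?thesis using plus_vector that by (auto simp: u_def)
  next
    case False
    show ?thesis
    proof (rule that[of "(1 / u) *\<^sub>R ((1/2) *\<^sub>R (w + J w))"])
      show "norm ((1 / u) *\<^sub>R ((1/2) *\<^sub>R (w + J w))) = 1"
      proof -
        have "norm ((1 / u) *\<^sub>R ((1/2) *\<^sub>R (w + J w))) = \<bar>1 / u\<bar> * u"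
          unfolding u_def by (rule norm_scaleR)
        also have "\<dots> = 1" using False uv0(1) by simp
        finally show ?thesis .
      qed
    qed (use False in \<open>simp_all add: J_scaleR J_add add.commute\<close>)
  qed
  obtain b where b: "norm b = 1" "J b = - b" "(1/2) *\<^sub>R (w - J w) = v *\<^sub>R b"
  proof (cases "v = 0")
    case True
    then show ?thesis using minus_vector that by (auto simp: v_def)
  next
    case False
    show ?thesis
    proof (rule that[of "(1 / v) *\<^sub>R ((1/2) *\<^sub>R (w - J w))"])
      show "norm ((1 / v) *\<^sub>R ((1/2) *\<^sub>R (w - J w))) = 1"
      proof -
        have "norm ((1 / v) *\<^sub>R ((1/2) *\<^sub>R (w - J w))) = \<bar>1 / v\<bar> * v"
          unfolding v_def by (rule norm_scaleR)
        also have "\<dots> = 1" using False uv0(2) by simp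
        finally show ?thesis .
      qed
    qed (use False in \<open>simp_all add: J_scaleR J_diff scaleR_diff_right\<close>)
  qed
  have ab: "a \<bullet> b = 0" using J_sym[of a b] a(2) b(2) by simp
  have aa: "a \<bullet> a = 1" "b \<bullet> b = 1" using a(1) b(1) by (simp_all add: dot_square_norm)
  have w_eq: "w = u *\<^sub>R a + v *\<^sub>R b"
    unfolding a(3)[symmetric] b(3)[symmetric] by (simp add: algebra_simps flip: scaleR_add_left)
  define z where "z = (1 / sqrt 2) *\<^sub>R (a + b)"
  have zz: "z \<bullet> z = 1" by (simp add: z_def inner_add_left inner_add_right ab aa inner_commute[of b a])
  have "q z = 0"
    by (simp add: q_def z_def J_scaleR J_add a(2) b(2) inner_add_left inner_add_right inner_diff_right ab aa inner_commute[of b a])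
  then have z_in: "z \<in> null_cone \<inter> sphere 0 1" using zz by (simp add: null_cone_def norm_eq_sqrt_inner)
  have wz: "w \<bullet> z = (u + v) / sqrt 2"
    unfolding w_eq z_def by (simp add: inner_add_left inner_add_right ab aa inner_commute[of b a] add_divide_distrib)
  have dist: "dist w y = sqrt (2 - 2 * (w \<bullet> y))" if "y \<in> null_cone \<inter> sphere 0 1" for y
    using that ww by (simp add: dist_norm norm_eq_sqrt_inner inner_diff_left inner_diff_right inner_commute[of y w])
  have two: "2 / sqrt 2 = sqrt (2 :: real)" by (simp add: real_div_sqrt)
  have dz: "dist w z = sqrt (cone_gap ((q w)\<^sup>2))"
    unfolding dist[OF z_in] wz gap using two by (simp add: field_simps)
  have lower: "sqrt (cone_gap ((q w)\<^sup>2)) \<le> dist w y" if y: "y \<in> null_cone \<inter> sphere 0 1" for y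
  proof -
    have yy: "y \<bullet> y = 1" "q y = 0" using y by (auto simp: null_cone_def dot_square_norm)
    have n: "norm ((1/2) *\<^sub>R (y + J y)) = 1 / sqrt 2" "norm ((1/2) *\<^sub>R (y - J y)) = 1 / sqrt 2"
      using sq[of y] yy by (metis add.right_neutral diff_zero norm_ge_zero real_sqrt_divide real_sqrt_one real_sqrt_unique)+
    have "w \<bullet> y = ((1/2) *\<^sub>R (w + J w)) \<bullet> ((1/2) *\<^sub>R (y + J y)) + ((1/2) *\<^sub>R (w - J w)) \<bullet> ((1/2) *\<^sub>R (y - J y))"
      by (simp add: inner_add_left inner_add_right inner_diff_left inner_diff_right field_simps)
    also have "\<dots> \<le> u * (1 / sqrt 2) + v * (1 / sqrt 2)"
      unfolding u_def v_def by (subst (1 2) n[symmetric]) (intro add_mono norm_cauchy_schwarz)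
    finally have "2 * (w \<bullet> y) \<le> 2 * (u * (1 / sqrt 2) + v * (1 / sqrt 2))" by simp
    also have "\<dots> = (2 / sqrt 2) * (u + v)"
      by (simp only: distrib_left times_divide_eq_right times_divide_eq_left mult_1_right mult.commute[of 2])
    finally have "2 * (w \<bullet> y) \<le> sqrt 2 * (u + v)" by (simp only: two)
    then show ?thesis unfolding dist[OF y] gap by simp
  qed
  show ?thesis
  proof (rule antisym)
    show "infdist w (null_cone \<inter> sphere 0 1) \<le> sqrt (cone_gap ((q w)\<^sup>2))"
      using infdist_le[OF z_in, of w] dz by simp
    show "sqrt (cone_gap ((q w)\<^sup>2)) \<le> infdist w (null_cone \<inter> sphere 0 1)"
      using z_in lower unfolding infdist_def by (auto intro!: cINF_greatest)
  qed
qed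

end

section \<open>Geometry of the deformed ball\<close>

lemma closure_ray:
  fixes z :: "'a::real_normed_vector"
  assumes "\<And>t. 0 < t \<Longrightarrow> t < 1 \<Longrightarrow> t *\<^sub>R z \<in> S"
  shows "z \<in> closure S"
proof (rule Lim_in_closed_set[OF closed_closure])
  show "((\<lambda>t. t *\<^sub>R z) \<longlongrightarrow> z) (at_left 1)"
    using tendsto_scaleR[OF tendsto_ident_at[of "1::real" "{..<1}"] tendsto_const[of z]] by simp
  have "\<forall>\<^sub>F t in at_left 1. (0::real) < t \<and> t < 1"
    by (rule eventually_at_leftI[of 0]) auto
  then show "\<forall>\<^sub>F t in at_left 1. t *\<^sub>R z \<in> closure S"
    by eventually_elim (use assms closure_subset[of S] in blast)
qed (rule trivial_limit_at_left_real)

context simons_involution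
begin

lemma cone_two_sided:
  assumes "q z = 0" "s > 0" and t: "t = 1 \<or> t = - 1"
  obtains y where "y \<in> ball z s" "0 < t * q y"
proof (cases "z = 0")
  case True
  obtain e where e: "norm e = 1" "J e = t *\<^sub>R e"
    using t plus_vector minus_vector by (metis scaleR_minus1_left scaleR_one)
  then have "q e = t" by (simp add: q_def dot_square_norm)
  then show ?thesis using that[of "(s / 2) *\<^sub>R e"] True assms(2) e(1) t by (auto simp: q_scaleR)
next
  case False
  define d where "d = s / (2 * norm z)"
  have d: "d > 0" "d * norm z < s" using False assms(2) by (simp_all add: d_def)
  show ?thesis
  proof (rule that[of "z + (t * d) *\<^sub>R J z"])
    show "z + (t * d) *\<^sub>R J z \<in> ball z s" using d t by (auto simp: dist_norm)
    show "0 < t * q (z + (t * d) *\<^sub>R J z)" using d(1) False t unfolding q_flow assms(1) by auto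
  qed
qed

lemma frontier_neg_side: "frontier neg_side = null_cone"
proof -
  have "closure neg_side \<subseteq> {x. q x \<le> 0}"
    by (rule closure_minimal) (auto simp: neg_side_def intro!: closed_Collect_le continuous_intros)
  moreover have "null_cone \<subseteq> closure neg_side"
  proof
    fix z assume "z \<in> null_cone"
    then have z: "q z = 0" by (simp add: null_cone_def)
    show "z \<in> closure neg_side"
      unfolding closure_approachable
    proof (intro allI impI)
      fix s :: real assume "s > 0"
      obtain y where "y \<in> ball z s" "0 < - 1 * q y" by (rule cone_two_sided[OF z \<open>s > 0\<close>, of "- 1"]) auto
      then show "\<exists>y\<in>neg_side. dist y z < s" by (intro bexI[of _ y]) (auto simp: neg_side_def dist_commute)
    qed
  qed
  moreover have "frontier neg_side = closure neg_side - neg_side"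
    by (simp add: frontier_def interior_open[OF open_neg_side])
  moreover have "x \<in> null_cone" if "q x \<le> 0" "x \<notin> neg_side" for x
    using that by (simp add: null_cone_def neg_side_def)
  moreover have "null_cone \<inter> neg_side = {}" by (auto simp: null_cone_def neg_side_def)
  ultimately show ?thesis by blast
qed

lemma boundary_mod_null_neg_side: "boundary_mod_null neg_side = null_cone"
proof (intro set_eqI iffI)
  fix x assume x: "x \<in> boundary_mod_null neg_side"
  have op: "open {x. q x > 0}" by (intro open_Collect_less continuous_intros)
  show "x \<in> null_cone"
  proof (rule ccontr)
    assume "x \<notin> null_cone"
    then consider "x \<in> neg_side" | "x \<in> {x. q x > 0}" by (force simp: null_cone_def neg_side_def)
    then show False
    proof cases
      case 1
      then obtain s where "s > 0" "ball x s \<subseteq> neg_side" using open_neg_side openE by blast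
      then have "ball x s - neg_side = {}" by blast
      then show False using x \<open>s > 0\<close> negligible_empty unfolding boundary_mod_null_def by (metis (lifting) mem_Collect_eq)
    next
      case 2
      then obtain s where "s > 0" "ball x s \<subseteq> {x. q x > 0}" using op openE by blast
      then have "ball x s \<inter> neg_side = {}" by (force simp: neg_side_def)
      then show False using x \<open>s > 0\<close> negligible_empty unfolding boundary_mod_null_def by (metis (lifting) mem_Collect_eq)
    qed
  qed
next
  fix x assume "x \<in> null_cone"
  then have x: "q x = 0" by (simp add: null_cone_def)
  show "x \<in> boundary_mod_null neg_side"
    unfolding boundary_mod_null_def
  proof (intro CollectI allI impI conjI)
    fix s :: real assume "s > 0"
    obtain y where "y \<in> ball x s" "0 < - 1 * q y" by (rule cone_two_sided[OF x \<open>s > 0\<close>, of "- 1"]) auto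
    then have "ball x s \<inter> neg_side \<noteq> {}" by (auto simp: neg_side_def)
    then show "\<not> negligible (ball x s \<inter> neg_side)"
      by (intro open_not_negligible open_Int open_neg_side open_ball)
    obtain y where "y \<in> ball x s" "0 < 1 * q y" by (rule cone_two_sided[OF x \<open>s > 0\<close>, of 1]) auto
    then have "ball x s \<inter> {x. q x > 0} \<noteq> {}" by auto
    then have "\<not> negligible (ball x s \<inter> {x. q x > 0})"
      by (intro open_not_negligible open_Int open_Collect_less continuous_intros open_ball)
    moreover have "ball x s \<inter> {x. q x > 0} \<subseteq> ball x s - neg_side" by (auto simp: neg_side_def)
    ultimately show "\<not> negligible (ball x s - neg_side)" by (meson negligible_subset)
  qed
qed

text \<open>The derivative at the origin of a function that vanishes on the cone kills every line of the cone, and these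
  lines span the space.\<close>

lemma singular_origin: "singular_point null_cone 0"
proof -
  have "frechet_derivative f (at 0) = (\<lambda>v. 0)"
    if U: "open U" "0 \<in> U" and f: "C1_on f U" "null_cone \<inter> U = {x \<in> U. f x = 0}" for U and f :: "'a \<Rightarrow> real"
  proof -
    let ?D = "frechet_derivative f (at 0)"
    have hd: "(f has_derivative ?D) (at 0)" using f(1) U(2) by (rule C1_on_has_derivative)
    then have lin: "linear ?D" by (rule has_derivative_linear)
    have cone0: "?D z = 0" if "q z = 0" for z
    proof -
      have "((\<lambda>t::real. t *\<^sub>R z) has_derivative (\<lambda>h. h *\<^sub>R z)) (at 0)"
        by (auto intro!: derivative_eq_intros)
      from has_derivative_compose[OF this, of f ?D] hd
      have 1: "((\<lambda>t. f (t *\<^sub>R z)) has_derivative (\<lambda>h. ?D (h *\<^sub>R z))) (at 0)" by simp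
      have "open ((\<lambda>t::real. t *\<^sub>R z) -` U)"
        using U(1) by (intro continuous_open_vimage) (auto intro!: continuous_intros)
      moreover have "f (t *\<^sub>R z) = 0" if "t \<in> (\<lambda>t::real. t *\<^sub>R z) -` U" for t
      proof -
        have "t *\<^sub>R z \<in> null_cone \<inter> U" using that \<open>q z = 0\<close> by (simp add: null_cone_def q_scaleR)
        then show ?thesis unfolding f(2) by simp
      qed
      ultimately have 2: "((\<lambda>t. f (t *\<^sub>R z)) has_derivative (\<lambda>h. 0)) (at (0::real))"
        using U(2) by (intro has_derivative_transform_within_open[OF has_derivative_const[of 0]]) auto
      from has_derivative_unique[OF 1 2] have "?D (1 *\<^sub>R z) = 0" by metis
      then show ?thesis by simp
    qed
    obtain a where a: "norm a = 1" "J a = a" using plus_vector by blast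
    obtain b where b: "norm b = 1" "J b = - b" using minus_vector by blast
    have eigen: "?D p = 0" if p: "J p = t *\<^sub>R p" and e: "norm e = 1" "J e = - t *\<^sub>R e" and t: "t \<noteq> 0" for p e t
    proof -
      have pe: "p \<bullet> e = 0" using J_sym[of p e] p e(2) t by simp
      have "q (p + norm p *\<^sub>R e) = 0" "q (p - norm p *\<^sub>R e) = 0"
        using p e pe by (simp_all add: q_def J_add J_diff J_scaleR inner_add_left inner_add_right
          inner_diff_left inner_diff_right inner_commute[of e p] dot_square_norm power2_eq_square)
      then have "?D ((p + norm p *\<^sub>R e) + (p - norm p *\<^sub>R e)) = 0"
        by (simp only: linear_add[OF lin, of "p + norm p *\<^sub>R e" "p - norm p *\<^sub>R e"] cone0)
      then have "?D (2 *\<^sub>R p) = 0" by (simp add: scaleR_2)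
      then show ?thesis by (simp add: linear_cmul[OF lin])
    qed
    have "?D v = 0" for v
    proof -
      have "2 *\<^sub>R v = (v + J v) + (v - J v)" by (simp add: scaleR_2)
      then have "?D (2 *\<^sub>R v) = ?D (v + J v) + ?D (v - J v)" by (simp only: linear_add[OF lin])
      also have "\<dots> = 0" using a b eigen[of _ 1 b] eigen[of _ "- 1" a] by (simp add: J_add J_diff add.commute)
      finally show ?thesis by (simp add: linear_cmul[OF lin])
    qed
    then show ?thesis by auto
  qed
  then show ?thesis unfolding singular_point_def by (auto simp: null_cone_def)
qed

definition domain :: "real \<Rightarrow> (real \<Rightarrow> real) \<Rightarrow> 'a set" where
  "domain K \<eta> = {x. x = 0 \<or> 0 < rho K (profile \<eta>) x}"

definition radius :: "real \<Rightarrow> (real \<Rightarrow> real) \<Rightarrow> 'a \<Rightarrow> real" where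
  "radius K \<eta> \<omega> = (let \<phi> = (\<lambda>a. a\<^sup>2 * \<eta> a) in 1 + K * \<phi> (infdist \<omega> (null_cone \<inter> sphere 0 1)))"

lemma radius_eq:
  assumes "norm w = 1"
  shows "radius K \<eta> w = 1 + K * profile \<eta> ((q w)\<^sup>2)"
  using unit_infdist_cone[OF assms] cone_gap_nonneg[of "(q w)\<^sup>2"]
  by (simp add: radius_def profile_def)

lemma rho_eq_radius:
  assumes "norm w = 1" "0 < t"
  shows "rho K (profile \<eta>) (t *\<^sub>R w) = radius K \<eta> w - t"
proof -
  have "sqrt ((t *\<^sub>R w) \<bullet> (t *\<^sub>R w)) = t"
    unfolding norm_eq_sqrt_inner[symmetric] using assms by simp
  then show ?thesis
    using assms by (simp add: rho_def latitude_scaleR latitude_unit radius_eq)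
qed

lemma rho_scaleR:
  assumes "0 < t"
  shows "rho K \<Phi> (t *\<^sub>R x) = rho K \<Phi> x + (1 - t) * norm x"
proof -
  have "sqrt ((t *\<^sub>R x) \<bullet> (t *\<^sub>R x)) = t * norm x"
    unfolding norm_eq_sqrt_inner[symmetric] using assms by simp
  moreover have "sqrt (x \<bullet> x) = norm x" by (simp add: norm_eq_sqrt_inner)
  ultimately show ?thesis using assms by (simp add: rho_def latitude_scaleR algebra_simps)
qed

lemma domain_eq_polar:
  assumes "0 \<le> K" "cutoff \<upsilon> \<eta>"
  shows "{t *\<^sub>R \<omega> | t \<omega>. \<omega> \<in> sphere 0 1 \<and> 0 \<le> t \<and> t < radius K \<eta> \<omega>} = domain K \<eta>"
proof (intro set_eqI iffI)
  fix x assume "x \<in> {t *\<^sub>R \<omega> | t \<omega>. \<omega> \<in> sphere 0 1 \<and> 0 \<le> t \<and> t < radius K \<eta> \<omega>}"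
  then obtain t w where w: "x = t *\<^sub>R w" "norm w = 1" "0 \<le> t" "t < radius K \<eta> w" by auto
  then show "x \<in> domain K \<eta>"
    using rho_eq_radius[OF w(2), of t K \<eta>] by (cases "t = 0") (auto simp: domain_def)
next
  fix x assume x: "x \<in> domain K \<eta>"
  show "x \<in> {t *\<^sub>R \<omega> | t \<omega>. \<omega> \<in> sphere 0 1 \<and> 0 \<le> t \<and> t < radius K \<eta> \<omega>}"
  proof (cases "x = 0")
    case True
    obtain e :: 'a where "norm e = 1" using plus_vector by blast
    moreover have "0 < radius K \<eta> e"
      using assms profile_nonneg[of \<upsilon> \<eta>] \<open>norm e = 1\<close> by (simp add: radius_eq add_pos_nonneg)
    ultimately show ?thesis using True by force
  next
    case False
    define w where "w = (1 / norm x) *\<^sub>R x"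
    have w: "norm w = 1" "x = norm x *\<^sub>R w" "0 < norm x" using False by (simp_all add: w_def)
    then have "norm x < radius K \<eta> w"
      using x False rho_eq_radius[OF w(1,3), of K \<eta>] by (simp add: domain_def)
    then show ?thesis using w by force
  qed
qed

context
  fixes K \<upsilon> :: real and \<eta> :: "real \<Rightarrow> real"
  assumes K: "4 \<le> K" and \<upsilon>: "0 < \<upsilon>" "\<upsilon> < 1 / 4" and \<eta>: "cutoff \<upsilon> \<eta>"
begin

abbreviation "\<rho> \<equiv> rho K (profile \<eta>)"

abbreviation "\<Omega> \<equiv> domain K \<eta>"

lemma rho_ge: "1 - norm x \<le> \<rho> x"
  using K profile_nonneg[OF \<eta> latitude_nonneg[of x]] by (simp add: rho_def norm_eq_sqrt_inner)

lemma superlevel_domain_rho: "\<exists>r. superlevel_domain J \<rho> \<Omega> r"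
proof -
  have "compact (profile \<eta> ` {0..1})"
    by (intro compact_continuous_image continuous_on_subset[OF C1_on_imp_continuous_on[OF C1_on_profile[OF \<upsilon> \<eta>]]]) auto
  then obtain M where M: "M > 0" "\<And>t. t \<in> {0..1} \<Longrightarrow> norm (profile \<eta> t) \<le> M"
    using compact_imp_bounded bounded_pos by (metis imageI)
  have "superlevel_domain J \<rho> \<Omega> (1 + K * M)"
  proof
    show "\<Omega> = {x. x = 0 \<or> 0 < \<rho> x}" by (simp add: domain_def)
    show "C1_on (\<rho>) (- {0})" by (rule C1_on_rho[OF C1_on_profile[OF \<upsilon> \<eta>]])
    show "1 / 2 < \<rho> x" if "norm x < 1 / 2" for x
      using rho_ge[of x] that by simp
    show "\<rho> x \<le> 0" if "1 + K * M \<le> norm x" for x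
    proof -
      have "profile \<eta> (latitude x) \<le> M"
        using M(2)[of "latitude x"] latitude_nonneg[of x] latitude_le_1[of x] by simp
      then have "K * profile \<eta> (latitude x) \<le> K * M" using K by (intro mult_left_mono) auto
      then show ?thesis using that by (simp add: rho_def norm_eq_sqrt_inner)
    qed
  qed
  then show ?thesis by blast
qed

lemma open_domain: "open \<Omega>"
  using superlevel_domain_rho superlevel_domain.open_\<Omega> by blast

lemma frontier_domain: "frontier \<Omega> = {x. x \<noteq> 0 \<and> \<rho> x = 0}"
proof (intro set_eqI iffI)
  fix x assume "x \<in> frontier \<Omega>"
  then have x: "x \<in> closure \<Omega>" "x \<notin> \<Omega>"
    using open_domain by (auto simp: frontier_def interior_open)
  then have x': "x \<noteq> 0" "\<rho> x \<le> 0" by (auto simp: domain_def)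
  have "\<not> \<rho> x < 0"
  proof
    assume neg: "\<rho> x < 0"
    let ?U = "(- {0}) \<inter> \<rho> -` {..<0}"
    have "open ?U"
      by (rule continuous_open_preimage[OF C1_on_imp_continuous_on[OF C1_on_rho[OF C1_on_profile[OF \<upsilon> \<eta>]]]])
        (auto simp: open_Compl)
    moreover have "x \<in> ?U" using x' neg by simp
    ultimately have "?U \<inter> \<Omega> \<noteq> {}" using x(1) open_Int_closure_eq_empty[of ?U "\<Omega>"] by blast
    then show False by (auto simp: domain_def)
  qed
  then show "x \<in> {x. x \<noteq> 0 \<and> \<rho> x = 0}" using x' by simp
next
  fix x assume "x \<in> {x. x \<noteq> 0 \<and> \<rho> x = 0}"
  then have x: "x \<noteq> 0" "\<rho> x = 0" by auto
  have "t *\<^sub>R x \<in> \<Omega>" if "0 < t" "t < 1" for t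
    using rho_scaleR[OF that(1), of K "profile \<eta>" x] x that by (simp add: domain_def)
  then have "x \<in> closure \<Omega>" by (rule closure_ray)
  then show "x \<in> frontier \<Omega>"
    using x open_domain by (simp add: frontier_def interior_open domain_def)
qed

lemma frontier_domain_polar: "frontier \<Omega> = (\<lambda>\<omega>. radius K \<eta> \<omega> *\<^sub>R \<omega>) ` sphere 0 1"
proof (intro set_eqI iffI)
  fix x assume "x \<in> frontier \<Omega>"
  then have x: "x \<noteq> 0" "\<rho> x = 0" by (auto simp: frontier_domain)
  define w where "w = (1 / norm x) *\<^sub>R x"
  have w: "norm w = 1" "x = norm x *\<^sub>R w" "0 < norm x" using x(1) by (simp_all add: w_def)
  have "norm x = radius K \<eta> w" using rho_eq_radius[OF w(1,3), of K \<eta>] w(2) x(2) by simp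
  then show "x \<in> (\<lambda>\<omega>. radius K \<eta> \<omega> *\<^sub>R \<omega>) ` sphere 0 1" using w by (intro image_eqI[of _ _ w]) auto
next
  fix x assume "x \<in> (\<lambda>\<omega>. radius K \<eta> \<omega> *\<^sub>R \<omega>) ` sphere 0 1"
  then obtain w where w: "norm w = 1" "x = radius K \<eta> w *\<^sub>R w" by auto
  have "0 < radius K \<eta> w"
    using K profile_nonneg[OF \<eta>] by (simp add: radius_eq[OF w(1)] add_pos_nonneg)
  then show "x \<in> frontier \<Omega>"
    using rho_eq_radius[OF w(1), of "radius K \<eta> w" K \<eta>] w by (auto simp: frontier_domain)
qed

lemma cone_Int_frontier: "null_cone \<inter> frontier \<Omega> = null_cone \<inter> sphere 0 1"
  by (auto simp: frontier_domain null_cone_def rho_def latitude_def norm_eq_sqrt_inner)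

lemma boundary_trace_neg_side:
  "boundary_trace \<Omega> neg_side = null_cone \<inter> frontier \<Omega>"
proof -
  have "closure (\<Omega> \<inter> null_cone) \<subseteq> null_cone" using closed_cone by (intro closure_minimal) auto
  moreover have "x \<in> closure (\<Omega> \<inter> null_cone)" if x: "x \<in> null_cone" "x \<in> frontier \<Omega>" for x
  proof (rule closure_ray)
    show "t *\<^sub>R x \<in> \<Omega> \<inter> null_cone" if "0 < t" "t < 1" for t
      using rho_scaleR[OF that(1), of K "profile \<eta>" x] x that unfolding frontier_domain
      by (simp add: domain_def null_cone_def q_scaleR)
  qed
  ultimately show ?thesis unfolding boundary_trace_def boundary_mod_null_neg_side by blast
qed

text \<open>Rotate a point \<open>p\<close> of the trace in the normal direction \<open>J p\<close>, by opposite angles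
  whose cosine is \<open>c\<close>. The boundary has moved out so far at the two new directions that the
  domain contains two points with midpoint \<open>p\<close>; but \<open>p\<close> itself lies on the frontier.\<close>

lemma not_convex_domain: "\<not> convex \<Omega>"
proof
  assume conv: "convex \<Omega>"
  obtain a where a: "norm a = 1" "J a = a" using plus_vector by blast
  obtain b where b: "norm b = 1" "J b = - b" using minus_vector by blast
  have ab: "a \<bullet> b = 0" using J_sym[of a b] a(2) b(2) by simp
  have aa: "a \<bullet> a = 1" "b \<bullet> b = 1" using a(1) b(1) by (simp_all add: dot_square_norm)
  define p where "p = (1 / sqrt 2) *\<^sub>R (a + b)"
  have pp: "p \<bullet> p = 1" by (simp add: p_def inner_add_left inner_add_right ab aa inner_commute[of b a])
  have pJ: "p \<bullet> J p = 0"
    by (simp add: p_def J_scaleR J_add a(2) b(2) inner_add_left inner_add_right inner_diff_right ab aa inner_commute[of b a])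
  \<comment> \<open>Chosen so that the two directions have distance exactly \<open>\<upsilon>\<close> from the trace, where the cut-off is still 1.\<close>
  define c where "c = 1 - \<upsilon>\<^sup>2 / 2"
  have u2: "0 < \<upsilon>\<^sup>2" "\<upsilon>\<^sup>2 < 1 / 16"
    using \<upsilon> power_strict_mono[of \<upsilon> "1/4" 2] by (auto simp: power2_eq_square)
  have c: "3 / 4 < c" "c < 1" using u2 by (auto simp: c_def)
  have c2: "1 / 2 < c\<^sup>2" "c\<^sup>2 < 1"
    using power_strict_mono[of "3/4" c 2] power_strict_mono[of c 1 2] c by (auto simp: power2_eq_square)
  have in_domain: "(1 / c) *\<^sub>R (c *\<^sub>R p + s *\<^sub>R J p) \<in> \<Omega>" if s: "s\<^sup>2 = 1 - c\<^sup>2" for s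
  proof -
    let ?w = "c *\<^sub>R p + s *\<^sub>R J p"
    have "?w \<bullet> ?w = c\<^sup>2 + s\<^sup>2"
      by (simp add: inner_add_left inner_add_right pp pJ inner_commute[of "J p" p] power2_eq_square)
    then have w: "norm ?w = 1" using s by (simp add: norm_eq_sqrt_inner)
    have "q ?w = 2 * c * s"
      by (simp add: q_add q_scaleR J_scaleR pp) (simp add: q_def pJ)
    then have "1 - (q ?w)\<^sup>2 = (2 * c\<^sup>2 - 1)\<^sup>2"
      using s by (simp add: power_mult_distrib) (simp add: power2_eq_square algebra_simps)
    then have "sqrt (1 - (q ?w)\<^sup>2) = 2 * c\<^sup>2 - 1" using c2 by simp
    then have "cone_gap ((q ?w)\<^sup>2) = 2 - sqrt 2 * sqrt (2 * c\<^sup>2)" by (simp add: cone_gap_def)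
    also have "sqrt (2 * c\<^sup>2) = sqrt 2 * c" using c by (simp add: real_sqrt_mult)
    also have "2 - sqrt 2 * (sqrt 2 * c) = \<upsilon>\<^sup>2" by (simp add: c_def flip: mult.assoc)
    finally have "radius K \<eta> ?w = 1 + K * \<upsilon>\<^sup>2"
      using \<eta> \<upsilon>(1) by (simp add: radius_eq[OF w] profile_def cutoff_def)
    moreover have "1 / c < 1 + K * \<upsilon>\<^sup>2"
    proof -
      have "1 < (1 - u / 2) * (1 + 4 * u)" if "0 < u" "u < 1 / 16" for u :: real
      proof -
        have "u * u < u * (1 / 16)" using that by (intro mult_strict_left_mono)
        then show ?thesis using that(1) by (simp add: algebra_simps)
      qed
      from this[OF u2] have "1 < (1 - \<upsilon>\<^sup>2 / 2) * (1 + 4 * \<upsilon>\<^sup>2)" .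
      also have "\<dots> \<le> c * (1 + K * \<upsilon>\<^sup>2)"
        using K c unfolding c_def[symmetric] by (intro mult_left_mono add_left_mono mult_right_mono) auto
      finally show ?thesis using c by (simp add: field_simps)
    qed
    ultimately show ?thesis
      using rho_eq_radius[OF w, of "1 / c" K \<eta>] c by (simp add: domain_def)
  qed
  define s where "s = sqrt (1 - c\<^sup>2)"
  have s: "s\<^sup>2 = 1 - c\<^sup>2" "(- s)\<^sup>2 = 1 - c\<^sup>2" using c2 by (simp_all add: s_def)
  have "(1 / 2) *\<^sub>R ((1 / c) *\<^sub>R (c *\<^sub>R p + s *\<^sub>R J p)) + (1 / 2) *\<^sub>R ((1 / c) *\<^sub>R (c *\<^sub>R p + (- s) *\<^sub>R J p)) \<in> \<Omega>"
    by (rule convexD[OF conv in_domain[OF s(1)] in_domain[OF s(2)]]) auto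
  also have "(1 / 2) *\<^sub>R ((1 / c) *\<^sub>R (c *\<^sub>R p + s *\<^sub>R J p)) + (1 / 2) *\<^sub>R ((1 / c) *\<^sub>R (c *\<^sub>R p + (- s) *\<^sub>R J p)) = p"
    using c by (simp add: scaleR_add_right scaleR_diff_right flip: scaleR_add_left)
  finally have "p \<in> \<Omega>" .
  moreover have "p \<noteq> 0" using pp by auto
  moreover have "\<rho> p = 0" using pp pJ by (simp add: rho_def latitude_def q_def)
  ultimately show False by (simp add: domain_def)
qed

text \<open>On \<open>G\<close> the bracket in \<open>rho_derivative_along_X\<close> is positive: the bending term is at
  least \<open>4 * 4 * (1 / 4) * (3 / 4) = 3\<close>, the radial term below \<open>2 * (3 / 2) = 3\<close>.\<close>

lemma simons_domain_rho:
  "\<exists>r G \<delta>. simons_domain J \<rho> \<Omega> r G \<delta>"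
proof -
  obtain r where r: "superlevel_domain J \<rho> \<Omega> r"
    using superlevel_domain_rho by blast
  obtain s where s: "0 < s" "s \<le> 1 / 4" "\<And>t. 0 \<le> t \<Longrightarrow> t < s \<Longrightarrow> 1 / 4 \<le> deriv (profile \<eta>) t"
    by (rule profile_near_0[OF \<upsilon> \<eta>]) (rule that)
  define G where "G = {x. x \<noteq> 0 \<and> latitude x < s \<and> norm x < 3 / 2}"
  define \<delta> where "\<delta> = min (1 / 4) (sqrt s / 4)"
  have \<delta>: "0 < \<delta>" "\<delta> \<le> 1 / 4" "\<delta> \<le> sqrt s / 4" using s(1) by (auto simp: \<delta>_def)
  have "simons_domain J \<rho> \<Omega> r G \<delta>"
  proof (intro simons_domain.intro r simons_domain_axioms.intro)
    have "open ((- {0}) \<inter> latitude -` {..<s})"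
      by (rule continuous_open_preimage[OF C1_on_imp_continuous_on[OF C1_on_latitude]]) (auto simp: open_Compl)
    moreover have "G = ((- {0}) \<inter> latitude -` {..<s}) \<inter> ball 0 (3 / 2)" by (auto simp: G_def)
    ultimately show "open G" by (simp only: open_Int open_ball)
    show "0 < \<delta>" by (rule \<delta>)
  next
    fix x assume "x \<in> G"
    then have x: "x \<noteq> 0" "latitude x < s" "norm x < 3 / 2" by (auto simp: G_def)
    have "(profile \<eta> has_real_derivative deriv (profile \<eta>) (latitude x)) (at (latitude x))"
      by (rule C1_on_DERIV[OF C1_on_profile[OF \<upsilon> \<eta>]]) (simp add: latitude_nonneg)
    note D = rho_derivative_along_X[OF x(1) this, of K]
    have d: "1 / 4 \<le> deriv (profile \<eta>) (latitude x)" using s(3) x(2) latitude_nonneg by blast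
    have "4 * 4 * (1 / 4) * (3 / 4) \<le> 4 * K * deriv (profile \<eta>) (latitude x) * (1 - latitude x)"
      using K d x(2) s(2) by (intro mult_mono) auto
    then have "0 \<le> 4 * K * deriv (profile \<eta>) (latitude x) * (1 - latitude x) - 2 * norm x"
      using x(3) by linarith
    then have "0 \<le> (q x)\<^sup>2 / sqrt (B x) * (4 * K * deriv (profile \<eta>) (latitude x) * (1 - latitude x) - 2 * norm x)"
      using B_pos[OF x(1)] by (intro mult_nonneg_nonneg divide_nonneg_nonneg) auto
    then show "x \<noteq> 0 \<and> 0 \<le> q x * frechet_derivative (\<rho>) (at x) (X x)"
      unfolding D using x(1) by (simp add: power2_eq_square mult.assoc)
  next
    fix p z assume p: "p \<in> frontier \<Omega>" "p \<notin> G"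
      and z: "z \<in> boundary_trace \<Omega> neg_side"
    then have z': "q z = 0" "norm z = 1"
      unfolding boundary_trace_neg_side cone_Int_frontier by (auto simp: null_cone_def)
    have p': "p \<noteq> 0" "1 \<le> norm p" using p(1) rho_ge[of p] by (auto simp: frontier_domain)
    show "\<delta> \<le> dist p z"
    proof (rule ccontr)
      assume "\<not> \<delta> \<le> dist p z"
      then have pz: "norm (p - z) < \<delta>" by (simp add: dist_norm)
      have "norm p \<le> norm z + norm (p - z)" by (metis add.commute diff_add_cancel norm_triangle_ineq)
      then have np: "norm p < 5 / 4" using pz \<delta>(2) z'(2) by simp
      have "\<bar>q p\<bar> \<le> norm (p - z) * norm (p + z)" using q_diff_le[of p z] z'(1) by simp
      also have "\<dots> \<le> \<delta> * 3"
        using pz np z'(2) norm_triangle_ineq[of p z] \<delta>(1) by (intro mult_mono) auto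
      also have "\<dots> < sqrt s" using \<delta>(1,3) by linarith
      finally have "\<bar>q p\<bar> < sqrt s" .
      then have "\<bar>q p\<bar>\<^sup>2 < (sqrt s)\<^sup>2" by (intro power_strict_mono) auto
      then have qp: "(q p)\<^sup>2 < s" using s(1) by simp
      have "1 \<le> p \<bullet> p" using p'(2) by (simp add: dot_square_norm power_mono[of 1 "norm p" 2, simplified])
      then have "\<bar>q p * (1 / (p \<bullet> p))\<bar> \<le> \<bar>q p\<bar>"
        by (simp add: abs_mult divide_le_eq mult_le_cancel_left1)
      then have "latitude p \<le> (q p)\<^sup>2" unfolding latitude_def by (rule abs_le_square_iff[THEN iffD1])
      then show False using p(2) p'(1) qp np by (simp add: G_def)
    qed
  qed
  then show ?thesis by blast
qed

lemma cone_strict_local_minimizer: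
  "\<exists>\<delta>>0. \<forall>E. competitor \<delta> \<Omega> neg_side E \<longrightarrow>
     perimeter \<Omega> neg_side \<le> perimeter \<Omega> E \<and>
     (boundary_mod_null E \<inter> \<Omega> \<noteq> null_cone \<inter> \<Omega> \<longrightarrow>
       perimeter \<Omega> neg_side < perimeter \<Omega> E)"
proof -
  obtain r G \<delta> where sd: "simons_domain J \<rho> \<Omega> r G \<delta>"
    using simons_domain_rho by blast
  show ?thesis
  proof (intro exI conjI allI impI)
    show "0 < \<delta>" by (rule simons_domain.\<delta>_pos[OF sd])
    fix E assume E: "competitor \<delta> \<Omega> neg_side E"
    let ?D = "\<Omega> \<inter> ((neg_side - E) \<union> (E - neg_side))"
    have less: "perimeter \<Omega> neg_side < perimeter \<Omega> E" if "\<not> negligible ?D"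
      using simons_domain.perimeter_less[OF sd E that] .
    have meas: "E \<in> sets lebesgue" "neg_side \<in> sets lebesgue"
      using E open_neg_side by (auto simp: competitor_def)
    show "perimeter \<Omega> neg_side \<le> perimeter \<Omega> E"
    proof (cases "negligible ?D")
      case True
      then show ?thesis using perimeter_cong_negligible[OF True meas(2,1)] by simp
    next
      case False
      then show ?thesis using less by simp
    qed
    assume "boundary_mod_null E \<inter> \<Omega> \<noteq> null_cone \<inter> \<Omega>"
    then have "\<not> negligible ?D"
      using boundary_mod_null_cong[of "\<Omega>" neg_side E] open_domain
      unfolding boundary_mod_null_neg_side by blast
    then show "perimeter \<Omega> neg_side < perimeter \<Omega> E" by (rule less)
  qed
qed

end

end

section \<open>The Simons cone\<close>

lemma UNIV_8: "(UNIV :: 8 set) = {1, 2, 3, 4, 5, 6, 7, 8}"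
proof -
  have "card {1, 2, 3, 4, 5, 6, 7, 8 :: 8} = CARD(8)" by simp
  then show ?thesis by (metis card_subset_eq finite subset_UNIV)
qed

lemma sum_8: "(\<Sum>i\<in>(UNIV :: 8 set). f i) = f 1 + f 2 + f 3 + f 4 + f 5 + f 6 + f 7 + f 8"
  unfolding UNIV_8 by (simp add: add.assoc)

definition split_sign :: "8 \<Rightarrow> real" where
  "split_sign i = (if i \<in> {1, 2, 3, 4} then 1 else - 1)"

text \<open>The sign \<open>s\<close> selects the side of the cone: \<open>neg_side\<close> of \<open>reflection s\<close>
  is \<open>{x. s * simons_form x < 0}\<close>.\<close>

definition reflection :: "real \<Rightarrow> real ^ 8 \<Rightarrow> real ^ 8" where
  "reflection s x = (\<chi> i. s * split_sign i * x $ i)"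

lemma simons_involution_reflection:
  assumes s: "s = 1 \<or> s = - 1"
  shows "simons_involution (reflection s)"
proof (rule simons_involution.intro)
  have sq: "s * split_sign i * (s * split_sign i * y) = y" for i y
    using s by (auto simp: split_sign_def)
  show "linear (reflection s)"
    by (intro linearI) (auto simp: reflection_def vec_eq_iff algebra_simps)
  show "reflection s (reflection s x) = x" for x
    by (simp add: reflection_def vec_eq_iff sq)
  show "reflection s x \<bullet> y = x \<bullet> reflection s y" for x y
    by (simp add: reflection_def inner_vec_def mult_ac)
  have "(\<Sum>b\<in>(Basis :: (real ^ 8) set). reflection s b \<bullet> b) = (\<Sum>i\<in>UNIV. reflection s (axis i 1) \<bullet> axis i 1)"
  proof -
    have "(Basis :: (real ^ 8) set) = (\<lambda>i. axis i 1) ` UNIV" by (auto simp: Basis_vec_def)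
    moreover have "inj (\<lambda>i::8. axis i (1::real))" by (auto simp: inj_def axis_eq_axis)
    ultimately show ?thesis by (intro sum.reindex_cong[of "\<lambda>i. axis i 1"]) auto
  qed
  also have "\<dots> = (\<Sum>i\<in>UNIV. s * split_sign i)"
    by (simp add: inner_axis reflection_def)
  also have "\<dots> = 0" by (simp add: sum_8 split_sign_def)
  finally show "(\<Sum>b\<in>(Basis :: (real ^ 8) set). reflection s b \<bullet> b) = 0" .
  show "DIM(real ^ 8) = 8" by simp
  have ax: "reflection s (axis i 1) = (s * split_sign i) *\<^sub>R axis i 1" for i
    by (auto simp: reflection_def vec_eq_iff axis_def)
  show "\<exists>e. norm e = 1 \<and> reflection s e = e"
    using s by (intro exI[of _ "axis (if s = 1 then 1 else 5) 1"]) (auto simp: ax split_sign_def)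
  show "\<exists>e. norm e = 1 \<and> reflection s e = - e"
    using s by (intro exI[of _ "axis (if s = 1 then 5 else 1) 1"]) (auto simp: ax split_sign_def)
qed

lemma q_reflection: 
  assumes s: "s = 1 \<or> s = - 1"
  shows "simons_involution.q (reflection s) x = s * simons_form x"
  unfolding simons_involution.q_def[OF simons_involution_reflection[OF s]]
  by (simp add: inner_vec_def reflection_def sum_8 split_sign_def simons_form_def power2_eq_square algebra_simps)

lemma side_reflection:
  assumes "N \<in> simons_sides"
  obtains s where "s = 1 \<or> s = - 1" "N = simons_involution.neg_side (reflection s)"
proof -
  have "simons_involution.neg_side (reflection s) = {x. s * simons_form x < 0}" if "s = 1 \<or> s = - 1" for s
    using that by (simp add: simons_involution.neg_side_def[OF simons_involution_reflection] q_reflection)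
  from this[of 1] this[of "- 1"] show ?thesis
    using assms that[of 1] that[of "- 1"] by (auto simp: simons_sides_def)
qed

lemma cone_reflection:
  assumes s: "s = 1 \<or> s = - 1"
  shows "simons_involution.null_cone (reflection s) = simons_cone"
  using s by (auto simp: simons_involution.null_cone_def[OF simons_involution_reflection[OF s]] q_reflection simons_cone_def)

lemma radius_reflection:
  assumes s: "s = 1 \<or> s = - 1"
  shows "simons_involution.radius (reflection s) = polar_radius"
  by (simp add: fun_eq_iff simons_involution.radius_def[OF simons_involution_reflection[OF s]]
      cone_reflection[OF s] polar_radius_def)

lemma domain_reflection:
  assumes s: "s = 1 \<or> s = - 1" and "4 \<le> K" "cutoff \<upsilon> \<eta>"
  shows "simons_involution.domain (reflection s) K \<eta> = deformed_ball K \<eta>"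
  using simons_involution.domain_eq_polar[OF simons_involution_reflection[OF s] _ assms(3), of K] assms(2)
  by (simp add: deformed_ball_def radius_reflection[OF s])

lemma polar_radius_close:
  assumes "0 \<le> K" "\<epsilon> > 0"
  obtains \<upsilon> \<eta> where "0 < \<upsilon>" "\<upsilon> < 1 / 4" "cutoff \<upsilon> \<eta>" "\<And>\<omega>. \<bar>polar_radius K \<eta> \<omega> - 1\<bar> < \<epsilon>"
proof -
  define \<upsilon> where "\<upsilon> = min (1 / 8) (sqrt (\<epsilon> / (8 * (K + 1))))"
  have \<upsilon>: "0 < \<upsilon>" "\<upsilon> < 1 / 4" "\<upsilon> \<le> sqrt (\<epsilon> / (8 * (K + 1)))" using assms by (auto simp: \<upsilon>_def)
  have "\<upsilon>\<^sup>2 \<le> \<epsilon> / (8 * (K + 1))"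
    using power_mono[OF \<upsilon>(3), of 2] \<upsilon>(1) assms by simp
  then have small: "8 * (K + 1) * \<upsilon>\<^sup>2 \<le> \<epsilon>" using assms by (simp add: field_simps)
  obtain \<eta> where \<eta>: "cutoff \<upsilon> \<eta>" "\<And>a. \<eta> a \<le> 1" by (rule cutoff_exists[OF \<upsilon>(1)]) (rule that)
  have "\<bar>polar_radius K \<eta> w - 1\<bar> < \<epsilon>" for w
  proof -
    define d where "d = infdist w (simons_cone \<inter> sphere 0 1)"
    have d0: "0 \<le> d" by (simp add: d_def infdist_nonneg)
    have e0: "0 \<le> \<eta> d" using \<eta>(1) by (simp add: cutoff_def)
    have "d\<^sup>2 * \<eta> d \<le> 4 * \<upsilon>\<^sup>2"
    proof (cases "d < 2 * \<upsilon>")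
      case True
      have "d\<^sup>2 * \<eta> d \<le> d\<^sup>2" using \<eta>(2)[of d] e0 by (simp add: mult_left_le)
      also have "\<dots> \<le> (2 * \<upsilon>)\<^sup>2" using True d0 by (intro power_mono) auto
      finally show ?thesis by simp
    next
      case False
      then have "\<eta> d = 0" using \<eta>(1) d0 by (simp add: cutoff_def)
      then show ?thesis by simp
    qed
    then have "K * (d\<^sup>2 * \<eta> d) \<le> K * (4 * \<upsilon>\<^sup>2)" using assms(1) by (rule mult_left_mono)
    also have "\<dots> < 8 * (K + 1) * \<upsilon>\<^sup>2"
    proof -
      have "0 < (4 * K + 8) * \<upsilon>\<^sup>2" using assms(1) \<upsilon>(1) by (intro mult_pos_pos) auto
      then show ?thesis by (simp add: algebra_simps)
    qed
    finally have "K * (d\<^sup>2 * \<eta> d) < \<epsilon>" using small by simp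
    moreover have "polar_radius K \<eta> w - 1 = K * (d\<^sup>2 * \<eta> d)"
      by (simp add: polar_radius_def d_def Let_def)
    moreover have "0 \<le> K * (d\<^sup>2 * \<eta> d)" using assms(1) e0 by simp
    ultimately show ?thesis by simp
  qed
  then show ?thesis using that \<upsilon>(1,2) \<eta>(1) by blast
qed

lemma deformed_ball_minimizer:
  assumes K: "4 \<le> K" and \<upsilon>: "0 < \<upsilon>" "\<upsilon> < 1 / 4" and \<eta>: "cutoff \<upsilon> \<eta>" and N: "N \<in> simons_sides"
  shows "frontier N = simons_cone" (is ?A) "boundary_mod_null N = simons_cone" (is ?B)
    "boundary_trace (deformed_ball K \<eta>) N = simons_cone \<inter> frontier (deformed_ball K \<eta>)" (is ?C)
    "\<exists>\<delta>>0. \<forall>E. competitor \<delta> (deformed_ball K \<eta>) N E \<longrightarrow>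
       perimeter (deformed_ball K \<eta>) N \<le> perimeter (deformed_ball K \<eta>) E \<and>
       (boundary_mod_null E \<inter> deformed_ball K \<eta> \<noteq> simons_cone \<inter> deformed_ball K \<eta> \<longrightarrow>
         perimeter (deformed_ball K \<eta>) N < perimeter (deformed_ball K \<eta>) E)" (is ?D)
proof -
  obtain s where s: "s = 1 \<or> s = - 1" and N: "N = simons_involution.neg_side (reflection s)"
    using N by (rule side_reflection)
  note S = simons_involution_reflection[OF s]
  note eqs = N[symmetric] cone_reflection[OF s] domain_reflection[OF s K \<eta>]
  show ?A ?B ?C ?D
    using simons_involution.frontier_neg_side[OF S] simons_involution.boundary_mod_null_neg_side[OF S]
      simons_involution.boundary_trace_neg_side[OF S K \<upsilon> \<eta>]
      simons_involution.cone_strict_local_minimizer[OF S K \<upsilon> \<eta>]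
    unfolding eqs by blast+
qed

lemma deformed_ball_geometry:
  assumes K: "4 \<le> K" and \<upsilon>: "0 < \<upsilon>" "\<upsilon> < 1 / 4" and \<eta>: "cutoff \<upsilon> \<eta>"
  shows "frontier (deformed_ball K \<eta>) = (\<lambda>\<omega>. polar_radius K \<eta> \<omega> *\<^sub>R \<omega>) ` sphere 0 1"
    "\<not> convex (deformed_ball K \<eta>)"
    "simons_cone \<inter> frontier (deformed_ball K \<eta>) = simons_cone \<inter> sphere 0 1"
    "0 \<in> deformed_ball K \<eta>" "singular_point simons_cone 0"
proof -
  have one: "(1::real) = 1 \<or> 1 = (- 1::real)" by simp
  note S = simons_involution_reflection[OF one]
  note eqs = cone_reflection[OF one] domain_reflection[OF one K \<eta>] radius_reflection[OF one]
  show "frontier (deformed_ball K \<eta>) = (\<lambda>\<omega>. polar_radius K \<eta> \<omega> *\<^sub>R \<omega>) ` sphere 0 1"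
    using simons_involution.frontier_domain_polar[OF S K \<upsilon> \<eta>] unfolding eqs .
  show "\<not> convex (deformed_ball K \<eta>)"
    using simons_involution.not_convex_domain[OF S K \<upsilon> \<eta>] unfolding eqs .
  show "simons_cone \<inter> frontier (deformed_ball K \<eta>) = simons_cone \<inter> sphere 0 1"
    using simons_involution.cone_Int_frontier[OF S K \<upsilon> \<eta>] unfolding eqs .
  show "0 \<in> deformed_ball K \<eta>"
    unfolding eqs[symmetric] by (simp add: simons_involution.domain_def[OF S])
  show "singular_point simons_cone 0"
    using simons_involution.singular_origin[OF S] unfolding eqs .
qed

theorem mainTheorem1:
  shows "\<exists>\<upsilon>\<^sub>0>0. \<exists>K\<^sub>0>0. \<forall>K\<ge>K\<^sub>0.
    (\<forall>\<upsilon> \<eta>. 0 < \<upsilon> \<and> \<upsilon> < \<upsilon>\<^sub>0 \<and> cutoff \<upsilon> \<eta> \<longrightarrow>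
      (let \<Omega> = deformed_ball K \<eta>; M = simons_cone in
        frontier \<Omega> = (\<lambda>\<omega>. polar_radius K \<eta> \<omega> *\<^sub>R \<omega>) ` sphere 0 1 \<and>
        \<not> convex \<Omega> \<and>
        M \<inter> frontier \<Omega> = M \<inter> sphere 0 1 \<and>
        0 \<in> \<Omega> \<and> singular_point M 0 \<and>
        (\<forall>N\<in>simons_sides.
          frontier N = M \<and> boundary_mod_null N = M \<and>
          boundary_trace \<Omega> N = M \<inter> frontier \<Omega> \<and>
          (\<exists>\<delta>>0. \<forall>N'. competitor \<delta> \<Omega> N N' \<longrightarrow>
             boundary_mod_null N' \<inter> \<Omega> \<noteq> M \<inter> \<Omega> \<longrightarrow>
             perimeter \<Omega> N < perimeter \<Omega> N') \<and>
          C0_local_perimeter_minimizer \<Omega> N \<and>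
          C0_local_volume_constrained_minimizer \<Omega> N))) \<and>
    (\<forall>\<epsilon>>0. \<exists>\<upsilon> \<eta>. 0 < \<upsilon> \<and> \<upsilon> < \<upsilon>\<^sub>0 \<and> cutoff \<upsilon> \<eta> \<and>
       (\<forall>\<omega>\<in>sphere 0 1. \<bar>polar_radius K \<eta> \<omega> - 1\<bar> < \<epsilon>))"
proof (rule exI[of _ "1 / 4"], rule conjI[rotated], rule exI[of _ 4], intro conjI allI impI, goal_cases)
  case (2 K \<upsilon> \<eta>)
  then have K: "4 \<le> K" and A: "0 < \<upsilon>" "\<upsilon> < 1 / 4" "cutoff \<upsilon> \<eta>" by auto
  show ?case
    unfolding Let_def
  proof (intro conjI ballI deformed_ball_geometry[OF K A] deformed_ball_minimizer(1-3)[OF K A])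
    fix N assume "N \<in> simons_sides"
    then obtain \<delta> where "\<delta> > 0"
      "\<And>E. competitor \<delta> (deformed_ball K \<eta>) N E \<Longrightarrow>
         perimeter (deformed_ball K \<eta>) N \<le> perimeter (deformed_ball K \<eta>) E \<and>
         (boundary_mod_null E \<inter> deformed_ball K \<eta> \<noteq> simons_cone \<inter> deformed_ball K \<eta> \<longrightarrow>
           perimeter (deformed_ball K \<eta>) N < perimeter (deformed_ball K \<eta>) E)"
      using deformed_ball_minimizer(4)[OF K A] by blast
    note \<delta> = this
    show "\<exists>\<delta>>0. \<forall>N'. competitor \<delta> (deformed_ball K \<eta>) N N' \<longrightarrow>
        boundary_mod_null N' \<inter> deformed_ball K \<eta> \<noteq> simons_cone \<inter> deformed_ball K \<eta> \<longrightarrow>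
        perimeter (deformed_ball K \<eta>) N < perimeter (deformed_ball K \<eta>) N'"
      using \<delta> by (intro exI[of _ \<delta>]) simp
    show "C0_local_perimeter_minimizer (deformed_ball K \<eta>) N"
      unfolding C0_local_perimeter_minimizer_def using \<delta> by (intro exI[of _ \<delta>]) simp
    show "C0_local_volume_constrained_minimizer (deformed_ball K \<eta>) N"
      unfolding C0_local_volume_constrained_minimizer_def using \<delta> by (intro exI[of _ \<delta>]) simp
  qed
next
  case (3 K \<epsilon>)
  then obtain \<upsilon> \<eta> where "0 < \<upsilon>" "\<upsilon> < 1 / 4" "cutoff \<upsilon> \<eta>" "\<And>\<omega>. \<bar>polar_radius K \<eta> \<omega> - 1\<bar> < \<epsilon>"
    by (elim polar_radius_close[of K \<epsilon>, rotated]) auto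
  then show ?case by blast
qed auto

end
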